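(* Let $f:\mathbb{R}^+\to\mathbb{R}$ be smooth with $f(s)f'(s)\neq0$ for all $s\in\mathbb{R}^+$. For every closed maximal solution $\mathcal{C}$ of $\kappa=f(r)$ the following are equivalent: (i) $\mathcal{C}$ is untwisted, and $\omega_f(\mathcal{C})=0$ or $\omega_f(\mathcal{C})=1/n$ for some $n\in\mathbb{N}\setminus\{1\}$; (ii) $\mathcal{C}$ is a Jordan solution. Moreover, $\omega_f(\mathcal{C})=0$ if and only if $\mathcal{C}$ is a circle of radius $|z|$ centered at $0$, with $z\in\mathbb{F}_f$, oriented counter-clockwise when $z>0$, and clockwise when $z<0$.
   Context: $\mathbb{R}^+=\,]0,\infty[$, $\mathbb{N}=\{1,2,\dots\}$; smooth means $C^\infty$. Flow. $\mathbb{F}_f=\{z\in\mathbb{C}\setminus\{0\}:zf(|z|)=1\}$, a subset of the real axis. The ODE $\dot z=izf(|z|)-i$ on $\mathbb{C}\setminus\{0\}$ generates a unique topological flow $\Phi_f$ on $\mathbb{C}$ (a continuous one-parameter group of homeomorphisms, with $t\mapsto\Phi_f(t,z)$ satisfying the ODE whenever $\Phi_f(t,z)\neq0$). Let $T_f(z)=\inf\{t>0:\Phi_f(t,z)=z\}$ ($\inf\varnothing=\infty$), $\mathrm{Per}\,\Phi_f=\{T_f<\infty\}$, $\mathrm{Fix}\,\Phi_f=\{T_f=0\}$. For $z\in\mathrm{Per}\,\Phi_f$ the orbit $\Phi_f(\mathbb{R},z)$ is untwisted if $0$ lies in the exterior of the closed path $\Phi_f(\cdot,z)$, and twisted otherwise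 (in particular if it contains $0$). For $z\in\mathrm{Per}\,\Phi_f$ the net winding is $\omega_f(z)=\pm\frac1{2\pi}\int_0^{T_f(z)}f(|\Phi_f(t,z)|)\,dt$, with sign $+$ (respectively $-$) if $\Phi_f(\cdot,z)$ is oriented counter-clockwise (respectively clockwise), and $\omega_f(z)=0$ for $z\in\mathrm{Fix}\,\Phi_f$. (Since $f$ has constant sign the integral is well-defined in the extended reals, also if the orbit contains $0$.) Curves. Let $c:\mathbb{J}_c\to\mathbb{C}$ be a smooth path parametrized by arc length, where $\mathbb{J}_c\subset\mathbb{R}$ is an open interval with $0\in\mathbb{J}_c$. Two such paths $c,\widehat c$ are equivalent if $\mathbb{J}_{\widehat c}=\alpha+\mathbb{J}_c$ for some $\alpha\in\mathbb{R}$ and $\widehat c(t)=c(t-\alpha)$ for all $t\in\mathbb{J}_{\widehat c}$; an equivalence class $\mathcal{C}$ is an oriented smooth curve, and $[\mathcal{C}]=c(\mathbb{J}_c)$ for $c\in\mathcal{C}$. Write $\dot c=e^{i\vartheta_c}$ with $\vartheta_c$ smooth, and let $\kappa_c=\dot\vartheta_c$ (curvature). $\mathcal{C}$ is a solution of $\kappa=f(r)$ if $\kappa_c(t)=f(|c(t)|)$ for all $t\in\mathbb{J}_c$ with $c(t)\ne0$. A solution $\mathcal{C}$ is maximal if $[\mathcal{C}]\subset[\widehat{\mathcal{C}}]$ for a solution $\widehat{\mathcal{C}}$ implies $[\mathcal{C}]=[\widehat{\mathcal{C}}]$; closed if $[\mathcal{C}]$ is compact. A Jordan solution is a maximal solution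 $\mathcal{C}$ with $[\mathcal{C}]$ homeomorphic to the unit circle. Correspondence. For $c\in\mathcal{C}$ let $z_c(t)=-i\,\overline{c(t)}e^{i\vartheta_c(t)}$. If $\mathcal{C}$ is a closed maximal solution then $z_c(0)\in\mathrm{Per}\,\Phi_f$ lies in the same $\Phi_f$-orbit for every $c\in\mathcal{C}$; $\mathcal{C}$ is called (un)twisted if $\Phi_f(\mathbb{R},z_c(0))$ is (un)twisted, and $\omega_f(\mathcal{C}):=\omega_f(z_c(0))$. *)

theory Defs
  imports "HOL-Complex_Analysis.Complex_Analysis"
begin

text \<open>Iterated derivatives are two-sided, so this is the usual notion for open sets \<open>S\<close> only.\<close>

definition smooth_on :: "real set \<Rightarrow> (real \<Rightarrow> 'a::real_normed_vector) \<Rightarrow> bool" where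
  "smooth_on S g \<longleftrightarrow>
     (\<forall>n. \<forall>t\<in>S. ((\<lambda>h t. vector_derivative h (at t)) ^^ n) g differentiable (at t))"


section \<open>The flow of \<open>z' = i z f(|z|) - i\<close>\<close>

definition Feq :: "(real \<Rightarrow> real) \<Rightarrow> complex set" where
  "Feq f = {z. z \<noteq> 0 \<and> z * complex_of_real (f (cmod z)) = 1}"

text \<open>
  \<open>generates_flow f \<Phi>\<close>: \<open>\<Phi>\<close> is the topological flow on the whole plane generated by the ODE on the
  punctured plane. By the group law each \<open>\<Phi> t\<close> has the continuous inverse \<open>\<Phi> (- t)\<close> and is
  therefore a homeomorphism.
\<close>

definition generates_flow :: "(real \<Rightarrow> real) \<Rightarrow> (real \<Rightarrow> complex \<Rightarrow> complex) \<Rightarrow> bool" where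
  "generates_flow f \<Phi> \<longleftrightarrow>
     continuous_on UNIV (\<lambda>(t, z). \<Phi> t z) \<and>
     (\<forall>z. \<Phi> 0 z = z) \<and>
     (\<forall>s t z. \<Phi> (s + t) z = \<Phi> s (\<Phi> t z)) \<and>
     (\<forall>t z. \<Phi> t z \<noteq> 0 \<longrightarrow>
        ((\<lambda>s. \<Phi> s z) has_vector_derivative
           (\<i> * \<Phi> t z * complex_of_real (f (cmod (\<Phi> t z))) - \<i>)) (at t))"

definition period :: "(real \<Rightarrow> complex \<Rightarrow> complex) \<Rightarrow> complex \<Rightarrow> ereal" where
  "period \<Phi> z = Inf {ereal t | t. t > 0 \<and> \<Phi> t z = z}"

definition Per :: "(real \<Rightarrow> complex \<Rightarrow> complex) \<Rightarrow> complex set" where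
  "Per \<Phi> = {z. period \<Phi> z < \<infinity>}"

definition Fix :: "(real \<Rightarrow> complex \<Rightarrow> complex) \<Rightarrow> complex set" where
  "Fix \<Phi> = {z. period \<Phi> z = 0}"

text \<open>
  The closed path \<open>\<Phi>(\<cdot>, z)\<close>, one period rescaled to the unit interval; meaningful for \<open>z\<close> in
  \<open>Per \<Phi>\<close>, and constant for \<open>z\<close> in \<open>Fix \<Phi>\<close>.
\<close>

definition orbit_path :: "(real \<Rightarrow> complex \<Rightarrow> complex) \<Rightarrow> complex \<Rightarrow> real \<Rightarrow> complex" where
  "orbit_path \<Phi> z = (\<lambda>s. \<Phi> (s * real_of_ereal (period \<Phi> z)) z)"

definition untwisted_orbit :: "(real \<Rightarrow> complex \<Rightarrow> complex) \<Rightarrow> complex \<Rightarrow> bool" where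
  "untwisted_orbit \<Phi> z \<longleftrightarrow> z \<in> Per \<Phi> \<and> 0 \<in> outside (path_image (orbit_path \<Phi> z))"

text \<open>Orientation of a simple closed path; the alternative value of the winding number is \<open>- 1\<close>.\<close>

definition counter_clockwise :: "(real \<Rightarrow> complex) \<Rightarrow> bool" where
  "counter_clockwise \<gamma> \<longleftrightarrow> (\<forall>w \<in> inside (path_image \<gamma>). winding_number \<gamma> w = 1)"

definition ext_integral :: "real set \<Rightarrow> (real \<Rightarrow> real) \<Rightarrow> ereal" where
  "ext_integral A g =
     enn2ereal (\<integral>\<^sup>+t\<in>A. ennreal (g t) \<partial>lborel) - enn2ereal (\<integral>\<^sup>+t\<in>A. ennreal (- g t) \<partial>lborel)"

text \<open>
  Meaningful for \<open>z\<close> in \<open>Per \<Phi>\<close>. A non-constant orbit meets \<open>0\<close> at most once per period, so the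
  value \<open>f 0\<close> is irrelevant.
\<close>

definition net_winding ::
  "(real \<Rightarrow> real) \<Rightarrow> (real \<Rightarrow> complex \<Rightarrow> complex) \<Rightarrow> complex \<Rightarrow> ereal" where
  "net_winding f \<Phi> z =
     (if z \<in> Fix \<Phi> then 0
      else (if counter_clockwise (orbit_path \<Phi> z) then 1 else - 1) *
           (ereal (1 / (2 * pi)) *
            ext_integral {0 .. real_of_ereal (period \<Phi> z)} (\<lambda>t. f (cmod (\<Phi> t z)))))"


section \<open>Oriented curves\<close>

text \<open>
  A path is a pair \<open>(J, c)\<close>; the values of \<open>c\<close> outside \<open>J\<close> carry no meaning, and \<open>same_curve\<close>
  ignores them.
\<close>

type_synonym path_on = "real set \<times> (real \<Rightarrow> complex)"

definition arclength_paths :: "path_on set" where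
  "arclength_paths = {(J, c). open J \<and> is_interval J \<and> 0 \<in> J \<and> smooth_on J c \<and>
     (\<forall>t\<in>J. norm (vector_derivative c (at t)) = 1)}"

definition same_curve :: "(path_on \<times> path_on) set" where
  "same_curve = {((J, c), (J', c')). (J, c) \<in> arclength_paths \<and> (J', c') \<in> arclength_paths \<and>
     (\<exists>\<alpha>. J' = (\<lambda>t. \<alpha> + t) ` J \<and> (\<forall>t\<in>J'. c' t = c (t - \<alpha>)))}"

definition oriented_curves :: "path_on set set" where
  "oriented_curves = arclength_paths // same_curve"

text \<open>All members of an oriented curve have the same image.\<close>

definition trace :: "path_on set \<Rightarrow> complex set" where
  "trace C = (\<Union>(J, c)\<in>C. c ` J)"

text \<open>A smooth tangent angle, determined on \<open>J\<close> up to an integer multiple of \<open>2 \<pi>\<close>.\<close>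

definition tangent_angle :: "path_on \<Rightarrow> real \<Rightarrow> real" where
  "tangent_angle = (\<lambda>(J, c). SOME \<theta>. smooth_on J \<theta> \<and>
     (\<forall>t\<in>J. vector_derivative c (at t) = cis (\<theta> t)))"

definition curvature :: "path_on \<Rightarrow> real \<Rightarrow> real" where
  "curvature p t = deriv (tangent_angle p) t"

definition solution :: "(real \<Rightarrow> real) \<Rightarrow> path_on set \<Rightarrow> bool" where
  "solution f C \<longleftrightarrow> C \<in> oriented_curves \<and>
     (\<forall>(J, c)\<in>C. \<forall>t\<in>J. c t \<noteq> 0 \<longrightarrow> curvature (J, c) t = f (cmod (c t)))"

definition maximal_solution :: "(real \<Rightarrow> real) \<Rightarrow> path_on set \<Rightarrow> bool" where
  "maximal_solution f C \<longleftrightarrow> solution f C \<and>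
     (\<forall>C'. solution f C' \<and> trace C \<subseteq> trace C' \<longrightarrow> trace C = trace C')"

definition closed_curve :: "path_on set \<Rightarrow> bool" where
  "closed_curve C \<longleftrightarrow> compact (trace C)"

definition Jordan_solution :: "(real \<Rightarrow> real) \<Rightarrow> path_on set \<Rightarrow> bool" where
  "Jordan_solution f C \<longleftrightarrow>
     maximal_solution f C \<and> trace C homeomorphic (sphere 0 1 :: complex set)"

text \<open>The circle of radius \<open>r > 0\<close> centered at \<open>0\<close>, traversed in the respective direction.\<close>

definition ccw_circle :: "real \<Rightarrow> path_on set \<Rightarrow> bool" where
  "ccw_circle r C \<longleftrightarrow> trace C = sphere 0 r \<and>
     (\<forall>(J, c)\<in>C. \<exists>\<alpha>. \<forall>t\<in>J. c t = complex_of_real r * cis (\<alpha> + t / r))"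

definition cw_circle :: "real \<Rightarrow> path_on set \<Rightarrow> bool" where
  "cw_circle r C \<longleftrightarrow> trace C = sphere 0 r \<and>
     (\<forall>(J, c)\<in>C. \<exists>\<alpha>. \<forall>t\<in>J. c t = complex_of_real r * cis (\<alpha> - t / r))"


section \<open>From curves to flow orbits\<close>

definition zpath :: "path_on \<Rightarrow> real \<Rightarrow> complex" where
  "zpath p t = - \<i> * cnj (snd p t) * cis (tangent_angle p t)"

text \<open>
  \<open>z\<^sub>c(0)\<close> for a representative \<open>c\<close> of \<open>C\<close>. For a closed maximal solution the
  orbit of this point does not depend on the representative, hence neither do the notions below.
\<close>

definition base_point :: "path_on set \<Rightarrow> complex" where
  "base_point C = zpath (SOME p. p \<in> C) 0"

definition untwisted :: "(real \<Rightarrow> complex \<Rightarrow> complex) \<Rightarrow> path_on set \<Rightarrow> bool" where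
  "untwisted \<Phi> C \<longleftrightarrow> untwisted_orbit \<Phi> (base_point C)"

definition curve_winding ::
  "(real \<Rightarrow> real) \<Rightarrow> (real \<Rightarrow> complex \<Rightarrow> complex) \<Rightarrow> path_on set \<Rightarrow> ereal" where
  "curve_winding f \<Phi> C = net_winding f \<Phi> (base_point C)"

end

theory Submission
  imports Defs
begin

text \<open>
  Along a solution \<open>c\<close> with tangent angle \<open>\<theta>\<close> the point \<open>z = - i cnj c e^(i \<theta>)\<close> moves along a flow
  orbit, and \<open>c\<close> is recovered from \<open>z\<close> and \<open>\<theta>\<close>; by maximality a closed solution lives on all of
  \<open>\<real>\<close>, and mirroring reduces everything to positive \<open>f\<close>. The orbit meets the real axis where \<open>|c|\<close>
  is extremal and is symmetric there, so it is either constant or periodic, with \<open>Im z > 0\<close> on one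
  half period \<open>]t1, t2[\<close>. If \<open>D\<close> is the increase of \<open>\<theta>\<close> over a period \<open>T\<close>, then \<open>c (t + T) = e^(i D) c t\<close>
  and the net winding is \<open>D / (2 \<pi>)\<close>.

  If \<open>Re z > 0\<close> throughout (the untwisted case), the polar angle of \<open>c\<close> increases strictly, so \<open>c\<close> is a
  simple closed curve when \<open>D = 2 \<pi> / n\<close>. Conversely, two passages of a Jordan solution through the
  same point have the same tangent, so they differ by a multiple of \<open>T\<close>. A twisted solution would
  violate this where it crosses a symmetry axis between two vertices; in the untwisted case an
  intermediate value argument gives two passages whose polar angles differ by exactly \<open>2 \<pi>\<close>, hence
  \<open>D = 2 \<pi> / n\<close>. Here \<open>n = 1\<close> is excluded by the argument of the four vertex theorem.
\<close>

section \<open>Smooth functions and tangent angles\<close>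

text \<open>Three obstacles shape the proof. The value of \<open>f\<close> at 0 means nothing, yet a
  twisted orbit may run through 0. The curvature is therefore carried as a separate continuous
  function that is tied to \<open>f\<close> only off 0. Zeros of an orbit are isolated, because its
  velocity there is \<open>- i\<close>, so identities and uniqueness for the flow extend across them
  by continuity. Secondly, maximality compares traces and not domains: representatives of a closed
  solution may live on a bounded interval, and the path on the whole line has to be built from the
  flow, its smoothness at a zero being borrowed from the given path. Thirdly, a homeomorphism from
  the trace to the circle says nothing about how \<open>c\<close> runs through the trace. But
  \<open>c\<close> has unit speed and so is locally injective, hence its lift to an angle coordinate
  is strictly monotone; this is what forces equal tangents at equal points. The monotonicity of
  \<open>f\<close> enters through \<open>D_neq_2pi\<close>, which excludes \<open>n = 1\<close> and
  also a tangent turning by exactly \<open>pi\<close> over the half period of a twisted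
  solution.\<close>

lemma smooth_on_mono: "smooth_on S g \<Longrightarrow> T \<subseteq> S \<Longrightarrow> smooth_on T g"
  by (auto simp: smooth_on_def)

lemma smooth_on_locally:
  assumes "\<And>t. t \<in> S \<Longrightarrow> \<exists>U. t \<in> U \<and> smooth_on U g"
  shows "smooth_on S g"
  using assms unfolding smooth_on_def by blast

lemma smooth_on_has_derivative:
  assumes "smooth_on S g" "t \<in> S"
  shows "(g has_vector_derivative vector_derivative g (at t)) (at t)"
proof -
  have "((\<lambda>h t. vector_derivative h (at t)) ^^ 0) g differentiable (at t)"
    using assms unfolding smooth_on_def by blast
  then show ?thesis by (simp add: vector_derivative_works)
qed

lemma smooth_on_continuous: "smooth_on S g \<Longrightarrow> continuous_on S g"
  by (meson continuous_at_imp_continuous_on has_vector_derivative_continuous smooth_on_has_derivative)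

lemma smooth_on_derivative:
  assumes "smooth_on S g"
  shows "smooth_on S (\<lambda>t. vector_derivative g (at t))"
  unfolding smooth_on_def
proof (intro allI ballI)
  fix n t assume "t \<in> S"
  have "((\<lambda>h t. vector_derivative h (at t)) ^^ (Suc n)) g differentiable (at t)"
    using assms \<open>t \<in> S\<close> unfolding smooth_on_def by blast
  then show "((\<lambda>h t. vector_derivative h (at t)) ^^ n) (\<lambda>t. vector_derivative g (at t))
      differentiable (at t)"
    by (simp add: funpow_Suc_right del: funpow.simps)
qed

text \<open>Iterated derivatives rarely have a closed formula. It is enough to find a set of
  functions each of which has, on \<open>S\<close>, a derivative in the set: by induction every
  iterated derivative agrees on \<open>S\<close> with a member. As \<open>S\<close> is open,
  derivatives in \<open>S\<close> depend on the values in \<open>S\<close> only.\<close>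

lemma smooth_on_coinduct:
  assumes S: "open S" and g: "g \<in> X"
    and step: "\<And>h. h \<in> X \<Longrightarrow> \<exists>h'\<in>X. \<forall>t\<in>S. (h has_vector_derivative h' t) (at t)"
  shows "smooth_on S g"
proof -
  let ?d = "\<lambda>h t. vector_derivative h (at t)"
  have deriv: "(p has_vector_derivative h' t) (at t)"
    if "t \<in> S" "\<forall>t\<in>S. p t = h t" "\<forall>t\<in>S. (h has_vector_derivative h' t) (at t)" for p h h' t
    using that S by (metis has_vector_derivative_transform_within_open)
  have ex: "\<exists>h\<in>X. \<forall>t\<in>S. (?d ^^ n) g t = h t" for n
  proof (induction n)
    case 0 show ?case using g by auto
  next
    case (Suc n)
    then obtain h where h: "h \<in> X" "\<forall>t\<in>S. (?d ^^ n) g t = h t" by blast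
    obtain h' where h': "h' \<in> X" "\<forall>t\<in>S. (h has_vector_derivative h' t) (at t)"
      using step[OF h(1)] by blast
    have "\<forall>t\<in>S. (?d ^^ Suc n) g t = h' t"
      using deriv[OF _ h(2) h'(2)] by (simp add: vector_derivative_at)
    then show ?case using h'(1) by blast
  qed
  show ?thesis unfolding smooth_on_def
  proof (intro allI ballI)
    fix n t assume "t \<in> S"
    obtain h where h: "h \<in> X" "\<forall>t\<in>S. (?d ^^ n) g t = h t" using ex by blast
    obtain h' where h': "\<forall>t\<in>S. (h has_vector_derivative h' t) (at t)"
      using step[OF h(1)] by blast
    show "(?d ^^ n) g differentiable (at t)"
      using deriv[OF \<open>t \<in> S\<close> h(2) h'] differentiableI_vector by blast
  qed
qed

lemma smooth_on_from_derivative: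
  assumes "open S" "\<And>t. t \<in> S \<Longrightarrow> (g has_vector_derivative g' t) (at t)" "smooth_on S g'"
  shows "smooth_on S g"
proof (rule smooth_on_coinduct[where X = "insert g {h. smooth_on S h}"])
  fix h assume "h \<in> insert g {h. smooth_on S h}"
  then show "\<exists>h'\<in>insert g {h. smooth_on S h}. \<forall>t\<in>S. (h has_vector_derivative h' t) (at t)"
    using assms smooth_on_derivative smooth_on_has_derivative by (metis insert_iff mem_Collect_eq)
qed (use assms in auto)

lemma smooth_on_cong:
  assumes "open S" "\<And>t. t \<in> S \<Longrightarrow> g t = h t" "smooth_on S h"
  shows "smooth_on S g"
proof (rule smooth_on_from_derivative[OF assms(1)])
  show "smooth_on S (\<lambda>t. vector_derivative h (at t))" by (rule smooth_on_derivative[OF assms(3)])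
  show "(g has_vector_derivative vector_derivative h (at t)) (at t)" if "t \<in> S" for t
    using has_vector_derivative_transform_within_open[OF smooth_on_has_derivative[OF assms(3) that]
      assms(1) that] assms(2) by metis
qed

lemma smooth_on_const: "smooth_on S (\<lambda>t. a)"
  by (rule smooth_on_mono[OF smooth_on_coinduct[where S = UNIV and X = "range (\<lambda>a t. a)"]])
    (auto intro!: exI[of _ 0])

lemma smooth_on_linear:
  assumes "open S" "bounded_linear L" "smooth_on S g"
  shows "smooth_on S (\<lambda>t. L (g t))"
proof (rule smooth_on_coinduct[where X = "{\<lambda>t. L (h t) |h. smooth_on S h}"])
  fix p assume "p \<in> {\<lambda>t. L (h t) |h. smooth_on S h}"
  then obtain h where h: "smooth_on S h" "p = (\<lambda>t. L (h t))" by auto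
  show "\<exists>h'\<in>{\<lambda>t. L (h t) |h. smooth_on S h}. \<forall>t\<in>S. (p has_vector_derivative h' t) (at t)"
    using h smooth_on_derivative[OF h(1)] smooth_on_has_derivative[OF h(1)]
      bounded_linear.has_vector_derivative[OF assms(2)]
    by (intro bexI[of _ "\<lambda>t. L (vector_derivative h (at t))"]) auto
qed (use assms in auto)

lemma smooth_on_shift:
  assumes "open S" "smooth_on S g"
  shows "smooth_on ((\<lambda>t. a + t) ` S) (\<lambda>t. g (t - a))"
proof (rule smooth_on_coinduct[where X = "{\<lambda>t. h (t - a) |h. smooth_on S h}"])
  fix p assume "p \<in> {\<lambda>t. h (t - a) |h. smooth_on S h}"
  then obtain h where h: "smooth_on S h" "p = (\<lambda>t. h (t - a))" by auto
  have *: "(p has_vector_derivative vector_derivative h (at (t - a))) (at t)" if "t - a \<in> S" for t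
  proof -
    have "((\<lambda>t. t - a) has_vector_derivative 1) (at t)"
      by (auto intro!: derivative_eq_intros)
    from vector_diff_chain_at[OF this smooth_on_has_derivative[OF h(1) that]]
    show ?thesis unfolding h(2) o_def by simp
  qed
  then show "\<exists>h'\<in>{\<lambda>t. h (t - a) |h. smooth_on S h}.
      \<forall>t\<in>(\<lambda>t. a + t) ` S. (p has_vector_derivative h' t) (at t)"
    using smooth_on_derivative[OF h(1)] *[of "a + _"]
    by (intro bexI[of _ "\<lambda>t. vector_derivative h (at (t - a))"]) auto
qed (use assms open_translation in \<open>auto\<close>)

text \<open>The product rule turns a product into a sum of two products, so this is a set to which
  \<open>smooth_on_coinduct\<close> applies.\<close>

inductive_set product_sums :: "real set \<Rightarrow> (real \<Rightarrow> 'a::real_normed_algebra) set" for S where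
  "smooth_on S u \<Longrightarrow> smooth_on S v \<Longrightarrow> (\<lambda>t. u t * v t) \<in> product_sums S"
| "p \<in> product_sums S \<Longrightarrow> q \<in> product_sums S \<Longrightarrow> (\<lambda>t. p t + q t) \<in> product_sums S"

lemma smooth_on_product_sums:
  assumes "open S" "p \<in> product_sums S"
  shows "smooth_on S p"
proof (rule smooth_on_coinduct[where X = "product_sums S", OF assms])
  fix h :: "real \<Rightarrow> 'a" assume "h \<in> product_sums S"
  then show "\<exists>h'\<in>product_sums S. \<forall>t\<in>S. (h has_vector_derivative h' t) (at t)"
  proof induction
    case (1 u v)
    show ?case
      using 1 has_vector_derivative_mult smooth_on_has_derivative
      by (intro bexI[of _ "\<lambda>t. u t * vector_derivative v (at t) + vector_derivative u (at t) * v t"])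
        (auto intro!: product_sums.intros smooth_on_derivative has_vector_derivative_mult
          smooth_on_has_derivative)
  next
    case (2 p q)
    then obtain p' q' where "p' \<in> product_sums S" "q' \<in> product_sums S"
      "\<forall>t\<in>S. (p has_vector_derivative p' t) (at t)" "\<forall>t\<in>S. (q has_vector_derivative q' t) (at t)"
      by auto
    then show ?case
      by (intro bexI[of _ "\<lambda>t. p' t + q' t"])
        (auto intro!: product_sums.intros has_vector_derivative_add)
  qed
qed

lemma smooth_on_mult:
  fixes u v :: "real \<Rightarrow> 'a::real_normed_algebra"
  shows "open S \<Longrightarrow> smooth_on S u \<Longrightarrow> smooth_on S v \<Longrightarrow> smooth_on S (\<lambda>t. u t * v t)"
  by (simp add: product_sums.intros(1) smooth_on_product_sums)

lemma smooth_on_add: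
  fixes u v :: "real \<Rightarrow> 'a::real_normed_algebra_1"
  assumes "open S" "smooth_on S u" "smooth_on S v"
  shows "smooth_on S (\<lambda>t. u t + v t)"
proof -
  \<comment> \<open>Only products generate \<open>product_sums\<close>, so each summand is
    multiplied by 1.\<close>
  have "(\<lambda>t. u t * 1 + v t * 1) \<in> product_sums S"
    using assms smooth_on_const by (intro product_sums.intros)
  from smooth_on_product_sums[OF assms(1) this] show ?thesis by simp
qed

section \<open>Unit tangents and their angles\<close>

lemma has_vector_derivative_cis:
  assumes "(\<theta> has_real_derivative d) (at t)"
  shows "((\<lambda>t. cis (\<theta> t)) has_vector_derivative \<i> * of_real d * cis (\<theta> t)) (at t)"
proof -
  have "((\<lambda>t. exp (\<i> * of_real (\<theta> t))) has_vector_derivative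
      (\<i> * of_real d) * exp (\<i> * of_real (\<theta> t))) (at t)"
  proof -
    have "((\<lambda>t. \<i> * of_real (\<theta> t)) has_vector_derivative \<i> * of_real d) (at t)"
      using assms
      by (intro has_vector_derivative_mult_right has_vector_derivative_of_real)
        (simp add: has_real_derivative_iff_has_vector_derivative)
    from field_vector_diff_chain_at[OF this DERIV_exp] show ?thesis
      by (simp add: o_def)
  qed
  then show ?thesis by (simp add: cis_conv_exp)
qed

text \<open>Multiples \<open>h cis \<theta>\<close> with smooth \<open>h\<close> are stable under
  differentiation; the new factor is \<open>h' + i \<theta>' h\<close>.\<close>

lemma smooth_on_cis:
  assumes "open S" "smooth_on S \<theta>"
  shows "smooth_on S (\<lambda>t. cis (\<theta> t))"
proof (rule smooth_on_coinduct[where X = "{\<lambda>t. h t * cis (\<theta> t) |h. smooth_on S h}"])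
  fix p assume "p \<in> {\<lambda>t. h t * cis (\<theta> t) |h. smooth_on S h}"
  then obtain h where h: "smooth_on S h" "p = (\<lambda>t. h t * cis (\<theta> t))" by auto
  let ?q = "\<lambda>t. h t * (\<i> * of_real (vector_derivative \<theta> (at t))) + vector_derivative h (at t)"
  have "(p has_vector_derivative ?q t * cis (\<theta> t)) (at t)" if "t \<in> S" for t
  proof -
    have "((\<lambda>t. cis (\<theta> t)) has_vector_derivative
        \<i> * of_real (vector_derivative \<theta> (at t)) * cis (\<theta> t)) (at t)"
      using smooth_on_has_derivative[OF assms(2) that]
      by (intro has_vector_derivative_cis) (simp add: has_real_derivative_iff_has_vector_derivative)
    from has_vector_derivative_mult[OF smooth_on_has_derivative[OF h(1) that] this]
    show ?thesis unfolding h(2) by (simp add: algebra_simps)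
  qed
  moreover have "smooth_on S ?q"
    using assms h
    by (intro smooth_on_add smooth_on_mult smooth_on_const smooth_on_derivative
        smooth_on_linear[OF _ bounded_linear_of_real]) auto
  ultimately show "\<exists>h'\<in>{\<lambda>t. h t * cis (\<theta> t) |h. smooth_on S h}.
      \<forall>t\<in>S. (p has_vector_derivative h' t) (at t)"
    by (intro bexI[of _ "\<lambda>t. ?q t * cis (\<theta> t)"]) auto
next
  show "(\<lambda>t. cis (\<theta> t)) \<in> {\<lambda>t. h t * cis (\<theta> t) |h. smooth_on S h}"
    by (auto intro!: exI[of _ "\<lambda>t. 1"] smooth_on_const)
qed (use assms in auto)

lemma interval_antiderivative:
  fixes K :: "real \<Rightarrow> real"
  assumes S: "open S" "is_interval S" "t0 \<in> S" and K: "continuous_on S K"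
  obtains F where "\<And>t. t \<in> S \<Longrightarrow> (F has_real_derivative K t) (at t)" "F t0 = v"
proof -
  let ?F = "\<lambda>t::real. v + (LBINT x=t0..t. K x)"
  have F: "(?F has_real_derivative K t) (at t)" if t: "t \<in> S" for t
  proof -
  obtain e where e: "e > 0" "cball t0 e \<subseteq> S" using S open_contains_cball by blast
  obtain d where d: "d > 0" "cball t d \<subseteq> S" using S t open_contains_cball by blast
  \<comment> \<open>\<open>[a, b]\<close> contains \<open>t0\<close> and has \<open>t\<close> in its
    interior, so the fundamental theorem on it gives a two-sided derivative at
    \<open>t\<close>.\<close>
  define a where "a = min (t0 - e) (t - d)"
  define b where "b = max (t0 + e) (t + d)"
  have "t - d \<in> S" "t + d \<in> S" "t0 - e \<in> S" "t0 + e \<in> S"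
    using d(1) e(1) subsetD[OF d(2), of "t - d"] subsetD[OF d(2), of "t + d"]
      subsetD[OF e(2), of "t0 - e"] subsetD[OF e(2), of "t0 + e"]
    by (simp_all add: dist_real_def)
  then have "a \<in> S" "b \<in> S"
    by (auto simp: a_def b_def min_def max_def)
  then have sub: "{a..b} \<subseteq> S" using mem_is_interval_1_I[OF S(2)] by (meson atLeastAtMost_iff subsetI)
  have "a \<le> t0" "t0 \<le> b" "a < t" "t < b" using d e by (auto simp: a_def b_def)
  have "((\<lambda>u. LBINT y=t0..u. K y) has_vector_derivative K t) (at t within {a..b})"
    using \<open>a \<le> t0\<close> \<open>t0 \<le> b\<close> \<open>a < t\<close> \<open>t < b\<close> continuous_on_subset[OF K sub]
    by (intro interval_integral_FTC2) auto
  then have "((\<lambda>u. LBINT y=t0..u. K y) has_vector_derivative K t) (at t)"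
    using \<open>a < t\<close> \<open>t < b\<close> by (simp add: at_within_Icc_at)
  then show ?thesis
    unfolding has_real_derivative_iff_has_vector_derivative
    using has_vector_derivative_add[OF has_vector_derivative_const] by fastforce
  qed
  show thesis by (rule that[of ?F]) (simp_all add: F)
qed

lemma interval_constant:
  fixes F :: "real \<Rightarrow> 'a::real_normed_vector"
  assumes S: "is_interval S" "s \<in> S" "t \<in> S"
    and F: "\<And>t. t \<in> S \<Longrightarrow> (F has_vector_derivative 0) (at t)"
  shows "F s = F t"
proof -
  have "convex S" using S(1) by (rule is_interval_convex)
  moreover have "(F has_derivative (\<lambda>h. 0)) (at t within S)" if "t \<in> S" for t
    using F[OF that] by (auto simp: has_vector_derivative_def intro: has_derivative_at_withinI)
  ultimately show ?thesis using has_derivative_zero_unique[of S F] S by metis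
qed

text \<open>The angle is the integral \<open>F\<close> of the curvature
  \<open>Im (c'' cnj c')\<close>, started at the argument of \<open>c' 0\<close>. Differentiating
  \<open>c' cnj c' = 1\<close> shows that \<open>c'' = i K c'\<close>, so
  \<open>c' cis (- F)\<close> is constant with value 1.\<close>

lemma tangent_angle_exists:
  assumes "(J, c) \<in> arclength_paths"
  shows "\<exists>\<theta>. smooth_on J \<theta> \<and> (\<forall>t\<in>J. vector_derivative c (at t) = cis (\<theta> t))"
proof -
  have J: "open J" "is_interval J" "0 \<in> J" and c: "smooth_on J c"
    and c1: "\<And>t. t \<in> J \<Longrightarrow> norm (vector_derivative c (at t)) = 1"
    using assms by (auto simp: arclength_paths_def)
  let ?d = "\<lambda>t. vector_derivative c (at t)" and ?dd = "\<lambda>t. vector_derivative (\<lambda>t. vector_derivative c (at t)) (at t)"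
  let ?K = "\<lambda>t. Im (?dd t * cnj (?d t))"
  have smd: "smooth_on J ?d" "smooth_on J ?dd" using c by (auto intro: smooth_on_derivative)
  have smK: "smooth_on J ?K"
    using J smd by (intro smooth_on_linear[OF _ bounded_linear_Im] smooth_on_mult
        smooth_on_linear[OF _ bounded_linear_cnj]) auto
  obtain F where F: "\<And>t. t \<in> J \<Longrightarrow> (F has_real_derivative ?K t) (at t)" "F 0 = Arg (?d 0)"
    using interval_antiderivative[OF J smooth_on_continuous[OF smK]] by metis
  have smF: "smooth_on J F"
    using F(1) smK J by (intro smooth_on_from_derivative[of J F ?K])
      (auto simp: has_real_derivative_iff_has_vector_derivative)
  have unit: "?d t * cnj (?d t) = 1" if "t \<in> J" for t
    using c1[OF that] by (simp add: complex_norm_square[symmetric])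
  have zero: "?dd t = \<i> * of_real (?K t) * ?d t" if t: "t \<in> J" for t
  proof -
    have d: "(?d has_vector_derivative ?dd t) (at t)" by (rule smooth_on_has_derivative[OF smd(1) t])
    have "((\<lambda>t. ?d t * cnj (?d t)) has_vector_derivative (?d t * cnj (?dd t) + ?dd t * cnj (?d t))) (at t)"
      by (intro has_vector_derivative_mult d has_vector_derivative_cnj)
    moreover have "((\<lambda>t. ?d t * cnj (?d t)) has_vector_derivative 0) (at t)"
      by (rule has_vector_derivative_transform_within_open[OF has_vector_derivative_const[of 1] J(1) t])
        (simp add: unit)
    ultimately have "?d t * cnj (?dd t) + ?dd t * cnj (?d t) = 0"
      by (rule vector_derivative_unique_at)
    then have "Re (?dd t * cnj (?d t)) = 0"
      by (simp add: complex_eq_iff mult.commute)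
    then have "?dd t * cnj (?d t) = \<i> * of_real (?K t)" by (simp add: complex_eq_iff)
    then have "?dd t * cnj (?d t) * ?d t = \<i> * of_real (?K t) * ?d t" by simp
    then show ?thesis using unit[OF t] by (simp add: mult.assoc mult.commute[of "cnj _"])
  qed
  let ?q = "\<lambda>t. ?d t * cis (- F t)"
  have "(?q has_vector_derivative 0) (at t)" if t: "t \<in> J" for t
  proof -
    define k where "k = ?K t"
    have z: "?dd t = \<i> * of_real k * ?d t" unfolding k_def by (rule zero[OF t])
    have "((\<lambda>t. - F t) has_real_derivative - k) (at t)"
      using DERIV_minus[OF F(1)[OF t]] unfolding k_def .
    from has_vector_derivative_mult[OF smooth_on_has_derivative[OF smd(1) t]
        has_vector_derivative_cis[OF this]]
    show ?thesis by (rule back_subst[where P = "\<lambda>x. (_ has_vector_derivative x) _"]) (subst z, simp)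
  qed
  then have "?q t = ?q 0" if "t \<in> J" for t
    using interval_constant[OF J(2) that J(3), of ?q] by blast
  moreover have "?q 0 = 1"
  proof -
    have "?d 0 \<noteq> 0" using c1[OF J(3)] by auto
    then have "cis (F 0) = ?d 0" using c1[OF J(3)] by (simp add: F(2) cis_Arg sgn_eq)
    then have "?q 0 = cis (F 0) * cis (- F 0)" by simp
    then show ?thesis by (simp add: cis_mult)
  qed
  ultimately have q1: "?q t = 1" if "t \<in> J" for t
    using that by simp
  have "?d t = cis (F t)" if "t \<in> J" for t
  proof -
    have "?d t = ?q t * cis (F t)" by (simp add: mult.assoc cis_mult)
    then show ?thesis by (simp only: q1[OF that] mult_1)
  qed
  then show ?thesis using smF by blast
qed

lemma tangent_angle:
  assumes "(J, c) \<in> arclength_paths"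
  shows "smooth_on J (tangent_angle (J, c))"
    and "\<And>t. t \<in> J \<Longrightarrow> vector_derivative c (at t) = cis (tangent_angle (J, c) t)"
    and "\<And>t. t \<in> J \<Longrightarrow> (c has_vector_derivative cis (tangent_angle (J, c) t)) (at t)"
    and "\<And>t. t \<in> J \<Longrightarrow> (tangent_angle (J, c) has_real_derivative curvature (J, c) t) (at t)"
proof -
  have *: "smooth_on J (tangent_angle (J, c)) \<and>
      (\<forall>t\<in>J. vector_derivative c (at t) = cis (tangent_angle (J, c) t))"
    unfolding tangent_angle_def prod.case
    by (rule someI_ex[OF tangent_angle_exists[OF assms]])
  then show 1: "smooth_on J (tangent_angle (J, c))"
    and 2: "\<And>t. t \<in> J \<Longrightarrow> vector_derivative c (at t) = cis (tangent_angle (J, c) t)" by auto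
  show "(c has_vector_derivative cis (tangent_angle (J, c) t)) (at t)" if "t \<in> J" for t
    using 2[OF that] assms smooth_on_has_derivative[of J c t] that by (auto simp: arclength_paths_def)
  show "(tangent_angle (J, c) has_real_derivative curvature (J, c) t) (at t)" if "t \<in> J" for t
    using smooth_on_has_derivative[OF 1 that] unfolding curvature_def
    by (metis DERIV_imp_deriv has_real_derivative_iff_has_vector_derivative)
qed

text \<open>\<open>tangent_angle\<close> is an arbitrary choice, so curvatures have to be computed
  from other angle functions. Comparing the derivatives of the tangent vector, rather than of the
  angles, avoids the unknown multiple of \<open>2 pi\<close> between them.\<close>

lemma curvature_eqI:
  assumes c: "(J, c) \<in> arclength_paths"
    and \<theta>: "\<And>t. t \<in> J \<Longrightarrow> (c has_vector_derivative cis (\<theta> t)) (at t)"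
    and t: "t \<in> J" "(\<theta> has_real_derivative k) (at t)"
  shows "curvature (J, c) t = k"
proof -
  have J: "open J" using c by (auto simp: arclength_paths_def)
  have eq: "cis (tangent_angle (J, c) s) = cis (\<theta> s)" if "s \<in> J" for s
    using \<theta>[OF that] tangent_angle(3)[OF c that] vector_derivative_unique_at by blast
  have "((\<lambda>t. cis (\<theta> t)) has_vector_derivative
      \<i> * of_real (curvature (J, c) t) * cis (tangent_angle (J, c) t)) (at t)"
    using has_vector_derivative_transform_within_open[OF
        has_vector_derivative_cis[OF tangent_angle(4)[OF c t(1)]] J t(1)] eq by metis
  then have "\<i> * of_real (curvature (J, c) t) * cis (\<theta> t) = \<i> * of_real k * cis (\<theta> t)"
    using has_vector_derivative_cis[OF t(2)] eq[OF t(1)] vector_derivative_unique_at by metis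
  then show ?thesis by simp
qed

section \<open>Uniqueness for the flow\<close>

lemma has_vector_derivative_shift:
  assumes "(g has_vector_derivative d) (at (t + a))"
  shows "((\<lambda>s. g (s + a)) has_vector_derivative d) (at t)"
proof -
  have "((\<lambda>s. s + a) has_vector_derivative 1) (at t)"
    by (auto intro!: derivative_eq_intros)
  from vector_diff_chain_at[OF this, of g d] assms show ?thesis by (simp add: o_def)
qed

lemma has_vector_derivative_reflect:
  assumes "(g has_vector_derivative d) (at (a - t))"
  shows "((\<lambda>s. g (a - s)) has_vector_derivative - d) (at t)"
proof -
  have "((\<lambda>s. a - s) has_vector_derivative - 1) (at t)"
    by (auto intro!: derivative_eq_intros)
  from vector_diff_chain_at[OF this, of g d] assms show ?thesis by (simp add: o_def)
qed

lemma has_real_derivative_Re: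
  "(v has_vector_derivative d) (at t) \<Longrightarrow> ((\<lambda>t. Re (v t)) has_real_derivative Re d) (at t)"
  by (simp add: bounded_linear.has_vector_derivative[OF bounded_linear_Re]
      has_real_derivative_iff_has_vector_derivative)

lemma has_real_derivative_Im:
  "(v has_vector_derivative d) (at t) \<Longrightarrow> ((\<lambda>t. Im (v t)) has_real_derivative Im d) (at t)"
  by (simp add: bounded_linear.has_vector_derivative[OF bounded_linear_Im]
      has_real_derivative_iff_has_vector_derivative)

lemma has_real_derivative_cmod_square:
  assumes "(v has_vector_derivative d) (at t)"
  shows "((\<lambda>t. (cmod (v t))\<^sup>2) has_real_derivative 2 * Re (cnj (v t) * d)) (at t)"
  unfolding cmod_power2
  using DERIV_add[OF DERIV_power[OF has_real_derivative_Re[OF assms], of 2]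
      DERIV_power[OF has_real_derivative_Im[OF assms], of 2]]
  by (simp add: algebra_simps)

lemma has_real_derivative_cmod:
  assumes "(v has_vector_derivative d) (at t)" "v t \<noteq> 0"
  shows "((\<lambda>t. cmod (v t)) has_real_derivative Re (cnj (v t) * d) / cmod (v t)) (at t)"
proof -
  have "0 < (cmod (v t))\<^sup>2" using assms(2) by simp
  from DERIV_chain2[OF DERIV_real_sqrt[OF this] has_real_derivative_cmod_square[OF assms(1)]]
  have "((\<lambda>t. cmod (v t)) has_real_derivative
      inverse (cmod (v t)) / 2 * (2 * Re (cnj (v t) * d))) (at t)"
    unfolding real_sqrt_abs abs_norm_cancel .
  moreover have "inverse (cmod (v t)) / 2 * (2 * x) = x / cmod (v t)" for x
    by (simp add: field_simps)
  ultimately show ?thesis by (simp only:)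
qed

text \<open>The summand \<open>- i\<close> is \<open>- i cnj c' c'\<close> with \<open>c'\<close> of
  length 1; the other one comes from the turning of the tangent. With \<open>k = f (|c|)\<close>
  this is the ODE of the flow, since the transformed point has the modulus of
  \<open>c\<close>.\<close>

lemma rolling_derivative:
  assumes "(c has_vector_derivative cis (\<theta> t)) (at t)" "(\<theta> has_real_derivative k) (at t)"
  shows "((\<lambda>t. - \<i> * cnj (c t) * cis (\<theta> t)) has_vector_derivative
    \<i> * of_real k * (- \<i> * cnj (c t) * cis (\<theta> t)) - \<i>) (at t)"
proof -
  have "((\<lambda>t. - \<i> * cnj (c t) * cis (\<theta> t)) has_vector_derivative
     (- \<i> * cnj (c t)) * (\<i> * of_real k * cis (\<theta> t)) + (- \<i> * cnj (cis (\<theta> t))) * cis (\<theta> t)) (at t)"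
    by (intro has_vector_derivative_mult has_vector_derivative_mult_right has_vector_derivative_cnj
        assms has_vector_derivative_cis)
  moreover have "(- \<i> * cnj (c t)) * (\<i> * of_real k * cis (\<theta> t)) + (- \<i> * cnj (cis (\<theta> t))) * cis (\<theta> t)
      = \<i> * of_real k * (- \<i> * cnj (c t) * cis (\<theta> t)) - \<i>"
  proof -
    have "cnj (cis (\<theta> t)) * cis (\<theta> t) = 1" by (simp add: cis_cnj cis_mult)
    then have "(- \<i> * cnj (cis (\<theta> t))) * cis (\<theta> t) = - \<i>" by (simp only: mult.assoc mult_1_right)
    moreover have "(- \<i> * cnj (c t)) * (\<i> * of_real k * cis (\<theta> t)) = \<i> * of_real k * (- \<i> * cnj (c t) * cis (\<theta> t))"
      by (simp only: mult_ac)
    ultimately show ?thesis by (simp only: diff_conv_add_uminus)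
  qed
  ultimately show ?thesis by (simp only:)
qed

text \<open>For fixed \<open>\<theta>\<close> the map is a reflection of the plane, hence its own
  inverse.\<close>

lemma rolling_inverse:
  fixes w :: complex and \<theta> :: real
  assumes "w = - \<i> * cnj c * cis \<theta>"
  shows "c = - \<i> * cnj w * cis \<theta>"
proof -
  have "cnj w = \<i> * (c * cis (- \<theta>))" by (simp add: assms cis_cnj)
  then have "- \<i> * cnj w * cis \<theta> = c * (cis (- \<theta>) * cis \<theta>)"
    by (simp add: mult.assoc)
  then show ?thesis by (simp add: cis_mult)
qed

text \<open>Gronwall's argument in both time directions: \<open>d exp (- C t)\<close> does not
  increase and \<open>d exp (C t)\<close> does not decrease, so the nonnegative \<open>d\<close>
  stays 0 on either side of \<open>s\<close>.\<close>

lemma gronwall_zero: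
  fixes d :: "real \<Rightarrow> real"
  assumes S: "is_interval S" "s \<in> S" "t \<in> S"
    and d: "\<And>t. t \<in> S \<Longrightarrow> (d has_real_derivative d' t) (at t)"
      "\<And>t. t \<in> S \<Longrightarrow> \<bar>d' t\<bar> \<le> C * d t" "\<And>t. t \<in> S \<Longrightarrow> 0 \<le> d t"
    and "d s = 0"
  shows "d t = 0"
proof (cases "s \<le> t")
  case True
  have "d t * exp (- C * t) \<le> d s * exp (- C * s)"
  proof (rule DERIV_nonpos_imp_nonincreasing[OF True])
    fix x assume "s \<le> x" "x \<le> t"
    then have x: "x \<in> S" using mem_is_interval_1_I[OF S(1,2,3)] by blast
    have "((\<lambda>t. d t * exp (- C * t)) has_real_derivative (d' x - C * d x) * exp (- C * x)) (at x)"
      using d(1)[OF x] by (auto intro!: derivative_eq_intros simp: algebra_simps)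
    moreover have "(d' x - C * d x) * exp (- C * x) \<le> 0"
      using d(2)[OF x] by (intro mult_nonpos_nonneg) auto
    ultimately show "\<exists>y. ((\<lambda>t. d t * exp (- C * t)) has_real_derivative y) (at x) \<and> y \<le> 0" by blast
  qed
  then have "d t \<le> 0" using \<open>d s = 0\<close> by (simp add: mult_le_0_iff)
  then show ?thesis using d(3)[OF S(3)] by simp
next
  case False
  then have le: "t \<le> s" by simp
  have "d t * exp (C * t) \<le> d s * exp (C * s)"
  proof (rule DERIV_nonneg_imp_nondecreasing[OF le])
    fix x assume "t \<le> x" "x \<le> s"
    then have x: "x \<in> S" using mem_is_interval_1_I[OF S(1,3,2)] by blast
    have "((\<lambda>t. d t * exp (C * t)) has_real_derivative (d' x + C * d x) * exp (C * x)) (at x)"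
      using d(1)[OF x] by (auto intro!: derivative_eq_intros simp: algebra_simps)
    moreover have "(d' x + C * d x) * exp (C * x) \<ge> 0"
      using d(2)[OF x] by (intro mult_nonneg_nonneg) auto
    ultimately show "\<exists>y. ((\<lambda>t. d t * exp (C * t)) has_real_derivative y) (at x) \<and> 0 \<le> y" by blast
  qed
  then have "d t \<le> 0" using \<open>d s = 0\<close> by (simp add: mult_le_0_iff)
  then show ?thesis using d(3)[OF S(3)] by simp
qed

locale flow =
  fixes f :: "real \<Rightarrow> real" and \<Phi> :: "real \<Rightarrow> complex \<Rightarrow> complex"
  assumes smooth: "smooth_on {0<..} f" and flow: "generates_flow f \<Phi>"
begin

definition rhs :: "complex \<Rightarrow> complex" where
  "rhs z = \<i> * z * of_real (f (cmod z)) - \<i>"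

lemma flow_0: "\<Phi> 0 z = z" and flow_add: "\<Phi> (s + t) z = \<Phi> s (\<Phi> t z)"
  using flow by (auto simp: generates_flow_def)

lemma flow_ode: "\<Phi> t z \<noteq> 0 \<Longrightarrow> ((\<lambda>s. \<Phi> s z) has_vector_derivative rhs (\<Phi> t z)) (at t)"
  using flow by (auto simp: generates_flow_def rhs_def)

lemma continuous_flow:
  assumes "continuous_on S a" "continuous_on S b"
  shows "continuous_on S (\<lambda>t. \<Phi> (a t) (b t))"
proof -
  have "continuous_on UNIV (\<lambda>(t, z). \<Phi> t z)" using flow by (auto simp: generates_flow_def)
  from continuous_on_compose2[OF this, of S "\<lambda>t. (a t, b t)"] show ?thesis
    using assms by (auto intro: continuous_on_Pair)
qed

lemma f_derivative: "s > 0 \<Longrightarrow> (f has_real_derivative deriv f s) (at s)"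
  using smooth_on_has_derivative[OF smooth, of s] DERIV_imp_deriv
    has_real_derivative_iff_has_vector_derivative[of f] by fastforce

lemma continuous_f: "continuous_on {0<..} f"
  by (rule smooth_on_continuous[OF smooth])

lemma continuous_deriv_f: "continuous_on {0<..} (deriv f)"
proof -
  have "continuous_on {0<..} (\<lambda>t. vector_derivative f (at t))"
    by (intro smooth_on_continuous smooth_on_derivative smooth)
  moreover have "vector_derivative f (at s) = deriv f s" if "s \<in> {0<..}" for s
    using f_derivative that by (simp add: has_real_derivative_iff_has_vector_derivative vector_derivative_at)
  ultimately show ?thesis by (rule continuous_on_eq)
qed

lemma rhs_lipschitz:
  assumes "z0 \<noteq> 0"
  obtains e L where "e > 0" "e < cmod z0"
    "\<And>z w. z \<in> ball z0 e \<Longrightarrow> w \<in> ball z0 e \<Longrightarrow> cmod (rhs z - rhs w) \<le> L * cmod (z - w)"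
proof -
  \<comment> \<open>Points closer than \<open>r\<close> to \<open>z0\<close> have modulus in
    \<open>[r, 3 r]\<close>, a compact set on which \<open>f\<close> and its derivative are
    bounded.\<close>
  define r where "r = cmod z0 / 2"
  have r: "r > 0" using assms by (simp add: r_def)
  let ?S = "{r..3 * r}"
  have S: "?S \<subseteq> {0<..}" using r by auto
  have "bounded (f ` ?S)" "bounded (deriv f ` ?S)"
    using continuous_on_subset[OF continuous_f S] continuous_on_subset[OF continuous_deriv_f S]
    by (auto intro!: compact_imp_bounded compact_continuous_image)
  then obtain N M where NM: "\<forall>s\<in>f ` ?S. \<bar>s\<bar> \<le> N" "\<forall>s\<in>deriv f ` ?S. \<bar>s\<bar> \<le> M"
    unfolding bounded_real by metis
  have N: "\<bar>f s\<bar> \<le> N" and M: "\<bar>deriv f s\<bar> \<le> M" if "s \<in> ?S" for s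
    using NM that by blast+
  have lip: "\<bar>f a - f b\<bar> \<le> M * \<bar>a - b\<bar>" if "a \<in> ?S" "b \<in> ?S" for a b
  proof -
    have "(f has_real_derivative deriv f s) (at s within ?S)" if "s \<in> ?S" for s
      using that r by (intro has_field_derivative_at_within[OF f_derivative]) auto
    from field_differentiable_bound[of ?S f "deriv f" M a b, OF convex_real_interval(5) this] M that
    show ?thesis unfolding real_norm_def by blast
  qed
  have M0: "M \<ge> 0" using order_trans[OF abs_ge_zero M[of r]] r by simp
  show thesis
  proof (rule that[of r "3 * r * M + N"])
    fix z w assume z: "z \<in> ball z0 r" and w: "w \<in> ball z0 r"
    have "dist z0 z < r" "dist z0 w < r" using z w by auto
    then have zS: "cmod z \<in> ?S" and wS: "cmod w \<in> ?S"
      using norm_triangle_ineq3[of z0 z] norm_triangle_ineq3[of z0 w]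
      by (auto simp: r_def dist_norm abs_le_iff)
    have "rhs z - rhs w = \<i> * (z * of_real (f (cmod z) - f (cmod w)) + (z - w) * of_real (f (cmod w)))"
      by (simp add: rhs_def algebra_simps)
    then have "cmod (rhs z - rhs w) \<le>
        cmod z * \<bar>f (cmod z) - f (cmod w)\<bar> + cmod (z - w) * \<bar>f (cmod w)\<bar>"
      by (metis (no_types, lifting) norm_mult norm_ii mult_1 norm_of_real norm_triangle_ineq)
    also have "\<dots> \<le> (3 * r) * (M * cmod (z - w)) + cmod (z - w) * N"
    proof (intro add_mono mult_mono)
      have "M * \<bar>cmod z - cmod w\<bar> \<le> M * cmod (z - w)"
        using M0 norm_triangle_ineq3 by (intro mult_left_mono)
      then show "\<bar>f (cmod z) - f (cmod w)\<bar> \<le> M * cmod (z - w)"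
        using lip[OF zS wS] by linarith
    qed (use zS wS N r in auto)
    finally show "cmod (rhs z - rhs w) \<le> (3 * r * M + N) * cmod (z - w)"
      by (simp add: algebra_simps)
  qed (use r in \<open>auto simp: r_def\<close>)
qed

lemma rhs_unique_local:
  assumes "z0 \<noteq> 0" "u t0 = z0" "w t0 = z0" "t0 \<in> S" "open S"
    and u: "continuous_on S u" "\<And>t. t \<in> S \<Longrightarrow> u t \<noteq> 0 \<Longrightarrow> (u has_vector_derivative rhs (u t)) (at t)"
    and w: "continuous_on S w" "\<And>t. t \<in> S \<Longrightarrow> w t \<noteq> 0 \<Longrightarrow> (w has_vector_derivative rhs (w t)) (at t)"
  shows "eventually (\<lambda>t. u t = w t) (nhds t0)"
proof -
  obtain e L where e: "e > 0" "e < cmod z0" and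
    L: "\<And>z w. z \<in> ball z0 e \<Longrightarrow> w \<in> ball z0 e \<Longrightarrow> cmod (rhs z - rhs w) \<le> L * cmod (z - w)"
    using rhs_lipschitz[OF \<open>z0 \<noteq> 0\<close>] by blast
  have "open (S \<inter> u -` ball z0 e \<inter> (S \<inter> w -` ball z0 e))"
    using \<open>open S\<close> u w by (intro open_Int continuous_open_preimage) auto
  moreover have "t0 \<in> S \<inter> u -` ball z0 e \<inter> (S \<inter> w -` ball z0 e)"
    using assms e by auto
  ultimately obtain \<delta> where \<delta>: "\<delta> > 0" "ball t0 \<delta> \<subseteq> S \<inter> u -` ball z0 e \<inter> (S \<inter> w -` ball z0 e)"
    by (meson open_contains_ball)
  have nz: "z \<noteq> 0" if "z \<in> ball z0 e" for z using that e by auto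
  have sub: "t \<in> S" "u t \<in> ball z0 e" "w t \<in> ball z0 e" if "t \<in> ball t0 \<delta>" for t
    using \<delta>(2) that by auto
  have "(cmod (u t - w t))\<^sup>2 = 0" if t: "t \<in> ball t0 \<delta>" for t
  proof (rule gronwall_zero[where S = "ball t0 \<delta>" and s = t0 and t = t and d = "\<lambda>t. (cmod (u t - w t))\<^sup>2"
      and d' = "\<lambda>t. 2 * Re (cnj (u t - w t) * (rhs (u t) - rhs (w t)))" and C = "2 * L"])
    show "is_interval (ball t0 \<delta>)" by (simp add: is_interval_ball_real)
    fix t assume t: "t \<in> ball t0 \<delta>"
    show "((\<lambda>t. (cmod (u t - w t))\<^sup>2) has_real_derivative
        2 * Re (cnj (u t - w t) * (rhs (u t) - rhs (w t)))) (at t)"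
      using sub[OF t] nz
      by (intro has_real_derivative_cmod_square has_vector_derivative_diff u w) auto
    have "\<bar>Re (cnj (u t - w t) * (rhs (u t) - rhs (w t)))\<bar> \<le> cmod (u t - w t) * cmod (rhs (u t) - rhs (w t))"
      by (metis abs_Re_le_cmod complex_mod_cnj norm_mult)
    also have "\<dots> \<le> cmod (u t - w t) * (L * cmod (u t - w t))"
      using L sub[OF t] by (intro mult_left_mono) auto
    finally show "\<bar>2 * Re (cnj (u t - w t) * (rhs (u t) - rhs (w t)))\<bar> \<le> 2 * L * (cmod (u t - w t))\<^sup>2"
      by (simp add: power2_eq_square algebra_simps)
  qed (use t \<delta> assms in auto)
  then show ?thesis unfolding eventually_nhds
    using \<delta>(1) by (intro exI[of _ "ball t0 \<delta>"]) auto
qed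

text \<open>Pulling \<open>w\<close> back along the flow gives
  \<open>h t = \<Phi> (- t) (w t)\<close>, which is locally constant off the zeros of
  \<open>w\<close> by local uniqueness. At a zero there is no ODE, but the zero is isolated and
  \<open>h\<close> is continuous, so the constants on both sides agree with the value there.\<close>

theorem flow_unique:
  assumes S: "open S" "is_interval S" "s \<in> S" "t \<in> S"
    and w: "continuous_on S w"
      "\<And>t. t \<in> S \<Longrightarrow> w t \<noteq> 0 \<Longrightarrow> (w has_vector_derivative rhs (w t)) (at t)"
    and iso: "\<And>t. t \<in> S \<Longrightarrow> w t = 0 \<Longrightarrow> eventually (\<lambda>s. w s \<noteq> 0) (at t)"
  shows "w t = \<Phi> (t - s) (w s)"
proof -
  define h where "h t = \<Phi> (- t) (w t)" for t
  have hc: "continuous_on S h"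
    unfolding h_def by (intro continuous_flow continuous_intros w)
  have nz: "eventually (\<lambda>s. h s = h t) (nhds t)" if t: "t \<in> S" "w t \<noteq> 0" for t
  proof -
    have "eventually (\<lambda>s. \<Phi> (s - t) (w t) = w s) (nhds t)"
    proof (rule rhs_unique_local[OF t(2)])
      show "continuous_on S (\<lambda>s. \<Phi> (s - t) (w t))" by (intro continuous_flow continuous_intros)
      show "((\<lambda>s. \<Phi> (s - t) (w t)) has_vector_derivative rhs (\<Phi> (s - t) (w t))) (at s)"
        if "\<Phi> (s - t) (w t) \<noteq> 0" for s
        using has_vector_derivative_shift[of "\<lambda>s. \<Phi> s (w t)" _ s "- t"] flow_ode[OF that] by simp
    qed (use S t w flow_0 in auto)
    then show ?thesis
    proof eventually_elim
      case (elim s)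
      have "h s = \<Phi> (- s) (\<Phi> (s - t) (w t))" by (simp add: h_def elim)
      also have "\<dots> = h t" using flow_add[of "- s" "s - t" "w t"] by (simp add: h_def)
      finally show ?case .
    qed
  qed
  have const: "h a = h b" if I: "connected I" "open I" "I \<subseteq> S" "a \<in> I" "b \<in> I"
    and "\<And>t. t \<in> I \<Longrightarrow> w t \<noteq> 0" for I a b
    using I
  proof (intro connected_local_const[of I a b h] ballI)
    fix t assume "t \<in> I"
    then have "eventually (\<lambda>s. h s = h t) (nhds t)" using nz that by blast
    then show "eventually (\<lambda>s. h t = h s) (at t within I)"
      unfolding eventually_at_filter by (auto elim: eventually_mono)
  qed auto
  have "eventually (\<lambda>s. h s = h t) (nhds t)" if t: "t \<in> S" "w t = 0" for t
  proof -
    have "eventually (\<lambda>s. s \<in> S \<and> (s \<noteq> t \<longrightarrow> w s \<noteq> 0)) (nhds t)"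
      using iso[OF t] eventually_nhds_in_open[OF S(1) t(1)]
      unfolding eventually_at_filter by eventually_elim auto
    then obtain d where d: "d > 0" "\<And>s. dist s t < d \<Longrightarrow> s \<in> S \<and> (s \<noteq> t \<longrightarrow> w s \<noteq> 0)"
      by (auto simp: eventually_nhds_metric)
    have "h s = h t" if s: "dist s t < d" for s
    proof -
      \<comment> \<open>One-sided version: \<open>t\<close> is an endpoint of an interval free of
        zeros, and constancy passes to the closure. In the applications the other endpoint is the
        midpoint of \<open>s\<close> and \<open>t + d\<close> or of \<open>s\<close> and
        \<open>t - d\<close>.\<close>
      have *: "h t = h s" if "s \<in> {a<..<b}" "t \<in> {a..b}" "{a..b} \<subseteq> S" "t \<notin> {a<..<b}"
        "\<And>r. r \<in> {a<..<b} \<Longrightarrow> w r \<noteq> 0" for a b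
      proof (rule continuous_constant_on_closure[of "{a<..<b}" h])
        have "a < b" using that by auto
        then have cl: "closure {a<..<b} = {a..b}" by simp
        show "continuous_on (closure {a<..<b}) h" "t \<in> closure {a<..<b}"
          unfolding cl using that hc continuous_on_subset by blast+
        show "h x = h s" if "x \<in> {a<..<b}" for x
          using const[of "{a<..<b}" x s] that \<open>s \<in> {a<..<b}\<close> \<open>{a..b} \<subseteq> S\<close>
            \<open>\<And>r. r \<in> {a<..<b} \<Longrightarrow> w r \<noteq> 0\<close>
          by (meson connected_Ioo open_greaterThanLessThan greaterThanLessThan_subseteq_atLeastAtMost_iff
              order_trans order_refl)
      qed
      consider "s = t" | "s > t" | "s < t" by linarith
      then show ?thesis
      proof cases
        case 2
        show ?thesis using s 2 d by (intro *[symmetric, of t "(s + t + d) / 2"])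
          (auto simp: dist_real_def)
      next
        case 3
        show ?thesis using s 3 d by (intro *[symmetric, of "(s + t - d) / 2" t])
          (auto simp: dist_real_def)
      qed auto
    qed
    then show ?thesis using d(1) unfolding eventually_nhds_metric by blast
  qed
  with nz have near: "eventually (\<lambda>s. h s = h t) (nhds t)" if "t \<in> S" for t using that by blast
  have "eventually (\<lambda>s. h t = h s) (at t within S)" if "t \<in> S" for t
    using near[OF that] unfolding eventually_at_filter by eventually_elim simp
  then have "h t = h s"
    using connected_local_const[of S t s h] S is_interval_connected by blast
  then have "\<Phi> t (h t) = \<Phi> t (h s)" by simp
  then show ?thesis
    using flow_add[of t "- t" "w t"] flow_add[of t "- s" "w s"] flow_0 by (simp add: h_def)
qed

end

text \<open>A class of functions of the state \<open>Z\<close> that is stable under differentiation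
  along the ODE. The modulus has derivative \<open>- Im Z / |Z|\<close>, which is why
  \<open>1 / |Z|\<close> is among the generators.\<close>

inductive_set orbit_functions :: "(real \<Rightarrow> real) \<Rightarrow> (real \<Rightarrow> complex) \<Rightarrow> (real \<Rightarrow> real) set"
  for f Z where
  orbit_fun: "smooth_on {0<..} F \<Longrightarrow> (\<lambda>t. F (cmod (Z t))) \<in> orbit_functions f Z"
| orbit_inverse: "(\<lambda>t. 1 / cmod (Z t)) \<in> orbit_functions f Z"
| orbit_const: "(\<lambda>t. a) \<in> orbit_functions f Z"
| orbit_Re: "(\<lambda>t. Re (Z t)) \<in> orbit_functions f Z"
| orbit_Im: "(\<lambda>t. Im (Z t)) \<in> orbit_functions f Z"
| orbit_add: "p \<in> orbit_functions f Z \<Longrightarrow> q \<in> orbit_functions f Z \<Longrightarrow>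
    (\<lambda>t. p t + q t) \<in> orbit_functions f Z"
| orbit_mult: "p \<in> orbit_functions f Z \<Longrightarrow> q \<in> orbit_functions f Z \<Longrightarrow>
    (\<lambda>t. p t * q t) \<in> orbit_functions f Z"

context flow
begin

lemma smooth_on_orbit_functions:
  assumes S: "open S" "\<And>t. t \<in> S \<Longrightarrow> Z t \<noteq> 0"
    and Z: "\<And>t. t \<in> S \<Longrightarrow> (Z has_vector_derivative rhs (Z t)) (at t)"
    and p: "p \<in> orbit_functions f Z"
  shows "smooth_on S p"
proof (rule smooth_on_coinduct[OF S(1) p])
  fix h assume "h \<in> orbit_functions f Z"
  then show "\<exists>h'\<in>orbit_functions f Z. \<forall>t\<in>S. (h has_vector_derivative h' t) (at t)"
    unfolding has_real_derivative_iff_has_vector_derivative[symmetric]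
  proof induction
    let ?y = "\<lambda>t. - 1 * Im (Z t)"
    have r: "((\<lambda>t. cmod (Z t)) has_real_derivative - Im (Z t) / cmod (Z t)) (at t)" if "t \<in> S" for t
    proof -
      have "Re (cnj (Z t) * rhs (Z t)) = - Im (Z t)"
        by (simp add: rhs_def algebra_simps)
      then show ?thesis using has_real_derivative_cmod[OF Z[OF that] S(2)[OF that]] by simp
    qed
    {
      case (orbit_fun F)
      have F: "((\<lambda>t. F (cmod (Z t))) has_real_derivative
          vector_derivative F (at (cmod (Z t))) * (?y t * (1 / cmod (Z t)))) (at t)" if "t \<in> S" for t
        using DERIV_chain2[OF _ r[OF that], of F] smooth_on_has_derivative[OF orbit_fun] S(2)[OF that]
        by (simp add: has_real_derivative_iff_has_vector_derivative)
      have "(\<lambda>t. vector_derivative F (at (cmod (Z t))) * (?y t * (1 / cmod (Z t)))) \<in> orbit_functions f Z"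
        by (intro orbit_functions.intros(1)[of "\<lambda>s. vector_derivative F (at s)"]
            orbit_functions.intros smooth_on_derivative[OF orbit_fun])
      then show ?case by (rule rev_bexI) (use F in simp)
    next
      case orbit_inverse
      let ?i = "\<lambda>t. 1 / cmod (Z t)"
      have F: "(?i has_real_derivative Im (Z t) * (?i t * (?i t * ?i t))) (at t)" if "t \<in> S" for t
        using r[OF that] S(2)[OF that]
        by (auto intro!: derivative_eq_intros simp: field_simps power2_eq_square)
      have "(\<lambda>t. Im (Z t) * (?i t * (?i t * ?i t))) \<in> orbit_functions f Z"
        by (intro orbit_functions.intros)
      then show ?case by (rule rev_bexI) (use F in simp)
    next
      case (orbit_const a)
      show ?case by (intro bexI[of _ "\<lambda>t. 0"] ballI orbit_functions.intros) auto
    next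
      case orbit_Re
      have F: "((\<lambda>t. Re (Z t)) has_real_derivative f (cmod (Z t)) * ?y t) (at t)" if "t \<in> S" for t
        using has_real_derivative_Re[OF Z[OF that]] by (simp add: rhs_def algebra_simps)
      have "(\<lambda>t. f (cmod (Z t)) * ?y t) \<in> orbit_functions f Z"
        by (intro orbit_functions.intros smooth)
      then show ?case by (rule rev_bexI) (use F in simp)
    next
      case orbit_Im
      have F: "((\<lambda>t. Im (Z t)) has_real_derivative f (cmod (Z t)) * Re (Z t) + (- 1)) (at t)" if "t \<in> S" for t
        using has_real_derivative_Im[OF Z[OF that]] by (simp add: rhs_def algebra_simps)
      have "(\<lambda>t. f (cmod (Z t)) * Re (Z t) + (- 1)) \<in> orbit_functions f Z"
        by (intro orbit_functions.intros smooth)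
      then show ?case by (rule rev_bexI) (use F in simp)
    next
      case (orbit_add p q)
      then obtain p' q' where "p' \<in> orbit_functions f Z" "q' \<in> orbit_functions f Z"
        "\<forall>t\<in>S. (p has_real_derivative p' t) (at t)" "\<forall>t\<in>S. (q has_real_derivative q' t) (at t)"
        by auto
      then show ?case
        by (intro bexI[of _ "\<lambda>t. p' t + q' t"]) (auto intro!: orbit_functions.intros DERIV_add)
    next
      case (orbit_mult p q)
      then obtain p' q' where "p' \<in> orbit_functions f Z" "q' \<in> orbit_functions f Z"
        "\<forall>t\<in>S. (p has_real_derivative p' t) (at t)" "\<forall>t\<in>S. (q has_real_derivative q' t) (at t)"
        by auto
      with orbit_mult(1,2) show ?case
        by (intro bexI[of _ "\<lambda>t. p' t * q t + q' t * p t"]) (auto intro!: orbit_functions.intros DERIV_mult)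
    }
  qed
qed

end

section \<open>Symmetry and periodicity\<close>

lemma DERIV_eventually_neq:
  fixes f :: "real \<Rightarrow> real"
  assumes "(f has_real_derivative d) (at t)" "d \<noteq> 0"
  shows "eventually (\<lambda>s. f s \<noteq> f t) (at t)"
proof -
  have "((\<lambda>s. (f s - f t) / (s - t)) \<longlongrightarrow> d) (at t)"
    using assms(1) by (simp add: has_field_derivative_iff)
  from tendsto_imp_eventually_ne[OF this assms(2)] show ?thesis
    by eventually_elim auto
qed

lemma eventually_neq_0_of_derivative:
  fixes w :: "real \<Rightarrow> complex"
  assumes "(w has_vector_derivative d) (at t)" "d \<noteq> 0" "w t = 0"
  shows "eventually (\<lambda>s. w s \<noteq> 0) (at t)"
proof (cases "Re d = 0")
  case True
  then have "Im d \<noteq> 0" using assms(2) complex_eq_iff by force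
  from DERIV_eventually_neq[OF has_real_derivative_Im[OF assms(1)] this] show ?thesis
    using assms(3) by (auto elim: eventually_mono)
next
  case False
  from DERIV_eventually_neq[OF has_real_derivative_Re[OF assms(1)] this] show ?thesis
    using assms(3) by (auto elim: eventually_mono)
qed

lemma DERIV_pos_strict_mono:
  fixes f :: "real \<Rightarrow> real"
  assumes "a < b" "\<And>x. (f has_real_derivative f' x) (at x)" "\<And>x. a < x \<Longrightarrow> x < b \<Longrightarrow> f' x > 0"
  shows "f a < f b"
proof (rule DERIV_pos_imp_increasing_open[OF assms(1)])
  show "continuous_on {a..b} f"
    using assms(2) by (meson DERIV_isCont continuous_at_imp_continuous_on)
qed (use assms in blast)

text \<open>\<open>K\<close> is kept apart from \<open>g (|c|)\<close>, which has no meaning where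
  \<open>c t = 0\<close>. The properties \<open>refl\<close> and \<open>fixed\<close> come from
  uniqueness for the flow; as assumptions they let the locale cover the mirror image of a solution,
  for which only the flow of the original is at hand.\<close>

locale rolling_curve =
  fixes g :: "real \<Rightarrow> real" and c :: "real \<Rightarrow> complex" and \<theta> K :: "real \<Rightarrow> real" and z :: "real \<Rightarrow> complex"
  assumes g_pos: "s > 0 \<Longrightarrow> g s > 0"
    and g_mono: "(\<forall>s t. 0 < s \<longrightarrow> s < t \<longrightarrow> g s < g t) \<or> (\<forall>s t. 0 < s \<longrightarrow> s < t \<longrightarrow> g t < g s)"
    and c': "(c has_vector_derivative cis (\<theta> t)) (at t)"
    and \<theta>': "(\<theta> has_real_derivative K t) (at t)"
    and K_cont: "continuous_on UNIV K"
    and K_eq: "c t \<noteq> 0 \<Longrightarrow> K t = g (cmod (c t))"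
    and z_def: "z t = - \<i> * cnj (c t) * cis (\<theta> t)"
    and refl: "Im (z s) = 0 \<Longrightarrow> z (s - u) = cnj (z (s + u))"
    and fixed: "z s * of_real (g (cmod (z s))) = 1 \<Longrightarrow> z t = z s"
    and trace_compact: "compact (range c)"
begin

lemma cmod_z: "cmod (z t) = cmod (c t)"
  by (simp add: z_def norm_mult)

lemma c_eq: "c t = - \<i> * cnj (z t) * cis (\<theta> t)"
  by (rule rolling_inverse[OF z_def])

lemma z': "(z has_vector_derivative \<i> * of_real (K t) * z t - \<i>) (at t)"
proof -
  have "z = (\<lambda>t. - \<i> * cnj (c t) * cis (\<theta> t))" using z_def by (rule ext)
  then show ?thesis using rolling_derivative[OF c' \<theta>'] by (simp only:)
qed

lemma x': "((\<lambda>t. Re (z t)) has_real_derivative - K t * Im (z t)) (at t)"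
  using has_real_derivative_Re[OF z'] by simp

lemma y': "((\<lambda>t. Im (z t)) has_real_derivative K t * Re (z t) - 1) (at t)"
  using has_real_derivative_Im[OF z'] by simp

lemma r': "((\<lambda>t. (cmod (z t))\<^sup>2) has_real_derivative - 2 * Im (z t)) (at t)"
proof -
  have "Re (cnj (z t) * (\<i> * of_real (K t) * z t - \<i>)) = - Im (z t)"
    by (simp add: algebra_simps)
  then show ?thesis using has_real_derivative_cmod_square[OF z'[of t]] by simp
qed

lemma z_cont: "continuous_on S z"
  using z' by (meson continuous_at_imp_continuous_on has_vector_derivative_continuous)

lemma c_cont: "continuous_on S c"
  using c' by (meson continuous_at_imp_continuous_on has_vector_derivative_continuous)

lemma \<theta>_cont: "continuous_on S \<theta>"
  using \<theta>' by (meson DERIV_isCont continuous_at_imp_continuous_on)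

lemma Kz: "z t \<noteq> 0 \<Longrightarrow> K t = g (cmod (z t))"
  using K_eq[of t] cmod_z[of t] by (metis norm_eq_zero)

text \<open>At a zero the velocity is \<open>- i\<close>, whatever the value of
  \<open>K\<close>.\<close>

lemma z_isolated: "eventually (\<lambda>s. z s \<noteq> 0) (at t)"
proof (cases "z t = 0")
  case True
  show ?thesis by (rule eventually_neq_0_of_derivative[OF z' _ True]) (simp add: True)
next
  case False
  show ?thesis
    using tendsto_imp_eventually_ne[OF has_vector_derivative_continuous[OF z',
        unfolded continuous_at] False] .
qed

lemma eqI_off_zeros:
  fixes p q :: "real \<Rightarrow> real"
  assumes "continuous_on UNIV p" "continuous_on UNIV q" "\<And>t. z t \<noteq> 0 \<Longrightarrow> p t = q t"
  shows "p t = q t"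
proof -
  have "((\<lambda>t. p t - q t) \<longlongrightarrow> p t - q t) (at t)"
    using assms(1,2) by (intro tendsto_diff) (simp_all add: continuous_on_def)
  moreover have "((\<lambda>t. p t - q t) \<longlongrightarrow> 0) (at t)"
    by (rule tendsto_eventually, use z_isolated[of t] in eventually_elim) (simp add: assms(3))
  ultimately have "p t - q t = 0" using tendsto_unique trivial_limit_at by blast
  then show ?thesis by simp
qed

lemma K_nonneg: "K t \<ge> 0"
proof -
  have "max (K t) 0 = K t"
    by (rule eqI_off_zeros[where p = "\<lambda>t. max (K t) 0"])
      (auto intro!: continuous_intros K_cont simp: Kz g_pos less_imp_le)
  then show ?thesis by simp
qed

text \<open>At a real point \<open>K x - 1\<close> is the derivative of \<open>Im z\<close>. If it
  vanishes too, the orbit is at rest; so on a nonconstant orbit all zeros of \<open>Im z\<close> are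
  simple.\<close>

lemma y_zero_simple:
  assumes "Im (z t) = 0" "K t * Re (z t) = 1"
  shows "z s = z t"
proof (rule fixed)
  have eq: "z t = of_real (Re (z t))" using assms(1) by (simp add: complex_eq_iff)
  have "z t \<noteq> 0" using assms by auto
  then have "of_real (g (cmod (z t))) = complex_of_real (K t)" by (simp add: Kz)
  then show "z t * of_real (g (cmod (z t))) = 1"
    using assms(2) eq by (metis mult.commute of_real_1 of_real_mult)
qed

text \<open>The derivative of \<open>|z|^2\<close> is \<open>- 2 Im z\<close>, so
  \<open>Im z\<close> vanishes where \<open>|z|\<close> is maximal and where it is minimal; both
  times exist because the trace is compact. If they coincided, \<open>|z|\<close> would be constant,
  \<open>Im z\<close> identically 0 and the orbit at rest.\<close>

lemma two_zeros:
  assumes nonconst: "z a \<noteq> z b"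
  obtains s t where "s < t" "Im (z s) = 0" "Im (z t) = 0"
proof -
  have cpt: "compact ((\<lambda>t. cmod (z t)) ` UNIV)"
  proof -
    have "(\<lambda>t. cmod (z t)) ` UNIV = cmod ` range c" by (auto simp: cmod_z)
    then show ?thesis
      using compact_continuous_image[OF _ trace_compact, of cmod] continuous_on_norm_id by auto
  qed
  obtain s where s: "\<And>t. cmod (z t) \<le> cmod (z s)"
    using compact_attains_sup[OF cpt] by auto
  obtain t where t: "\<And>s. cmod (z t) \<le> cmod (z s)"
    using compact_attains_inf[OF cpt] by auto
  have ys: "Im (z s) = 0"
    using DERIV_local_max[OF r'[of s], of 1] s by (simp add: power_mono)
  have yt: "Im (z t) = 0"
    using DERIV_local_min[OF r'[of t], of 1] t by (simp add: power_mono)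
  have "s \<noteq> t"
  proof
    assume "s = t"
    define m where "m = cmod (z s)"
    have const: "cmod (z u) = m" for u using s[of u] t[of u] \<open>s = t\<close> by (simp add: m_def)
    have "Im (z u) = 0" for u
    proof -
      have "((\<lambda>t. (cmod (z t))\<^sup>2) has_real_derivative 0) (at u)" by (simp add: const)
      from DERIV_unique[OF this r'[of u]] show ?thesis by simp
    qed
    then have "((\<lambda>t. 0) has_real_derivative K s * Re (z s) - 1) (at s)"
      using y'[of s] by simp
    from DERIV_unique[OF this DERIV_const] have "z u = z s" for u
      using y_zero_simple[OF ys] by simp
    then show False using nonconst by metis
  qed
  then show thesis using that ys yt by (metis linorder_neq_iff)
qed

text \<open>As the zeros are simple, \<open>Im z\<close> has a next zero after a given one, with a
  fixed sign in between.\<close>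

lemma half_period_exists:
  assumes nonconst: "z a \<noteq> z b"
  obtains s t where "s < t" "Im (z s) = 0" "Im (z t) = 0" "\<And>u. s < u \<Longrightarrow> u < t \<Longrightarrow> Im (z u) > 0"
proof -
  obtain s b' where sb: "s < b'" "Im (z s) = 0" "Im (z b') = 0" by (rule two_zeros[OF nonconst])
  have "K s * Re (z s) - 1 \<noteq> 0" using y_zero_simple[OF sb(2)] nonconst by (metis eq_iff_diff_eq_0)
  from DERIV_eventually_neq[OF y' this] obtain d where d: "d > 0"
    "\<And>u. u \<noteq> s \<Longrightarrow> dist u s < d \<Longrightarrow> Im (z u) \<noteq> 0"
    using sb(2) by (auto simp: eventually_at)
  \<comment> \<open>The minimum keeps the known zero \<open>b'\<close> inside
    \<open>[e, b']\<close>, where the first zero is sought.\<close>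
  define e where "e = min (s + d / 2) b'"
  have se: "s < e" "e \<le> b'" using d sb by (auto simp: e_def)
  have "closed ({e..b'} \<inter> (\<lambda>u. Im (z u)) -` {0})"
    by (intro continuous_closed_preimage continuous_intros z_cont)
  moreover have "{e..b'} \<inter> (\<lambda>u. Im (z u)) -` {0} \<subseteq> {e..b'}" by auto
  ultimately have "compact ({e..b'} \<inter> (\<lambda>u. Im (z u)) -` {0})"
    using compact_Icc bounded_subset compact_eq_bounded_closed by metis
  moreover have "{e..b'} \<inter> (\<lambda>u. Im (z u)) -` {0} \<noteq> {}" using se sb by auto
  ultimately obtain t where t': "t \<in> {e..b'} \<inter> (\<lambda>u. Im (z u)) -` {0}"
    "\<forall>u\<in>{e..b'} \<inter> (\<lambda>u. Im (z u)) -` {0}. t \<le> u"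
    using compact_attains_inf by meson
  have t: "t \<in> {e..b'}" "Im (z t) = 0" "\<And>u. u \<in> {e..b'} \<Longrightarrow> Im (z u) = 0 \<Longrightarrow> t \<le> u"
    using t' by simp_all
  have st: "s < t" using se t by auto
  have nz: "Im (z u) \<noteq> 0" if "s < u" "u < t" for u
  proof (cases "u < e")
    case True
    then show ?thesis using d(2)[of u] that by (auto simp: e_def dist_real_def)
  next
    case False
    then have "u \<in> {e..b'}" using t(1) that by simp
    then show ?thesis using t(3)[of u] that by linarith
  qed
  have sign: "Im (z u) > 0 \<longleftrightarrow> Im (z v) > 0" if "s < u" "u < t" "s < v" "v < t" for u v
  proof (rule ccontr)
    assume *: "\<not> ?thesis"
    have "connected ((\<lambda>u. Im (z u)) ` {s<..<t})"
      by (intro connected_continuous_image continuous_intros z_cont) auto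
    then have iv: "is_interval ((\<lambda>u. Im (z u)) ` {s<..<t})" by (simp add: is_interval_connected_1)
    have im: "Im (z u) \<in> (\<lambda>u. Im (z u)) ` {s<..<t}" "Im (z v) \<in> (\<lambda>u. Im (z u)) ` {s<..<t}"
      using that by auto
    have "(Im (z u) \<le> 0 \<and> 0 \<le> Im (z v)) \<or> (Im (z v) \<le> 0 \<and> 0 \<le> Im (z u))" using * by auto
    then have "0 \<in> (\<lambda>u. Im (z u)) ` {s<..<t}"
      using mem_is_interval_1_I[OF iv im] mem_is_interval_1_I[OF iv im(2,1)] by blast
    then show False using nz by force
  qed
  show thesis
  proof (cases "Im (z ((s + t) / 2)) > 0")
    case True
    then show thesis using that[OF st sb(2) t(2)] sign[of "(s + t) / 2"] st by simp
  next
    case False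
    \<comment> \<open>If the sign is negative, reflection at \<open>t\<close> moves the interval to
      \<open>]t, 2 t - s[\<close> and reverses the sign.\<close>
    have r: "Im (z (2 * t - u)) = - Im (z u)" for u
      using refl[OF t(2), of "u - t"] by (simp add: algebra_simps)
    have "Im (z u) < 0" if "s < u" "u < t" for u
      using sign[of "(s + t) / 2" u] nz[OF that] False st that by (auto simp: not_less_iff_gr_or_eq)
    then have "Im (z u) > 0" if "t < u" "u < 2 * t - s" for u
      using r[of u] that by (smt (verit))
    then show thesis using that[of t "2 * t - s"] st t(2) r[of s] sb(2) by simp
  qed
qed

end

section \<open>The half period and its symmetries\<close>

locale half_period = rolling_curve +
  fixes t1 t2 :: real
  assumes t12: "t1 < t2" and y1: "Im (z t1) = 0" and y2: "Im (z t2) = 0"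
    and y_pos: "\<And>t. t1 < t \<Longrightarrow> t < t2 \<Longrightarrow> Im (z t) > 0"
begin

definition "T = 2 * (t2 - t1)"
definition "D = 2 * (\<theta> t2 - \<theta> t1)"

lemma T_pos: "T > 0" using t12 by (simp add: T_def)

lemma z_reflect1: "z (2 * t1 - t) = cnj (z t)"
  using refl[OF y1, of "t - t1"] by (simp add: algebra_simps)

lemma z_reflect2: "z (2 * t2 - t) = cnj (z t)"
  using refl[OF y2, of "t - t2"] by (simp add: algebra_simps)

text \<open>The reflection at \<open>t1\<close> followed by the one at \<open>t2\<close> is the
  translation by \<open>T\<close>, and the two conjugations cancel.\<close>

lemma z_T: "z (t + T) = z t"
proof -
  have "t + T = 2 * t2 - (2 * t1 - t)" by (simp add: T_def)
  then show ?thesis by (simp only: z_reflect2 z_reflect1 complex_cnj_cnj)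
qed

lemma K_compose:
  assumes "\<And>t. cmod (z (p t)) = cmod (z t)" "continuous_on UNIV p"
  shows "K (p t) = K t"
proof (rule eqI_off_zeros[where p = "\<lambda>t. K (p t)" and q = K])
  show "continuous_on UNIV (\<lambda>t. K (p t))"
    using continuous_on_compose2[OF K_cont assms(2)] by simp
  show "K (p t) = K t" if "z t \<noteq> 0" for t
    using that assms(1)[of t] Kz[of "p t"] Kz[of t] by (metis norm_eq_zero)
qed (rule K_cont)

lemma \<theta>_reflect:
  assumes "\<And>t. z (2 * a - t) = cnj (z t)"
  shows "\<theta> (2 * a - t) = 2 * \<theta> a - \<theta> t"
proof -
  have K: "K (2 * a - t) = K t" for t
    by (rule K_compose) (auto simp: assms intro!: continuous_intros)
  have "((\<lambda>t. \<theta> (2 * a - t) + \<theta> t) has_real_derivative 0) (at t)" for t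
  proof -
    have "((\<lambda>t. \<theta> (2 * a - t)) has_real_derivative - K (2 * a - t)) (at t)"
      using has_vector_derivative_reflect[of \<theta>] \<theta>'
      by (simp add: has_real_derivative_iff_has_vector_derivative)
    from DERIV_add[OF this \<theta>'[of t]] show ?thesis by (simp add: K)
  qed
  then have "\<theta> (2 * a - t) + \<theta> t = \<theta> (2 * a - a) + \<theta> a" by (rule DERIV_isconst_all[rule_format])
  then show ?thesis by simp
qed

lemma \<theta>_reflect1: "\<theta> (2 * t1 - t) = 2 * \<theta> t1 - \<theta> t"
  by (rule \<theta>_reflect[OF z_reflect1])

lemma \<theta>_reflect2: "\<theta> (2 * t2 - t) = 2 * \<theta> t2 - \<theta> t"
  by (rule \<theta>_reflect[OF z_reflect2])

lemma \<theta>_T: "\<theta> (t + T) = \<theta> t + D"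
proof -
  have "t + T = 2 * t2 - (2 * t1 - t)" by (simp add: T_def)
  then have "\<theta> (t + T) = 2 * \<theta> t2 - (2 * \<theta> t1 - \<theta> t)" by (simp only: \<theta>_reflect2 \<theta>_reflect1)
  then show ?thesis by (simp add: D_def)
qed

lemma shift_nat:
  "z (t + real n * T) = z t" "\<theta> (t + real n * T) = \<theta> t + real n * D"
proof (induction n)
  case (Suc n)
  { case 1 show ?case using z_T[of "t + real n * T"] Suc by (simp add: algebra_simps) }
  { case 2 show ?case using \<theta>_T[of "t + real n * T"] Suc by (simp add: algebra_simps) }
qed auto

lemma shift_int:
  "z (t + of_int k * T) = z t" "\<theta> (t + of_int k * T) = \<theta> t + of_int k * D"
proof -
  have "z (t + of_int k * T) = z t \<and> \<theta> (t + of_int k * T) = \<theta> t + of_int k * D"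
  proof (cases "k \<ge> 0")
    case True
    then show ?thesis using shift_nat[of t "nat k"] by simp
  next
    case False
    then show ?thesis using shift_nat[of "t + of_int k * T" "nat (- k)"] by simp
  qed
  then show "z (t + of_int k * T) = z t" "\<theta> (t + of_int k * T) = \<theta> t + of_int k * D" by auto
qed

text \<open>Geometrically, the curve is symmetric about the line through 0 that is perpendicular to
  its tangent at time \<open>a\<close>.\<close>

lemma c_reflect:
  assumes "\<And>t. z (2 * a - t) = cnj (z t)"
  shows "c (2 * a - t) = - cnj (c t) * cis (2 * \<theta> a)"
  unfolding c_eq assms \<theta>_reflect[OF assms]
  by (simp add: cis_cnj cis_divide[symmetric] cis_inverse divide_inverse)

lemma z_neq_0: "t1 < t \<Longrightarrow> t < t2 \<Longrightarrow> z t \<noteq> 0"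
  using y_pos[of t] by auto

lemma K_pos: "t1 < t \<Longrightarrow> t < t2 \<Longrightarrow> K t > 0"
  using Kz[OF z_neq_0] g_pos z_neq_0 by simp

text \<open>\<open>Im z\<close> is 0 at \<open>t1\<close> and positive afterwards, so its derivative
  \<open>K x - 1\<close> is nonnegative at \<open>t1\<close>; it is not 0 because zeros are
  simple.\<close>

lemma x1_pos: "Re (z t1) > 0" and y1'_pos: "K t1 * Re (z t1) > 1"
proof -
  have "K t1 * Re (z t1) \<noteq> 1"
  proof
    assume "K t1 * Re (z t1) = 1"
    from y_zero_simple[OF y1 this, of "(t1 + t2) / 2"] show False
      using y_pos[of "(t1 + t2) / 2"] t12 y1 by auto
  qed
  moreover have "\<not> K t1 * Re (z t1) - 1 < 0"
  proof
    assume "K t1 * Re (z t1) - 1 < 0"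
    from DERIV_neg_dec_right[OF y' this] obtain d where d: "d > 0"
      "\<forall>h>0. h < d \<longrightarrow> Im (z t1) > Im (z (t1 + h))" by auto
    define h where "h = min (d / 2) ((t2 - t1) / 2)"
    have "0 < h" "h \<le> d / 2" "h \<le> (t2 - t1) / 2" using d t12
      unfolding h_def by (simp, metis min.cobounded1, metis min.cobounded2)
    then have "0 < h" "h < d" "t1 + h < t2" using d(1) t12 by (auto simp: field_simps)
    then show False using d(2) y_pos[of "t1 + h"] y1 by force
  qed
  ultimately show *: "K t1 * Re (z t1) > 1" by simp
  then show "Re (z t1) > 0" using K_nonneg[of t1] by (metis mult_nonneg_nonpos not_less zero_le_one order_trans linorder_le_less_linear)
qed

lemma x_decreasing: "t1 \<le> s \<Longrightarrow> s < t \<Longrightarrow> t \<le> t2 \<Longrightarrow> Re (z t) < Re (z s)"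
  using DERIV_pos_strict_mono[of s t "\<lambda>t. - Re (z t)" "\<lambda>t. K t * Im (z t)"]
    DERIV_minus[OF x'] K_pos y_pos by simp

lemma r_decreasing:
  assumes "t1 \<le> s" "s < t" "t \<le> t2"
  shows "cmod (z t) < cmod (z s)"
proof -
  have "- (cmod (z s))\<^sup>2 < - (cmod (z t))\<^sup>2"
    using DERIV_pos_strict_mono[of s t "\<lambda>t. - (cmod (z t))\<^sup>2" "\<lambda>t. 2 * Im (z t)"]
      DERIV_minus[OF r'] y_pos assms by simp
  then show ?thesis by (simp add: power_mono_iff power2_less_imp_less)
qed

lemma \<theta>_increasing: "t1 \<le> s \<Longrightarrow> s < t \<Longrightarrow> t \<le> t2 \<Longrightarrow> \<theta> s < \<theta> t"
  using DERIV_pos_strict_mono[of s t \<theta> K] \<theta>' K_pos by simp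

lemma D_pos: "D > 0"
  using \<theta>_increasing[of t1 t2] t12 by (simp add: D_def)

lemma mod_T: obtains k :: int where "t1 \<le> t + of_int k * T" "t + of_int k * T < t1 + T"
proof (rule that)
  define q where "q = (t - t1) / T"
  have q: "t - t1 = q * T" using T_pos by (simp add: q_def)
  have "of_int \<lfloor>q\<rfloor> * T \<le> q * T" "q * T < (of_int \<lfloor>q\<rfloor> + 1) * T"
    using T_pos by (auto intro!: mult_right_mono mult_strict_right_mono)
  then show "t1 \<le> t + of_int (- \<lfloor>q\<rfloor>) * T" "t + of_int (- \<lfloor>q\<rfloor>) * T < t1 + T"
    using q by (simp_all add: algebra_simps)
qed

text \<open>The sign of \<open>Im z\<close> separates the two halves of the period, and
  \<open>Re z\<close> is strictly monotone on each.\<close>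

lemma z_inj_period:
  assumes s: "t1 \<le> s" "s < t1 + T" and t: "t1 \<le> t" "t < t1 + T" and "z s = z t"
  shows "s = t"
proof -
  have inj: "s = t" if "t1 \<le> s" "s \<le> t2" "t1 \<le> t" "t \<le> t2" "Re (z s) = Re (z t)" for s t
    using that x_decreasing[of s t] x_decreasing[of t s] by (metis less_irrefl linorder_neq_iff)
  have up: "Im (z t) \<ge> 0" if "t1 \<le> t" "t \<le> t2" for t
    using that y_pos[of t] y1 y2 by (metis less_eq_real_def)
  have lo: "Im (z t) < 0" if "t2 < t" "t < t1 + T" for t
    using y_pos[of "2 * t2 - t"] z_reflect2[of t] that by (simp add: T_def)
  consider "s \<le> t2" "t \<le> t2" | "s \<le> t2" "t2 < t" | "t2 < s" "t \<le> t2" | "t2 < s" "t2 < t"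
    by linarith
  then show ?thesis
  proof cases
    case 1
    then show ?thesis using inj[of s t] s t \<open>z s = z t\<close> by simp
  next
    case 2
    then show ?thesis using up[of s] lo[of t] s t \<open>z s = z t\<close> by simp
  next
    case 3
    then show ?thesis using up[of t] lo[of s] s t \<open>z s = z t\<close> by simp
  next
    case 4
    then have "2 * t2 - s = 2 * t2 - t"
      using s t \<open>z s = z t\<close> inj[of "2 * t2 - s" "2 * t2 - t"] by (simp add: T_def z_reflect2)
    then show ?thesis by simp
  qed
qed

lemma z_eq_iff: "z s = z t \<longleftrightarrow> (\<exists>k::int. s - t = of_int k * T)"
proof
  assume eq: "z s = z t"
  obtain j :: int where j: "t1 \<le> s + of_int j * T" "s + of_int j * T < t1 + T" by (rule mod_T)
  obtain k :: int where k: "t1 \<le> t + of_int k * T" "t + of_int k * T < t1 + T" by (rule mod_T)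
  have "s + of_int j * T = t + of_int k * T"
    using z_inj_period[OF j k] eq by (simp add: shift_int)
  then have "s - t = of_int (k - j) * T" by (simp add: algebra_simps)
  then show "\<exists>k::int. s - t = of_int k * T" by blast
next
  assume "\<exists>k::int. s - t = of_int k * T"
  then obtain k :: int where "s = t + of_int k * T" by (metis add_diff_cancel_left' add.commute diff_add_cancel)
  then show "z s = z t" by (simp add: shift_int)
qed

lemma half_representative:
  obtains s where "t1 \<le> s" "s \<le> t2" "z t = z s \<or> z t = cnj (z s)"
proof -
  obtain k :: int where k: "t1 \<le> t + of_int k * T" "t + of_int k * T < t1 + T" by (rule mod_T)
  show thesis
  proof (cases "t + of_int k * T \<le> t2")
    case True
    show thesis by (rule that[OF k(1) True]) (simp add: shift_int)
  next
    case False
    have "z (2 * t2 - (t + of_int k * T)) = cnj (z t)" by (simp only: z_reflect2 shift_int)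
    then show thesis using False k
      by (intro that[of "2 * t2 - (t + of_int k * T)"]) (auto simp: T_def)
  qed
qed

lemma x_range: "Re (z t2) \<le> Re (z t)" "Re (z t) \<le> Re (z t1)"
proof -
  obtain s where s: "t1 \<le> s" "s \<le> t2" "z t = z s \<or> z t = cnj (z s)" by (rule half_representative)
  then have "Re (z t) = Re (z s)" by auto
  then show "Re (z t2) \<le> Re (z t)" "Re (z t) \<le> Re (z t1)"
    using x_decreasing[of s t2] x_decreasing[of t1 s] s(1,2) by (cases "s = t2"; cases "s = t1"; simp)+
qed

lemma r_le: "cmod (z t) \<le> cmod (z t1)"
proof -
  obtain s where s: "t1 \<le> s" "s \<le> t2" "z t = z s \<or> z t = cnj (z s)" by (rule half_representative)
  then have "cmod (z t) = cmod (z s)" by auto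
  then show ?thesis
    using r_decreasing[of t1 s] s(1,2) by (cases "s = t1") simp_all
qed

end

section \<open>Jordan solutions\<close>

lemma cis_eq_iff: "cis a = cis b \<longleftrightarrow> (\<exists>m::int. a - b = 2 * pi * of_int m)"
proof -
  have "cis a = cis b \<longleftrightarrow> sin a = sin b \<and> cos a = cos b" by (auto simp: complex_eq_iff)
  also have "\<dots> \<longleftrightarrow> (\<exists>m::int. a = b + 2 * pi * of_int m)" by (rule sin_cos_eq_iff)
  also have "\<dots> \<longleftrightarrow> (\<exists>m::int. a - b = 2 * pi * of_int m)" by (simp add: algebra_simps)
  finally show ?thesis .
qed

lemma real_IVT_UNIV:
  fixes F :: "real \<Rightarrow> real"
  assumes "continuous_on UNIV F" "F a \<le> v" "v \<le> F b"
  obtains t where "F t = v" "min a b \<le> t" "t \<le> max a b"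
proof -
  have "connected (F ` {min a b..max a b})"
    using assms(1) by (intro connected_continuous_image continuous_on_subset[OF assms(1)]) auto
  then have "is_interval (F ` {min a b..max a b})" by (simp add: is_interval_connected_1)
  then have "v \<in> F ` {min a b..max a b}"
    by (rule mem_is_interval_1_I[OF _ _ _ assms(2,3)]) auto
  then obtain t where "t \<in> {min a b..max a b}" "v = F t" by (rule imageE)
  then show thesis using that[of t] by simp
qed

text \<open>If \<open>u a = u b\<close>, then \<open>u\<close> attains an extremum over
  \<open>[a, b]\<close> at an interior point \<open>e\<close>; but near \<open>e\<close> a
  continuous injective function is strictly monotone.\<close>

lemma locally_injective_imp_inj:
  fixes u :: "real \<Rightarrow> real"
  assumes u: "continuous_on UNIV u"
    and loc: "\<And>t. \<exists>d>0. inj_on u {t - d<..<t + d}"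
  shows "inj u"
proof -
  have "u a \<noteq> u b" if "a < b" for a b
  proof
    assume eq: "u a = u b"
    have cab: "continuous_on {a..b} u" by (rule continuous_on_subset[OF u]) simp
    obtain M where M: "M \<in> {a..b}" "\<And>t. t \<in> {a..b} \<Longrightarrow> u t \<le> u M"
      using continuous_attains_sup[OF _ _ cab] \<open>a < b\<close> by auto
    obtain m where m: "m \<in> {a..b}" "\<And>t. t \<in> {a..b} \<Longrightarrow> u m \<le> u t"
      using continuous_attains_inf[OF _ _ cab] \<open>a < b\<close> by auto
    have "\<exists>e. a < e \<and> e < b \<and> ((\<forall>t\<in>{a..b}. u t \<le> u e) \<or> (\<forall>t\<in>{a..b}. u e \<le> u t))"
    proof (cases "(a < M \<and> M < b) \<or> (a < m \<and> m < b)")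
      case True
      then show ?thesis using M(2) m(2) by blast
    next
      case False
      then have "M = a \<or> M = b" "m = a \<or> m = b" using M(1) m(1) by auto
      \<comment> \<open>With both extrema at endpoints \<open>u\<close> is constant on
        \<open>[a, b]\<close>, and any interior point will do.\<close>
      then have "u M = u m" using eq by auto
      then have "u t \<le> u ((a + b) / 2)" if "t \<in> {a..b}" for t
        using M(2)[OF that] m(2)[of "(a + b) / 2"] \<open>a < b\<close> by simp
      then show ?thesis using \<open>a < b\<close> by (intro exI[of _ "(a + b) / 2"]) simp
    qed
    then obtain e where e: "a < e" "e < b" "(\<forall>t\<in>{a..b}. u t \<le> u e) \<or> (\<forall>t\<in>{a..b}. u e \<le> u t)"
      by blast
    obtain d where d: "d > 0" "inj_on u {e - d<..<e + d}" using loc by blast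
    define \<delta> where "\<delta> = min (d / 2) (min (e - a) (b - e))"
    have \<delta>: "0 < \<delta>" "\<delta> \<le> d / 2" "\<delta> \<le> e - a" "\<delta> \<le> b - e" using d e
      unfolding \<delta>_def
      by (simp, metis min.cobounded1, metis min.cobounded1 min.cobounded2 order_trans,
          metis min.cobounded2 order_trans)
    have sub: "{e - \<delta>..e + \<delta>} \<subseteq> {e - d<..<e + d}" using \<delta> d(1) by auto
    have "(u (e - \<delta>) < u e \<and> u e < u (e + \<delta>)) \<or> (u (e + \<delta>) < u e \<and> u e < u (e - \<delta>))"
      using \<delta>(1) by (intro continuous_inj_imp_mono continuous_on_subset[OF u] inj_on_subset[OF d(2) sub]) auto
    moreover have "e - \<delta> \<in> {a..b}" "e + \<delta> \<in> {a..b}" using \<delta> e by auto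
    ultimately show False using e(3) by (meson not_less)
  qed
  then show ?thesis by (intro injI) (metis linorder_neq_iff)
qed

context half_period
begin

text \<open>The component of \<open>c t\<close> along the tangent at time \<open>a\<close>. If
  \<open>a\<close> is a vertex, \<open>q a t = 0\<close> says that \<open>c t\<close> lies on the
  symmetry axis belonging to \<open>a\<close>.\<close>

definition q :: "real \<Rightarrow> real \<Rightarrow> real" where
  "q a t = Re (c t * cis (- \<theta> a))"

lemma q': "(q a has_real_derivative cos (\<theta> t - \<theta> a)) (at t)"
proof -
  have "((\<lambda>t. c t * cis (- \<theta> a)) has_vector_derivative cis (\<theta> t) * cis (- \<theta> a)) (at t)"
    by (intro has_vector_derivative_mult_left c')
  from has_real_derivative_Re[OF this] show ?thesis
    unfolding q_def by (simp add: cos_diff)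
qed

lemma q_cont: "continuous_on S (q a)"
  using q' by (meson DERIV_isCont continuous_at_imp_continuous_on)

lemma q_eq: "q a t = Im (cnj (z t) * cis (\<theta> t - \<theta> a))"
proof -
  have "c t * cis (- \<theta> a) = - \<i> * (cnj (z t) * cis (\<theta> t - \<theta> a))"
    by (subst c_eq) (simp add: cis_mult mult.assoc)
  then show ?thesis by (simp add: q_def)
qed

text \<open>The argument of the four vertex theorem: if \<open>D\<close> were \<open>2 \<pi>\<close>, the function \<open>G\<close> below would be
  strictly monotone on \<open>[t1, t2]\<close>, because the curvature is monotone there, but vanish at both ends.\<close>

lemma D_neq_2pi: "D \<noteq> 2 * pi"
proof
  assume D: "D = 2 * pi"
  then have th2: "\<theta> t2 - \<theta> t1 = pi" by (simp add: D_def)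
  \<comment> \<open>At \<open>s\<close> the tangent is perpendicular to the one at
    \<open>t1\<close>. There \<open>cos (\<theta> - \<theta> t1)\<close> changes sign, and so does
    \<open>K - K s\<close>.\<close>
  obtain s where s: "\<theta> s = \<theta> t1 + pi / 2" "t1 \<le> s" "s \<le> t2"
    using real_IVT_UNIV[OF \<theta>_cont, of t1 "\<theta> t1 + pi / 2" t2] th2 t12 pi_gt_zero by auto
  have s12: "t1 < s" "s < t2" using s th2 pi_gt_zero by (auto simp: less_le)
  \<comment> \<open>\<open>\<epsilon>\<close> is 1 if the curvature decreases on the half period and
    - 1 if it increases.\<close>
  obtain \<epsilon> :: real where \<epsilon>: "\<And>t. t1 < t \<Longrightarrow> t < s \<Longrightarrow> \<epsilon> * (K t - K s) > 0"
    "\<And>t. s < t \<Longrightarrow> t < t2 \<Longrightarrow> \<epsilon> * (K t - K s) < 0"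
  proof -
    have Ks: "K t = g (cmod (z t))" "cmod (z t) > 0" if "t1 < t" "t < t2" for t
      using Kz z_neq_0 that by auto
    have r: "cmod (z v) < cmod (z u)" if "t1 < u" "u < v" "v < t2" for u v
      using r_decreasing[of u v] that by simp
    show thesis
      using g_mono
    proof
      assume g: "\<forall>s t. 0 < s \<longrightarrow> s < t \<longrightarrow> g s < g t"
      have "K v < K u" if "t1 < u" "u < v" "v < t2" for u v
        using g r[OF that] Ks[of u] Ks[of v] that by simp
      then show thesis using s12 by (intro that[of 1]) simp_all
    next
      assume g: "\<forall>s t. 0 < s \<longrightarrow> s < t \<longrightarrow> g t < g s"
      have "K u < K v" if "t1 < u" "u < v" "v < t2" for u v
        using g r[OF that] Ks[of u] Ks[of v] that by simp
      then show thesis using s12 by (intro that[of "- 1"]) simp_all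
    qed
  qed
  \<comment> \<open>An antiderivative of
    \<open>\<epsilon> (K - K s) cos (\<theta> - \<theta> t1)\<close>. Subtracting the constant
    \<open>K s\<close> leaves the boundary values at 0 because \<open>q t1\<close> vanishes at both
    vertices.\<close>
  define G where "G t = \<epsilon> * (sin (\<theta> t - \<theta> t1) - K s * q t1 t)" for t
  have G': "(G has_real_derivative cos (\<theta> t - \<theta> t1) * (\<epsilon> * (K t - K s))) (at t)" for t
  proof -
    have "((\<lambda>t. sin (\<theta> t - \<theta> t1)) has_real_derivative cos (\<theta> t - \<theta> t1) * K t) (at t)"
      using DERIV_chain2[OF DERIV_sin DERIV_diff[OF \<theta>'[of t] DERIV_const[of "\<theta> t1"]]] by simp
    from DERIV_cmult[OF DERIV_diff[OF this DERIV_cmult[OF q'[of t1 t], of "K s"]], of \<epsilon>]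
    show ?thesis unfolding G_def by (simp add: algebra_simps)
  qed
  have "G t1 < G s"
  proof (rule DERIV_pos_strict_mono[OF s12(1) G'])
    fix t assume t: "t1 < t" "t < s"
    have "0 < \<theta> t - \<theta> t1" "\<theta> t - \<theta> t1 < pi / 2"
      using \<theta>_increasing[of t1 t] \<theta>_increasing[of t s] t s s12 by auto
    then show "0 < cos (\<theta> t - \<theta> t1) * (\<epsilon> * (K t - K s))"
      by (intro mult_pos_pos[OF cos_gt_zero \<epsilon>(1)[OF t]])
  qed
  moreover have "G s < G t2"
  proof (rule DERIV_pos_strict_mono[OF s12(2) G'])
    fix t assume t: "s < t" "t < t2"
    have "pi / 2 < \<theta> t - \<theta> t1" "\<theta> t - \<theta> t1 < pi"
      using \<theta>_increasing[of s t] \<theta>_increasing[of t t2] t s s12 th2 by auto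
    then have "cos (\<theta> t - \<theta> t1) < 0"
      using cos_gt_zero_pi[of "pi - (\<theta> t - \<theta> t1)"] by simp
    then show "0 < cos (\<theta> t - \<theta> t1) * (\<epsilon> * (K t - K s))"
      using \<epsilon>(2)[OF t] by (intro mult_neg_neg)
  qed
  moreover have "G t1 = 0" by (simp add: G_def q_eq y1)
  moreover have "G t2 = 0" by (simp add: G_def q_eq y2 th2)
  ultimately show False by simp
qed

text \<open>As long as the tangent deviates by less than a right angle from the one at
  \<open>t\<close>, the component \<open>q t\<close> increases strictly.\<close>

lemma c_locally_injective: "\<exists>d>0. inj_on c {t - d<..<t + d}"
proof -
  have "isCont \<theta> t" using DERIV_isCont[OF \<theta>'] .
  then obtain d where d: "d > 0" "\<And>s. dist s t < d \<Longrightarrow> dist (\<theta> s) (\<theta> t) < pi / 2"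
    unfolding continuous_at_eps_delta by (metis pi_half_gt_zero)
  have less: "q t u < q t v" if "t - d < u" "u < v" "v < t + d" for u v
  proof (rule DERIV_pos_strict_mono[OF that(2) q'])
    fix s assume "u < s" "s < v"
    then have "\<bar>\<theta> s - \<theta> t\<bar> < pi / 2" using d(2)[of s] that by (simp add: dist_real_def)
    then have "- (pi / 2) < \<theta> s - \<theta> t" "\<theta> s - \<theta> t < pi / 2" by linarith+
    then show "0 < cos (\<theta> s - \<theta> t)" by (rule cos_gt_zero_pi)
  qed
  have "inj_on c {t - d<..<t + d}"
  proof (rule inj_onI)
    fix u v assume uv: "u \<in> {t - d<..<t + d}" "v \<in> {t - d<..<t + d}" "c u = c v"
    then have "q t u = q t v" by (simp add: q_def)
    then show "u = v" using less[of u v] less[of v u] uv(1,2) by (cases u v rule: linorder_cases) auto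
  qed
  then show ?thesis using d(1) by blast
qed

text \<open>\<open>u\<close> is an angle coordinate on the trace, pulled back along \<open>c\<close>.\<close>

lemma circle_coordinate:
  assumes "range c homeomorphic (sphere 0 1 :: complex set)"
  obtains u where "continuous_on UNIV u" "strict_mono u"
    "\<And>s t. c s = c t \<longleftrightarrow> (\<exists>m::int. u s - u t = 2 * pi * of_int m)"
    "\<And>a. \<exists>t. \<exists>m::int. u t - a = 2 * pi * of_int m"
proof -
  obtain h k where hk: "homeomorphism (range c) (sphere 0 1 :: complex set) h k"
    using assms unfolding homeomorphic_def by blast
  define w where "w t = h (c t)" for t
  have wc: "continuous_on UNIV w"
    unfolding w_def using hk c_cont
    by (intro continuous_on_compose2[of "range c" h UNIV c]) (auto simp: homeomorphism_def)
  have w1: "cmod (w t) = 1" for t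
    using hk unfolding w_def homeomorphism_def by (metis imageI mem_sphere_0 rangeI)
  have wc_eq: "w s = w t \<longleftrightarrow> c s = c t" for s t
    using hk unfolding w_def homeomorphism_def by (metis rangeI)
  have w_surj: "\<exists>t. w t = p" if "cmod p = 1" for p
  proof -
    have "p \<in> h ` range c" using hk that by (simp add: homeomorphism_def)
    then show ?thesis by (auto simp: w_def)
  qed
  \<comment> \<open>The line is contractible, so \<open>w\<close> has a continuous logarithm; its
    imaginary part is the angle.\<close>
  obtain l where l: "continuous_on UNIV l" "\<And>t. w t = exp (l t)"
  proof (rule continuous_logarithm_on_contractible[OF wc])
    show "contractible (UNIV :: real set)" by (rule contractible_UNIV)
    show "w t \<noteq> 0" for t using w1[of t] by auto
  qed auto
  define u0 where "u0 t = Im (l t)" for t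
  have u0c: "continuous_on UNIV u0" unfolding u0_def by (intro continuous_intros l)
  have wu: "w t = cis (u0 t)" for t
  proof -
    have "Re (l t) = 0" using w1[of t] by (simp add: l(2))
    then have "l t = \<i> * of_real (u0 t)" by (simp add: complex_eq_iff u0_def)
    then show ?thesis by (simp add: l(2) cis_conv_exp)
  qed
  have eq: "c s = c t \<longleftrightarrow> (\<exists>m::int. u0 s - u0 t = 2 * pi * of_int m)" for s t
    by (simp only: wc_eq[symmetric] wu cis_eq_iff)
  have surj: "\<exists>t. \<exists>m::int. u0 t - a = 2 * pi * of_int m" for a
    using w_surj[of "cis a"] by (simp only: wu cis_eq_iff norm_cis)
  \<comment> \<open>Equal angles mean equal points, so the local injectivity of \<open>c\<close>
    passes to its lift.\<close>
  have "inj u0"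
  proof (rule locally_injective_imp_inj[OF u0c])
    fix t
    obtain d where "d > 0" "inj_on c {t - d<..<t + d}" using c_locally_injective by blast
    moreover have "c a = c b" if "u0 a = u0 b" for a b using that by (simp add: wc_eq[symmetric] wu)
    ultimately show "\<exists>d>0. inj_on u0 {t - d<..<t + d}" unfolding inj_on_def by meson
  qed
  then have "strict_mono u0 \<or> strict_antimono_on UNIV u0"
    using injective_eq_monotone_map[of UNIV u0] u0c by auto
  then show thesis
  proof
    assume "strict_mono u0"
    then show thesis using that[of u0] u0c eq surj by blast
  next
    \<comment> \<open>If the homeomorphism reverses the orientation, the sign of the angle is
      changed.\<close>
    assume anti: "strict_antimono_on UNIV u0"
    have neg: "(\<exists>m::int. - a - (- b) = 2 * pi * of_int m) \<longleftrightarrow> (\<exists>m::int. a - b = 2 * pi * of_int m)" for a b :: real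
    proof -
      have "cis (- a) = cis (- b) \<longleftrightarrow> cis a = cis b" by (simp flip: cis_cnj)
      then show ?thesis by (simp only: cis_eq_iff)
    qed
    show thesis
    proof (rule that[of "\<lambda>t. - u0 t"])
      show "continuous_on UNIV (\<lambda>t. - u0 t)" by (intro continuous_intros u0c)
      show "strict_mono (\<lambda>t. - u0 t)" using anti by (auto simp: monotone_on_def strict_mono_def)
      show "c s = c t \<longleftrightarrow> (\<exists>m::int. - u0 s - (- u0 t) = 2 * pi * of_int m)" for s t
        unfolding neg by (rule eq)
      show "\<exists>t. \<exists>m::int. - u0 t - a = 2 * pi * of_int m" for a
        using surj[of "- a"] neg[of _ "- a"] by simp
    qed
  qed
qed

text \<open>If the tangents differed, the component \<open>L\<close> along their difference
  \<open>\<nu>\<close> would grow after \<open>s\<close> and fall after \<open>t\<close>. But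
  \<open>u\<close> increases, so shortly after \<open>s\<close> and shortly after \<open>t\<close>
  the curve runs over the same points of the trace.\<close>

lemma Jordan_same_tangent:
  assumes J: "range c homeomorphic (sphere 0 1 :: complex set)" and eq: "c s = c t"
  shows "cis (\<theta> s) = cis (\<theta> t)"
proof (rule ccontr)
  assume neq: "cis (\<theta> s) \<noteq> cis (\<theta> t)"
  obtain u where u: "continuous_on UNIV u" "strict_mono u"
    "\<And>s t. c s = c t \<longleftrightarrow> (\<exists>m::int. u s - u t = 2 * pi * of_int m)"
    using circle_coordinate[OF J] by metis
  obtain m :: int where m: "u s - u t = 2 * pi * of_int m" using u(3) eq by blast
  define \<nu> where "\<nu> = cis (\<theta> s) - cis (\<theta> t)"
  define L where "L r = Re (c r * cnj \<nu>)" for r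
  have L': "(L has_real_derivative Re (cis (\<theta> r) * cnj \<nu>)) (at r)" for r
    unfolding L_def by (intro has_real_derivative_Re has_vector_derivative_mult_left c')
  have "Re (\<nu> * cnj \<nu>) = (cmod \<nu>)\<^sup>2" by (simp add: complex_mult_cnj cmod_power2)
  then have "Re (\<nu> * cnj \<nu>) > 0" using neq by (simp add: \<nu>_def)
  moreover have "Re (cis (\<theta> s) * cnj \<nu>) = Re (\<nu> * cnj \<nu>) / 2" "Re (cis (\<theta> t) * cnj \<nu>) = - Re (\<nu> * cnj \<nu>) / 2"
    using sin_cos_squared_add3[of "\<theta> s"] sin_cos_squared_add3[of "\<theta> t"]
    by (simp_all add: \<nu>_def algebra_simps)
  ultimately have pos: "Re (cis (\<theta> s) * cnj \<nu>) > 0" and neg: "Re (cis (\<theta> t) * cnj \<nu>) < 0" by auto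
  obtain d1 where d1: "d1 > 0" "\<forall>h>0. h < d1 \<longrightarrow> L s < L (s + h)"
    using DERIV_pos_inc_right[OF L' pos] by blast
  obtain d2 where d2: "d2 > 0" "\<forall>h>0. h < d2 \<longrightarrow> L t > L (t + h)"
    using DERIV_neg_dec_right[OF L' neg] by blast
  \<comment> \<open>An angle above \<open>u s\<close> that is attained shortly after
    \<open>s\<close> and, lowered by \<open>2 pi m\<close>, also shortly after
    \<open>t\<close>.\<close>
  define v where "v = min (u (s + d1 / 2)) (u (t + d2 / 2) + 2 * pi * of_int m)"
  have us: "u s < v" using strict_monoD[OF u(2), of s "s + d1 / 2"] strict_monoD[OF u(2), of t "t + d2 / 2"] d1(1) d2(1) m
    by (simp add: v_def)
  have v: "v \<le> u (s + d1 / 2)" "v - 2 * pi * of_int m \<le> u (t + d2 / 2)"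
    unfolding v_def by (rule min.cobounded1) (simp add: algebra_simps)
  obtain a where a: "u a = v" "s \<le> a" "a \<le> s + d1 / 2"
    using real_IVT_UNIV[OF u(1), of s v "s + d1 / 2"] us v(1) d1(1) by auto
  obtain b where b: "u b = v - 2 * pi * of_int m" "t \<le> b" "b \<le> t + d2 / 2"
    using real_IVT_UNIV[OF u(1), of t "v - 2 * pi * of_int m" "t + d2 / 2"] us m v(2) d2(1) by auto
  have "a \<noteq> s" using a us by auto
  moreover have "b \<noteq> t" using b us m by auto
  ultimately have "0 < a - s" "a - s < d1" "0 < b - t" "b - t < d2"
    using a(2,3) b(2,3) d1(1) d2(1) by auto
  then have "L s < L (s + (a - s))" "L t > L (t + (b - t))" using d1(2) d2(2) by blast+
  then have "L s < L a" "L t > L b" by simp_all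
  moreover have "c a = c b" using u(3) a b by auto
  ultimately show False using eq by (simp add: L_def)
qed

lemma Jordan_shift:
  assumes J: "range c homeomorphic (sphere 0 1 :: complex set)" and eq: "c s = c t"
  obtains k m :: int where "s - t = of_int k * T" "of_int k * D = 2 * pi * of_int m"
proof -
  have cis: "cis (\<theta> s) = cis (\<theta> t)" by (rule Jordan_same_tangent[OF J eq])
  then have "z s = z t" by (simp add: z_def eq)
  then obtain k :: int where k: "s - t = of_int k * T" using z_eq_iff by blast
  then have "s = t + of_int k * T" by simp
  then have "\<theta> s - \<theta> t = of_int k * D" by (simp add: shift_int)
  then obtain m :: int where "of_int k * D = 2 * pi * of_int m" using cis cis_eq_iff by metis
  then show thesis using that k by blast
qed

text \<open>The line cannot be mapped injectively onto the circle. If \<open>u\<close> never grew by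
  \<open>2 pi\<close>, its range would have length at most \<open>2 pi\<close> and omit its
  supremum; the point with that angle would then be attained a full turn or more below it, which
  leaves no room for earlier times.\<close>

lemma Jordan_closes:
  assumes J: "range c homeomorphic (sphere 0 1 :: complex set)"
  obtains k :: nat and m :: int where "k > 0" "real k * D = 2 * pi * of_int m"
proof -
  obtain u where u: "continuous_on UNIV u" "strict_mono u"
    "\<And>s t. c s = c t \<longleftrightarrow> (\<exists>m::int. u s - u t = 2 * pi * of_int m)"
    "\<And>a. \<exists>t. \<exists>m::int. u t - a = 2 * pi * of_int m"
    using circle_coordinate[OF J] by metis
  have "\<exists>s t. u t = u s + 2 * pi"
  proof (rule ccontr)
    assume "\<not> ?thesis"
    then have no: "u t \<noteq> u s + 2 * pi" for s t by blast
    have bd: "u t < u s + 2 * pi" for s t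
    proof (rule ccontr)
      assume "\<not> ?thesis"
      then obtain r where "u r = u s + 2 * pi"
        using real_IVT_UNIV[OF u(1), of s "u s + 2 * pi" t] pi_gt_zero by auto
      then show False using no by blast
    qed
    have bdd: "bdd_above (range u)" using bd[of _ 0] by (intro bdd_aboveI[of _ "u 0 + 2 * pi"]) (auto intro: less_imp_le)
    define b where "b = Sup (range u)"
    have ub: "u t < b" for t
      using strict_monoD[OF u(2), of t "t + 1"] cSup_upper[OF _ bdd, of "u (t + 1)"] by (simp add: b_def)
    obtain t and m :: int where t: "u t - b = 2 * pi * of_int m" using u(4) by blast
    then have "2 * pi * of_int m < 0" using ub[of t] by simp
    then have "m < 0" by (simp add: mult_less_0_iff)
    then have "of_int m \<le> (- 1 :: real)" by simp
    then have "2 * pi * of_int m \<le> 2 * pi * (- 1)" by (intro mult_left_mono) auto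
    \<comment> \<open>One unit of time earlier the angle is smaller, which makes the inequality
      strict.\<close>
    then have "u (t - 1) + 2 * pi < b" using t strict_monoD[OF u(2), of "t - 1" t] by simp
    then obtain r where "u (t - 1) + 2 * pi < u r"
      unfolding b_def using less_cSup_iff[OF _ bdd] by auto
    then show False using bd[of r "t - 1"] by simp
  qed
  then obtain s t where st: "u t = u s + 2 * pi" by blast
  then have "c t = c s" using u(3)[of t s] by (intro iffD2[OF u(3)] exI[of _ 1]) simp
  from Jordan_shift[OF J this] obtain k m :: int where
    k: "t - s = of_int k * T" "of_int k * D = 2 * pi * of_int m" by blast
  have "s < t" using st strict_mono_less[OF u(2), of s t] pi_gt_zero by simp
  then have "k > 0" using k(1) T_pos by (metis diff_gt_0_iff_gt of_int_0_less_iff zero_less_mult_pos2)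
  then show thesis using that[of "nat k" m] k(2) by simp
qed

text \<open>Where \<open>q a\<close> vanishes, \<open>c t\<close> lies on the symmetry axis of
  \<open>a\<close> and equals its mirror image \<open>c (2 a - t)\<close>. The two times are
  distinct and differ by less than \<open>T\<close>, contrary to
  \<open>Jordan_shift\<close>.\<close>

lemma Jordan_q_neq_0:
  assumes J: "range c homeomorphic (sphere 0 1 :: complex set)"
    and a: "a = t1 \<or> a = t2" and t: "t1 < t" "t < t2"
  shows "q a t \<noteq> 0"
proof
  assume q0: "q a t = 0"
  have "c (2 * a - t) = - cnj (c t) * cis (2 * \<theta> a)"
    by (rule c_reflect) (use a z_reflect1 z_reflect2 in auto)
  moreover have "c t * cis (- \<theta> a) = - cnj (c t * cis (- \<theta> a))"
    using q0 by (simp add: q_def complex_eq_iff)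
  then have "c t * (cis (- \<theta> a) * cis (\<theta> a)) = - cnj (c t) * (cis (\<theta> a) * cis (\<theta> a))"
    by (simp add: cis_cnj mult.assoc)
      (metis (no_types, lifting) cis_cnj complex_cnj_mult minus_mult_left mult.assoc minus_minus)
  then have "c t = - cnj (c t) * cis (2 * \<theta> a)" by (simp add: cis_mult)
  ultimately have "c (2 * a - t) = c t" by simp
  from Jordan_shift[OF J this] obtain k :: int where k: "2 * (a - t) = of_int k * T" by auto
  have "\<bar>2 * (a - t)\<bar> < T" "2 * (a - t) \<noteq> 0" using a t by (auto simp: T_def)
  then have "\<bar>of_int k\<bar> * T < 1 * T" "k \<noteq> 0" using T_pos unfolding k by (auto simp: abs_mult)
  then have "\<bar>real_of_int k\<bar> < 1" using T_pos mult_less_cancel_right_pos by blast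
  then show False using \<open>k \<noteq> 0\<close> by linarith
qed

text \<open>\<open>q a\<close> vanishes at \<open>a\<close> with derivative 1, which fixes the signs
  just after \<open>t1\<close> and just before \<open>t2\<close>; by \<open>Jordan_q_neq_0\<close>
  they cannot change in between.\<close>

lemma Jordan_q_sign:
  assumes J: "range c homeomorphic (sphere 0 1 :: complex set)" and t: "t1 < t" "t < t2"
  shows "q t1 t > 0" "q t2 t < 0"
proof -
  have q1: "q t1 t1 = 0" "q t2 t2 = 0" by (simp_all add: q_eq y1 y2)
  obtain d where d: "d > 0" "\<forall>h>0. h < d \<longrightarrow> q t1 t1 < q t1 (t1 + h)"
    using DERIV_pos_inc_right[OF q'[of t1 t1]] by auto
  show "q t1 t > 0"
  proof (rule ccontr)
    assume n: "\<not> q t1 t > 0"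
    define h where "h = min (d / 2) (t - t1)"
    have h: "0 < h" "h \<le> d / 2" "h \<le> t - t1" using d t
      unfolding h_def by (simp, metis min.cobounded1, metis min.cobounded2)
    then have "q t1 (t1 + h) > 0" using d q1 by simp
    then obtain r where r: "q t1 r = 0" "min t (t1 + h) \<le> r" "r \<le> max t (t1 + h)"
      using real_IVT_UNIV[OF q_cont, of t1 t 0 "t1 + h"] n by auto
    moreover have "t1 < r" "r < t2" using r(2,3) h t by auto
    ultimately show False using Jordan_q_neq_0[OF J, of t1 r] by simp
  qed
  obtain d where d: "d > 0" "\<forall>h>0. h < d \<longrightarrow> q t2 (t2 - h) < q t2 t2"
    using DERIV_pos_inc_left[OF q'[of t2 t2]] by auto
  show "q t2 t < 0"
  proof (rule ccontr)
    assume n: "\<not> q t2 t < 0"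
    define h where "h = min (d / 2) (t2 - t)"
    have h: "0 < h" "h \<le> d / 2" "h \<le> t2 - t" using d t
      unfolding h_def by (simp, metis min.cobounded1, metis min.cobounded2)
    then have "q t2 (t2 - h) < 0" using d q1 by simp
    then obtain r where r: "q t2 r = 0" "min (t2 - h) t \<le> r" "r \<le> max (t2 - h) t"
      using real_IVT_UNIV[OF q_cont, of t2 "t2 - h" 0 t] n by auto
    moreover have "t1 < r" "r < t2" using r(2,3) h t by auto
    ultimately show False using Jordan_q_neq_0[OF J, of t2 r] by simp
  qed
qed

text \<open>A twisted solution crosses one of its symmetry axes between two vertices, and hence itself.\<close>

lemma Jordan_untwisted:
  assumes J: "range c homeomorphic (sphere 0 1 :: complex set)"
  shows "Re (z t2) > 0"
proof (rule ccontr)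
  assume "\<not> Re (z t2) > 0"
  then have x2: "Re (z t2) \<le> 0" by simp
  have cl: "closure {t1<..<t2} = {t1..t2}" using t12 by simp
  have lim: "F t \<ge> 0"
    if "continuous_on UNIV F" "\<And>t. t1 < t \<Longrightarrow> t < t2 \<Longrightarrow> F t > 0" "t \<in> {t1..t2}" for F :: "real \<Rightarrow> real" and t
  proof (rule continuous_ge_on_closure[of "{t1<..<t2}" F])
    show "continuous_on (closure {t1<..<t2}) F" using that(1) continuous_on_subset by blast
    show "t \<in> closure {t1<..<t2}" unfolding cl by (rule that(3))
    show "0 \<le> F s" if "s \<in> {t1<..<t2}" for s
      using \<open>\<And>t. t1 < t \<Longrightarrow> t < t2 \<Longrightarrow> F t > 0\<close>[of s] that by simp
  qed
  have D2: "D / 2 = \<theta> t2 - \<theta> t1" by (simp add: D_def)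
  \<comment> \<open>At the opposite vertices the components are \<open>Re (z t2) sin (D / 2)\<close>
    and \<open>- Re (z t1) sin (D / 2)\<close>. If \<open>Re (z t2)\<close> is negative, their signs
    leave only \<open>sin (D / 2) = 0\<close>.\<close>
  have "q t1 t2 \<ge> 0" using t12 by (intro lim q_cont Jordan_q_sign(1)[OF J]) simp_all
  then have a: "Re (z t2) * sin (D / 2) \<ge> 0" by (simp add: q_eq y2 D2)
  have "- q t2 t1 \<ge> 0"
  proof (rule lim[of "\<lambda>t. - q t2 t"])
    show "continuous_on UNIV (\<lambda>t. - q t2 t)" by (intro continuous_intros q_cont)
  qed (use Jordan_q_sign[OF J] t12 in auto)
  moreover have "- q t2 t1 = Re (z t1) * sin (D / 2)"
    using sin_minus[of "\<theta> t2 - \<theta> t1"] by (simp add: q_eq y1 D2)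
  ultimately have b: "sin (D / 2) \<ge> 0" using x1_pos by (simp add: zero_le_mult_iff)
  have sin0: "sin (D / 2) = 0"
  proof (cases "Re (z t2) = 0")
    case True
    \<comment> \<open>The curve is at 0 at the times \<open>t2\<close> and \<open>t2 + T\<close>, so
      equality of tangents makes \<open>D\<close> a multiple of \<open>2 pi\<close>.\<close>
    then have "z t2 = 0" using y2 by (simp add: complex_eq_iff)
    then have "c t2 = 0" "c (t2 + T) = 0" using cmod_z[of t2] cmod_z[of "t2 + T"] z_T[of t2] by auto
    then have "cis (\<theta> (t2 + T)) = cis (\<theta> t2)" by (intro Jordan_same_tangent[OF J]) simp
    then obtain m :: int where "D = 2 * pi * of_int m" unfolding cis_eq_iff by (auto simp: \<theta>_T)
    then have "D / 2 = of_int m * pi" by simp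
    then show ?thesis by (simp only: sin_zero_iff_int2) blast
  next
    case False
    then show ?thesis using a b x2 by (simp add: zero_le_mult_iff)
  qed
  then obtain m :: int where "D / 2 = of_int m * pi" by (auto simp: sin_zero_iff_int2)
  then have Dm: "\<theta> t2 - \<theta> t1 = of_int m * pi" by (simp add: D_def)
  have "\<theta> t2 - \<theta> t1 > 0" using D_pos by (simp add: D_def)
  then have "of_int m * pi > 0" by (simp only: Dm)
  then have "m > 0" by (simp add: zero_less_mult_iff)
  moreover have "m \<noteq> 1" using D_neq_2pi Dm by (auto simp: D_def)
  ultimately have "m = 2 \<or> m \<ge> 3" by linarith
  \<comment> \<open>For \<open>m = 2\<close> the function \<open>q t1\<close> increases to 0 at
    \<open>t2\<close> and so is negative just before. For \<open>m \<ge> 3\<close> the tangent angle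
    is \<open>\<theta> t1 + 2 pi\<close> at some time before \<open>t2\<close>, where
    \<open>q t1 = - Im z\<close> is negative.\<close>
  then show False
  proof
    assume "m = 2"
    then have th: "\<theta> t2 - \<theta> t1 = 2 * pi" using Dm by simp
    then have q0: "q t1 t2 = 0" by (simp add: q_eq y2)
    obtain d where d: "d > 0" "\<forall>h>0. h < d \<longrightarrow> q t1 (t2 - h) < q t1 t2"
      using DERIV_pos_inc_left[OF q'[of t1 t2]] th by auto
    define h where "h = min (d / 2) ((t2 - t1) / 2)"
    have h: "0 < h" "h \<le> d / 2" "h \<le> (t2 - t1) / 2" using d t12 unfolding h_def
      by (simp, metis min.cobounded1, metis min.cobounded2)
    then have "q t1 (t2 - h) < 0" "t1 < t2 - h" "t2 - h < t2" using d q0 t12 by auto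
    then show False using Jordan_q_sign(1)[OF J, of "t2 - h"] by simp
  next
    assume "m \<ge> 3"
    then have "of_int m * pi \<ge> 3 * pi" by (intro mult_right_mono) auto
    then have gt: "\<theta> t2 - \<theta> t1 > 2 * pi" using Dm pi_gt_zero by simp
    then obtain s where s: "\<theta> s = \<theta> t1 + 2 * pi" "t1 \<le> s" "s \<le> t2"
      using real_IVT_UNIV[OF \<theta>_cont, of t1 "\<theta> t1 + 2 * pi" t2] t12 pi_gt_zero by auto
    have s12: "t1 < s" "s < t2" using s gt pi_gt_zero by (auto simp: less_le)
    have "q t1 s = - Im (z s)" by (simp add: q_eq s(1))
    then show False using Jordan_q_sign(1)[OF J s12] y_pos[OF s12] by simp
  qed
qed

text \<open>The polar angle of \<open>c\<close>, read off from
  \<open>c = - i cnj z cis \<theta>\<close>. It is continuous as long as \<open>z\<close> avoids the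
  cut of \<open>Ln\<close>.\<close>

definition \<phi> :: "real \<Rightarrow> real" where
  "\<phi> t = \<theta> t - pi / 2 - Im (Ln (z t))"

lemma c_polar:
  assumes "z t \<noteq> 0"
  shows "c t = of_real (cmod (z t)) * cis (\<phi> t)"
proof -
  have "z t = of_real (cmod (z t)) * cis (Im (Ln (z t)))"
    using assms exp_Ln[OF assms] exp_eq_polar[of "Ln (z t)"] by (simp add: Re_Ln exp_of_real[symmetric])
  then have "cnj (z t) = of_real (cmod (z t)) * cis (- Im (Ln (z t)))"
    by (metis cis_cnj complex_cnj_complex_of_real complex_cnj_mult)
  then have "c t = - \<i> * (of_real (cmod (z t)) * cis (- Im (Ln (z t)))) * cis (\<theta> t)"
    by (subst c_eq) simp
  also have "\<dots> = of_real (cmod (z t)) * (- \<i> * (cis (- Im (Ln (z t))) * cis (\<theta> t)))"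
    by (simp add: algebra_simps)
  also have "- \<i> = cis (- (pi / 2))" by (simp add: complex_eq_iff)
  also have "cis (- (pi / 2)) * (cis (- Im (Ln (z t))) * cis (\<theta> t)) = cis (\<phi> t)"
    unfolding cis_mult \<phi>_def by (rule arg_cong[where f = cis]) simp
  finally show ?thesis .
qed

lemma \<phi>_shift: "\<phi> (t + of_int k * T) = \<phi> t + of_int k * D"
  by (simp add: \<phi>_def shift_int)

text \<open>The curvature cancels between the derivatives of \<open>\<theta>\<close> and of
  \<open>Im (Ln z)\<close>, so the sign of \<open>Re z\<close> alone decides in which sense
  \<open>c\<close> moves about 0.\<close>

lemma \<phi>':
  assumes "Re (z t) > 0"
  shows "(\<phi> has_real_derivative Re (z t) / (cmod (z t))\<^sup>2) (at t)"
proof -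
  have z0: "z t \<noteq> 0" "z t \<notin> \<real>\<^sub>\<le>\<^sub>0" using assms by (auto simp: complex_nonpos_Reals_iff)
  have "((Ln \<circ> z) has_vector_derivative (\<i> * of_real (K t) * z t - \<i>) * inverse (z t)) (at t)"
    by (rule field_vector_diff_chain_at[OF z' has_field_derivative_Ln[OF z0(2)]])
  from has_real_derivative_Im[OF this]
  have "((\<lambda>t. Im (Ln (z t))) has_real_derivative Im ((\<i> * of_real (K t) * z t - \<i>) * inverse (z t))) (at t)"
    by (simp add: o_def)
  moreover have "Im ((\<i> * of_real (K t) * z t - \<i>) * inverse (z t)) = K t - Re (z t) / (cmod (z t))\<^sup>2"
  proof -
    have "(\<i> * of_real (K t) * z t - \<i>) * inverse (z t) = \<i> * (of_real (K t) - inverse (z t))"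
      using z0(1) by (simp add: field_simps)
    then show ?thesis by (simp add: cmod_power2)
  qed
  ultimately have "((\<lambda>t. Im (Ln (z t))) has_real_derivative K t - Re (z t) / (cmod (z t))\<^sup>2) (at t)" by simp
  from DERIV_diff[OF DERIV_diff[OF \<theta>'[of t] DERIV_const[of "pi / 2"]] this]
  show ?thesis unfolding \<phi>_def[abs_def] by simp
qed

lemma c_eq_polar:
  assumes "z s \<noteq> 0" "z t \<noteq> 0" "c s = c t"
  obtains m :: int where "\<phi> s - \<phi> t = 2 * pi * of_int m"
proof -
  have "cmod (z s) = cmod (z t)" using assms(3) by (simp add: cmod_z)
  then have "cis (\<phi> s) = cis (\<phi> t)" using assms c_polar[of s] c_polar[of t] by simp
  then show thesis using that cis_eq_iff by blast
qed

section \<open>The untwisted case: the polar angle as a parameter\<close>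

context
  assumes x2_pos: "Re (z t2) > 0"
begin

lemma x_pos: "Re (z t) > 0"
  using x_range(1)[of t] x2_pos by simp

lemma z_neq_0': "z t \<noteq> 0"
  using x_pos[of t] by auto

lemma \<phi>_strict_mono: "strict_mono \<phi>"
proof (rule strict_monoI)
  fix s t :: real assume "s < t"
  then show "\<phi> s < \<phi> t"
  proof (rule DERIV_pos_strict_mono)
    show "(\<phi> has_real_derivative Re (z t) / (cmod (z t))\<^sup>2) (at t)" for t by (rule \<phi>'[OF x_pos])
    show "0 < Re (z t) / (cmod (z t))\<^sup>2" for t using x_pos[of t] z_neq_0'[of t] by simp
  qed
qed

lemma \<phi>_cont: "continuous_on UNIV \<phi>"
  using \<phi>'[OF x_pos] by (meson DERIV_isCont continuous_at_imp_continuous_on)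

lemma \<phi>_surj: "surj \<phi>"
proof -
  have "\<exists>t. \<phi> t = v" for v
  proof -
    obtain n :: nat where n: "real n * D > \<bar>v - \<phi> 0\<bar>" using D_pos reals_Archimedean3 by blast
    have "\<phi> (of_int (- int n) * T) \<le> v" "v \<le> \<phi> (of_int (int n) * T)"
      using \<phi>_shift[of 0 "- int n"] \<phi>_shift[of 0 "int n"] n by auto
    from real_IVT_UNIV[OF \<phi>_cont this] show ?thesis by blast
  qed
  then show ?thesis by (metis surjI)
qed

lemma Jordan_winding:
  assumes J: "range c homeomorphic (sphere 0 1 :: complex set)"
  obtains n :: nat where "n \<ge> 2" "D = 2 * pi / n"
proof -
  let ?P = "\<lambda>k::nat. k > 0 \<and> (\<exists>m::int. real k * D = 2 * pi * of_int m)"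
  \<comment> \<open>The smallest number of periods over which the tangent makes a whole number of
    turns.\<close>
  define k where "k = (LEAST k. ?P k)"
  have "\<exists>k. ?P k" using Jordan_closes[OF J] by metis
  then have Pk: "?P k" unfolding k_def by (rule LeastI_ex)
  then obtain m :: int where k: "k > 0" "real k * D = 2 * pi * of_int m" by blast
  have kmin: "k \<le> j" if "?P j" for j unfolding k_def using that by (rule Least_le)
  have "real k * D > 0" using k(1) D_pos by simp
  then have m: "m \<ge> 1" using k(2) by (simp add: zero_less_mult_iff)
  define \<psi> where "\<psi> = inv \<phi>"
  have \<phi>\<psi>: "\<phi> (\<psi> a) = a" for a unfolding \<psi>_def by (rule surj_f_inv_f[OF \<phi>_surj])
  have \<psi>\<phi>: "\<psi> (\<phi> t) = t" for t unfolding \<psi>_def by (rule inv_f_f[OF strict_mono_imp_inj_on[OF \<phi>_strict_mono]])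
  have \<psi>_cont: "continuous_on UNIV \<psi>"
  proof (rule continuous_onI_mono)
    have "\<psi> ` UNIV = UNIV" using \<psi>\<phi> by (metis surjI)
    then show "open (\<psi> ` UNIV)" by simp
    show "\<psi> a \<le> \<psi> b" if "a \<le> b" for a b
      using that strict_mono_less_eq[OF \<phi>_strict_mono, of "\<psi> a" "\<psi> b"] by (simp add: \<phi>\<psi>)
  qed
  \<comment> \<open>The time at which the polar angle has grown by exactly one turn since
    \<open>t\<close>.\<close>
  define \<tau> where "\<tau> t = \<psi> (\<phi> t + 2 * pi)" for t
  have \<phi>\<tau>: "\<phi> (\<tau> t) = \<phi> t + 2 * pi" for t by (simp add: \<tau>_def \<phi>\<psi>)
  have \<tau>_cont: "continuous_on UNIV \<tau>"
    unfolding \<tau>_def by (rule continuous_on_compose2[OF \<psi>_cont]) (auto intro!: continuous_intros \<phi>_cont)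
  have "continuous_on UNIV (\<lambda>t. cmod (z (\<tau> t)) - cmod (z t))"
    by (intro continuous_intros continuous_on_compose2[OF z_cont[of UNIV] \<tau>_cont] z_cont) auto
  \<comment> \<open>\<open>|z|\<close> is maximal at \<open>t1\<close>. This decides the sign of the
    difference at \<open>t1\<close> and, the other way, at the time that \<open>\<tau>\<close> sends
    to \<open>t1\<close>.\<close>
  moreover have "cmod (z (\<tau> t1)) - cmod (z t1) \<le> 0" using r_le by simp
  moreover have "0 \<le> cmod (z (\<tau> (\<psi> (\<phi> t1 - 2 * pi)))) - cmod (z (\<psi> (\<phi> t1 - 2 * pi)))"
  proof -
    have "\<tau> (\<psi> (\<phi> t1 - 2 * pi)) = t1" by (simp add: \<tau>_def \<phi>\<psi> \<psi>\<phi>)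
    then show ?thesis using r_le by simp
  qed
  ultimately obtain t where t: "cmod (z (\<tau> t)) - cmod (z t) = 0" by (rule real_IVT_UNIV)
  have "cis (\<phi> (\<tau> t)) = cis (\<phi> t)" unfolding cis_eq_iff by (intro exI[of _ 1]) (simp add: \<phi>\<tau>)
  then have "c (\<tau> t) = c t"
    using c_polar[OF z_neq_0', of t] c_polar[OF z_neq_0', of "\<tau> t"] t by simp
  from Jordan_shift[OF J this] obtain j l :: int where
    j: "\<tau> t - t = of_int j * T" "of_int j * D = 2 * pi * of_int l" by blast
  have "\<phi> (\<tau> t) = \<phi> (t + of_int j * T)" using j(1) by (simp add: algebra_simps)
  then have jD: "of_int j * D = 2 * pi" using \<phi>\<tau>[of t] by (simp add: \<phi>_shift)
  then have "of_int j * D > 0" by simp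
  then have j0: "j > 0" using D_pos by (simp add: zero_less_mult_iff)
  \<comment> \<open>Now \<open>j\<close> periods make exactly one turn, so minimality of
    \<open>k\<close> gives \<open>k D \<le> 2 pi\<close> and hence \<open>m = 1\<close>.\<close>
  then have "?P (nat j)" using j(2) by auto
  then have "k \<le> nat j" by (rule kmin)
  then have "int k \<le> j" using j0 by linarith
  then have "real k \<le> of_int j" by linarith
  then have "real k * D \<le> of_int j * D" using D_pos by (intro mult_right_mono) auto
  then have "2 * pi * of_int m \<le> 2 * pi * 1" using k(2) jD by simp
  then have "m = 1" using m by (simp add: mult_le_cancel_left)
  then have "D = 2 * pi / k" using k by (simp add: field_simps)
  moreover have "k \<noteq> 1" using calculation D_neq_2pi by auto
  ultimately show thesis using that[of k] k(1) by auto
qed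

lemma Jordan_if:
  assumes n: "n > 0" "D = 2 * pi / real n"
  shows "range c homeomorphic (sphere 0 1 :: complex set)"
proof -
  \<comment> \<open>The length of the closed curve: over \<open>n\<close> periods the polar angle
    makes one turn.\<close>
  define P where "P = real n * T"
  have P: "P > 0" using n T_pos by (simp add: P_def)
  have nD: "real n * D = 2 * pi" using n by simp
  have \<phi>P: "\<phi> (t + of_int j * P) = \<phi> t + 2 * pi * of_int j" for t and j :: int
  proof -
    have "\<phi> (t + of_int j * P) = \<phi> (t + of_int (j * int n) * T)" by (simp add: P_def mult.assoc)
    also have "\<dots> = \<phi> t + of_int j * (real n * D)" unfolding \<phi>_shift by simp
    finally show ?thesis by (simp add: nD mult.commute)
  qed
  have cP: "c (t + of_int j * P) = c t" for t and j :: int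
  proof -
    have "z (t + of_int j * P) = z t" using shift_int(1)[of t "j * int n"] by (simp add: P_def mult.assoc)
    moreover have "cis (\<phi> (t + of_int j * P)) = cis (\<phi> t)" unfolding cis_eq_iff by (auto simp: \<phi>P)
    ultimately show ?thesis using c_polar[OF z_neq_0', of t] c_polar[OF z_neq_0', of "t + of_int j * P"] by simp
  qed
  have c_inj: "\<exists>j::int. s - t = of_int j * P" if st: "c s = c t" for s t
  proof -
    obtain j :: int where "\<phi> s - \<phi> t = 2 * pi * of_int j"
      by (rule c_eq_polar[OF z_neq_0' z_neq_0' st])
    then have "\<phi> s = \<phi> (t + of_int j * P)" by (simp add: \<phi>P)
    then have "s = t + of_int j * P" using strict_mono_eq[OF \<phi>_strict_mono] by blast
    then show ?thesis by (intro exI[of _ j]) simp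
  qed
  define \<gamma> where "\<gamma> s = c (s * P)" for s
  have "path \<gamma>" unfolding path_def \<gamma>_def
    by (rule continuous_on_compose2[OF c_cont[of UNIV]]) (auto intro!: continuous_intros)
  moreover have "loop_free \<gamma>" unfolding loop_free_def
  proof (intro ballI impI)
    fix s t :: real assume st: "s \<in> {0..1}" "t \<in> {0..1}" "\<gamma> s = \<gamma> t"
    then obtain j :: int where "s * P - t * P = of_int j * P" using c_inj unfolding \<gamma>_def by blast
    then have "s - t = of_int j" using P by (simp add: left_diff_distrib[symmetric])
    moreover have "j = 0 \<or> j = 1 \<or> j = - 1 \<or> j \<ge> 2 \<or> j \<le> - 2" by linarith
    ultimately show "s = t \<or> s = 0 \<and> t = 1 \<or> s = 1 \<and> t = 0" using st(1,2) by auto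
  qed
  ultimately have "simple_path \<gamma>" by (simp add: simple_path_def)
  moreover have "pathfinish \<gamma> = pathstart \<gamma>"
    using cP[of 0 1] by (simp add: pathfinish_def pathstart_def \<gamma>_def)
  ultimately have "path_image \<gamma> homeomorphic (sphere 0 1 :: complex set)"
    using homeomorphic_simple_path_image_circle by (metis zero_less_one)
  moreover have "path_image \<gamma> = range c"
  proof
    show "range c \<subseteq> path_image \<gamma>"
    proof (rule image_subsetI)
      fix t
      have "c t = c (t + of_int (- \<lfloor>t / P\<rfloor>) * P)" by (simp only: cP)
      also have "t + of_int (- \<lfloor>t / P\<rfloor>) * P = frac (t / P) * P"
        using P by (simp add: frac_def left_diff_distrib)
      finally have "c t = \<gamma> (frac (t / P))" by (simp add: \<gamma>_def)
      moreover have "frac (t / P) \<in> {0..1}" using frac_lt_1[of "t / P"] by (simp add: less_imp_le)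
      ultimately show "c t \<in> path_image \<gamma>" by (simp add: path_image_def)
    qed
  qed (auto simp: path_image_def \<gamma>_def)
  ultimately show ?thesis by simp
qed

end

theorem Jordan_iff:
  "range c homeomorphic (sphere 0 1 :: complex set) \<longleftrightarrow>
     Re (z t2) > 0 \<and> (\<exists>n::nat. n \<ge> 2 \<and> D = 2 * pi / real n)"
proof
  assume J: "range c homeomorphic (sphere 0 1 :: complex set)"
  have x2: "Re (z t2) > 0" by (rule Jordan_untwisted[OF J])
  then show "Re (z t2) > 0 \<and> (\<exists>n::nat. n \<ge> 2 \<and> D = 2 * pi / real n)"
    using Jordan_winding[OF x2 J] by blast
next
  assume "Re (z t2) > 0 \<and> (\<exists>n::nat. n \<ge> 2 \<and> D = 2 * pi / real n)"
  then show "range c homeomorphic (sphere 0 1 :: complex set)"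
    using Jordan_if by fastforce
qed

end

section \<open>Orientation and net winding of the orbit\<close>

text \<open>\<open>w\<close> selects an open half-plane that contains both endpoints and has
  \<open>p\<close> on its boundary.\<close>

lemma not_in_closed_segment:
  assumes "Re (w * (a - p)) > 0" "Re (w * (b - p)) > 0"
  shows "p \<notin> closed_segment a b"
proof
  assume "p \<in> closed_segment a b"
  then obtain u where u: "0 \<le> u" "u \<le> 1" "p = (1 - u) *\<^sub>R a + u *\<^sub>R b"
    by (auto simp: in_segment)
  have "(1 - u) *\<^sub>R (w * (a - p)) + u *\<^sub>R (w * (b - p)) = w * (((1 - u) *\<^sub>R a + u *\<^sub>R b) - p)"
    by (simp add: scaleR_conv_of_real algebra_simps)
  then have "(1 - u) * Re (w * (a - p)) + u * Re (w * (b - p)) = Re (w * (p - p))"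
    unfolding u(3)[symmetric] by (metis plus_complex.sel(1) scaleR_complex.sel(1))
  moreover have "(1 - u) * Re (w * (a - p)) + u * Re (w * (b - p)) > 0"
  proof (cases "u = 0")
    case False
    then have "u * Re (w * (b - p)) > 0" using u(1) assms(2) by simp
    moreover have "(1 - u) * Re (w * (a - p)) \<ge> 0" using u(2) assms(1) by simp
    ultimately show ?thesis by linarith
  qed (use assms in simp)
  ultimately show False by simp
qed

text \<open>At every time \<open>\<gamma> s\<close> and the corresponding point of the unit circle
  about \<open>p\<close> lie strictly on the same side of the horizontal or the vertical line
  through \<open>p\<close>. So the linear homotopy between the two loops misses
  \<open>p\<close>.\<close>

lemma winding_number_upper_lower:
  assumes \<gamma>: "path \<gamma>" "\<gamma> 1 = \<gamma> 0" and "Im p = 0"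
    and up: "\<And>s. 0 < s \<Longrightarrow> s < 1/2 \<Longrightarrow> Im (\<gamma> s) > 0" and lo: "\<And>s. 1/2 < s \<Longrightarrow> s < 1 \<Longrightarrow> Im (\<gamma> s) < 0"
    and right: "Re (\<gamma> 0) > Re p" and left: "Re (\<gamma> (1/2)) < Re p"
  shows "winding_number \<gamma> p = 1"
proof -
  let ?C = "circlepath p 1"
  have C: "?C s - p = cis (2 * pi * s)" for s
    by (simp add: circlepath cis_conv_exp mult_ac)
  have "winding_number \<gamma> p = winding_number ?C p"
  proof (rule winding_number_loops_linear_eq)
    show "path ?C" by (simp add: valid_path_imp_path)
    fix s :: real assume "s \<in> {0..1}"
    then consider "s = 0" | "0 < s" "s < 1/2" | "s = 1/2" | "1/2 < s" "s < 1" | "s = 1"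
      by fastforce
    then show "p \<notin> closed_segment (?C s) (\<gamma> s)"
    proof cases
      case 1
      show ?thesis unfolding 1
        by (rule not_in_closed_segment[of 1]) (use C[of 0] right in simp_all)
    next
      case 2
      then have "sin (2 * pi * s) > 0" by (intro sin_gt_zero) auto
      then show ?thesis
        using C[of s] up[OF 2] \<open>Im p = 0\<close> by (intro not_in_closed_segment[of "- \<i>"]) simp_all
    next
      case 3
      show ?thesis unfolding 3
        by (rule not_in_closed_segment[of "- 1"]) (use C[of "1/2"] left in simp_all)
    next
      case 4
      have "sin (2 * pi * (s - 1/2)) > 0"
        using 4 by (intro sin_gt_zero) auto
      moreover have "2 * pi * (s - 1/2) = 2 * pi * s - pi" by (simp add: algebra_simps)
      ultimately have "sin (2 * pi * s) < 0" by (simp add: sin_diff)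
      then show ?thesis
        using C[of s] lo[OF 4] \<open>Im p = 0\<close> by (intro not_in_closed_segment[of \<i>]) simp_all
    next
      case 5
      show ?thesis unfolding 5
        by (rule not_in_closed_segment[of 1]) (use C[of 1] right \<gamma>(2) in simp_all)
    qed
  qed (use \<gamma> in \<open>simp_all add: pathfinish_def pathstart_def circlepath\<close>)
  then show ?thesis by (simp add: winding_number_circlepath_centre)
qed

lemma winding_number_lower_upper:
  assumes \<gamma>: "path \<gamma>" "\<gamma> 1 = \<gamma> 0" and "Im p = 0" and p: "p \<notin> path_image \<gamma>"
    and lo: "\<And>s. 0 < s \<Longrightarrow> s < 1/2 \<Longrightarrow> Im (\<gamma> s) < 0" and up: "\<And>s. 1/2 < s \<Longrightarrow> s < 1 \<Longrightarrow> Im (\<gamma> s) > 0"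
    and right: "Re (\<gamma> 0) > Re p" and left: "Re (\<gamma> (1/2)) < Re p"
  shows "winding_number \<gamma> p = - 1"
proof -
  have "winding_number (reversepath \<gamma>) p = 1"
    by (rule winding_number_upper_lower) (use assms in \<open>simp_all add: reversepath_def[abs_def] path_reversepath[unfolded reversepath_def]\<close>)
  then have "- winding_number \<gamma> p = 1" using winding_number_reversepath[OF \<gamma>(1) p] by simp
  then show ?thesis by (metis minus_minus)
qed

text \<open>These facts are needed twice, for an orbit and for its mirror image.\<close>

locale periodic_loop =
  fixes F :: "real \<Rightarrow> complex" and T :: real
  assumes F_cont: "continuous_on UNIV F" and period_pos: "T > 0"
    and F_eq_iff: "F s = F t \<longleftrightarrow> (\<exists>k::int. s - t = of_int k * T)"
begin

text \<open>The base time \<open>b\<close> is free because the signs of \<open>Im z\<close> are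
  known from \<open>t1\<close> or \<open>t2\<close> on, while the orbit of the flow begins at time
  0.\<close>

definition loop :: "real \<Rightarrow> real \<Rightarrow> complex" where
  "loop b = (\<lambda>s. F (b + s * T))"

lemma F_shift: "F (t + of_int k * T) = F t"
  by (rule iffD2[OF F_eq_iff]) (auto intro: exI[of _ k])

lemma path_loop: "path (loop b)"
  unfolding path_def loop_def
  by (rule continuous_on_compose2[OF F_cont]) (auto intro!: continuous_intros)

lemma loop_closed: "loop b 1 = loop b 0"
  using F_shift[of b 1] by (simp add: loop_def)

lemma simple_loop: "simple_path (loop b)"
  unfolding simple_path_def loop_free_def
proof (intro conjI path_loop ballI impI)
  fix s t :: real assume st: "s \<in> {0..1}" "t \<in> {0..1}" "loop b s = loop b t"
  then obtain j :: int where "(b + s * T) - (b + t * T) = of_int j * T"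
    unfolding loop_def F_eq_iff by blast
  then have "(s - t) * T = of_int j * T" by (simp add: left_diff_distrib)
  then have "s - t = of_int j" using period_pos by simp
  moreover have "j = 0 \<or> j = 1 \<or> j = - 1 \<or> j \<ge> 2 \<or> j \<le> - 2" by linarith
  ultimately show "s = t \<or> s = 0 \<and> t = 1 \<or> s = 1 \<and> t = 0" using st(1,2) by auto
qed

lemma path_image_loop: "path_image (loop b) = range F"
proof
  show "range F \<subseteq> path_image (loop b)"
  proof (rule image_subsetI)
    fix t
    define q where "q = (t - b) / T"
    have "t - b = q * T" using period_pos by (simp add: q_def)
    then have "t = (b + frac q * T) + of_int \<lfloor>q\<rfloor> * T" by (simp add: frac_def algebra_simps)
    then have "F t = loop b (frac q)" by (metis F_shift loop_def)
    moreover have "frac q \<in> {0..1}" using frac_lt_1[of q] by (simp add: less_imp_le)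
    ultimately show "F t \<in> path_image (loop b)" by (simp add: path_image_def)
  qed
qed (auto simp: path_image_def loop_def)

text \<open>Moving the base time is a \<open>shiftpath\<close> by the fractional part of the
  displacement measured in periods.\<close>

lemma winding_number_loop:
  assumes "p \<notin> range F"
  shows "winding_number (loop b) p = winding_number (loop a) p"
proof -
  define q where "q = (b - a) / T"
  have q: "b - a = q * T" using period_pos by (simp add: q_def)
  have "shiftpath (frac q) (loop a) s = loop b s" for s
  proof -
    have "a + (frac q + s) * T + of_int \<lfloor>q\<rfloor> * T = b + s * T"
      using q by (simp add: frac_def algebra_simps)
    then have 1: "loop b s = F (a + (frac q + s) * T)" unfolding loop_def by (metis F_shift)
    have "a + (frac q + s - 1) * T + of_int 1 * T = a + (frac q + s) * T" by (simp add: algebra_simps)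
    then have 2: "F (a + (frac q + s - 1) * T) = F (a + (frac q + s) * T)" by (metis F_shift)
    show ?thesis unfolding shiftpath_def 1 using 2 by (simp add: loop_def)
  qed
  then have "shiftpath (frac q) (loop a) = loop b" by (rule ext)
  moreover have "winding_number (shiftpath (frac q) (loop a)) p = winding_number (loop a) p"
    using assms frac_lt_1[of q] loop_closed[of a]
    by (intro winding_number_shiftpath path_loop)
      (simp_all add: path_image_loop pathfinish_def pathstart_def less_imp_le)
  ultimately show ?thesis by simp
qed

text \<open>By the Jordan curve theorem the inside is connected, so one point with nonzero winding
  number determines the orientation.\<close>

lemma winding_number_loop_inside:
  assumes "p \<notin> range F" "winding_number (loop b) p \<noteq> 0"
  shows "p \<in> inside (path_image (loop b))"
    and "w \<in> inside (path_image (loop b)) \<Longrightarrow> winding_number (loop b) w = winding_number (loop b) p"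
proof -
  have closed: "pathfinish (loop b) = pathstart (loop b)"
    using loop_closed by (simp add: pathfinish_def pathstart_def)
  have "p \<notin> outside (path_image (loop b))"
    using winding_number_zero_in_outside[OF path_loop closed] assms(2) by blast
  then show p: "p \<in> inside (path_image (loop b))"
    using assms(1) inside_Un_outside[of "path_image (loop b)"] path_image_loop[of b] by blast
  have "winding_number (loop b) constant_on inside (path_image (loop b))"
    using Jordan_inside_outside[OF simple_loop closed] inside_no_overlap[of "path_image (loop b)"]
    by (intro winding_number_constant path_loop closed) auto
  then show "winding_number (loop b) w = winding_number (loop b) p" if "w \<in> inside (path_image (loop b))"
    using p that unfolding constant_on_def by metis
qed

lemma not_in_outside:
  assumes "p \<notin> range F \<Longrightarrow> winding_number (loop b) p \<noteq> 0"
  shows "p \<notin> outside (path_image (loop b))"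
proof (cases "p \<in> range F")
  case True
  then show ?thesis
    using outside_no_overlap[of "path_image (loop b)"] path_image_loop[of b] by blast
next
  case False
  then show ?thesis
    using winding_number_zero_in_outside[OF path_loop, of b p] assms loop_closed[of b]
    by (auto simp: pathfinish_def pathstart_def)
qed

end

section \<open>The periodic orbit and its mirror image\<close>

context half_period
begin

sublocale orbit: periodic_loop z T
  by standard (rule z_cont T_pos z_eq_iff)+

text \<open>Where \<open>z\<close> satisfies the ODE with \<open>g\<close>, the path
  \<open>- cnj z\<close> satisfies it with \<open>- g\<close>. For negative \<open>f\<close> the
  locale is used with the mirrored orbit as \<open>z\<close>, so \<open>- cnj z\<close> is the
  actual one.\<close>

sublocale mirror: periodic_loop "\<lambda>t. - cnj (z t)" T
  by standard (auto intro!: continuous_intros z_cont simp: T_pos z_eq_iff)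

lemma y_neg: "t2 < t \<Longrightarrow> t < t1 + T \<Longrightarrow> Im (z t) < 0"
  using y_pos[of "2 * t2 - t"] z_reflect2[of t] by (simp add: T_def)

lemma z_real: "Im (z t) = 0 \<Longrightarrow> z t = z t1 \<or> z t = z t2"
proof -
  assume y: "Im (z t) = 0"
  obtain s where s: "t1 \<le> s" "s \<le> t2" "z t = z s \<or> z t = cnj (z s)" by (rule half_representative)
  then have "Im (z s) = 0" using y by auto
  then have "s = t1 \<or> s = t2" using y_pos[of s] s(1,2) by force
  moreover have "z t = z s" using s(3) \<open>Im (z s) = 0\<close> by (auto simp: complex_eq_iff)
  ultimately show ?thesis by auto
qed

lemma between_notin_orbit:
  assumes "Im p = 0" "Re (z t2) < Re p" "Re p < Re (z t1)"
  shows "p \<notin> range z" "- p \<notin> range (\<lambda>t. - cnj (z t))"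
proof -
  show 1: "p \<notin> range z" using z_real assms by force
  show "- p \<notin> range (\<lambda>t. - cnj (z t))"
  proof
    assume "- p \<in> range (\<lambda>t. - cnj (z t))"
    then obtain t where "p = cnj (z t)" by auto
    then have "p = z (2 * t1 - t)" by (simp add: z_reflect1)
    then show False using 1 by blast
  qed
qed

text \<open>The orbit crosses the real axis at \<open>z t1\<close> to the right of \<open>p\<close>
  and at \<open>z t2\<close> to the left, and passes from the first to the second above the
  axis.\<close>

lemma winding_orbit:
  assumes p: "Im p = 0" "Re (z t2) < Re p" "Re p < Re (z t1)"
  shows "winding_number (orbit.loop b) p = 1"
proof -
  have "winding_number (orbit.loop t1) p = 1"
  proof (rule winding_number_upper_lower)
    have "t1 + 1/2 * T = t2" by (simp add: T_def field_simps)
    then show "Re (orbit.loop t1 (1/2)) < Re p" using p by (simp add: orbit.loop_def)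
    show "Re p < Re (orbit.loop t1 0)" using p by (simp add: orbit.loop_def)
    show "Im (orbit.loop t1 s) > 0" if "0 < s" "s < 1/2" for s
    proof -
      have "s * T < 1/2 * T" using that T_pos by (intro mult_strict_right_mono)
      then have "t1 + s * T < t2" by (simp add: T_def)
      moreover have "0 < s * T" using that T_pos by simp
      ultimately show ?thesis unfolding orbit.loop_def by (intro y_pos) auto
    qed
    show "Im (orbit.loop t1 s) < 0" if "1/2 < s" "s < 1" for s
    proof -
      have "1/2 * T < s * T" "s * T < 1 * T" using that T_pos by (intro mult_strict_right_mono; simp)+
      then have "t2 < t1 + s * T" "t1 + s * T < t1 + T" by (simp_all add: T_def)
      then show ?thesis unfolding orbit.loop_def by (rule y_neg)
    qed
  qed (use p orbit.path_loop orbit.loop_closed in auto)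
  then show ?thesis using orbit.winding_number_loop[OF between_notin_orbit(1)[OF p], of b t1] by simp
qed

text \<open>Started at \<open>t2\<close>, the mirrored loop begins at its rightmost point and runs
  through the lower half-plane first.\<close>

lemma winding_mirror:
  assumes p: "Im p = 0" "Re (z t2) < Re p" "Re p < Re (z t1)"
  shows "winding_number (mirror.loop b) (- p) = - 1"
proof -
  have "winding_number (mirror.loop t2) (- p) = - 1"
  proof (rule winding_number_lower_upper)
    have "t2 + 1/2 * T = t1 + T" by (simp add: T_def field_simps)
    then have "z (t2 + 1/2 * T) = z t1" by (simp only: z_T)
    then show "Re (mirror.loop t2 (1/2)) < Re (- p)" using p by (simp add: mirror.loop_def)
    show "Re (- p) < Re (mirror.loop t2 0)" using p by (simp add: mirror.loop_def)
    show "Im (mirror.loop t2 s) < 0" if "0 < s" "s < 1/2" for s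
    proof -
      have "s * T < 1/2 * T" using that T_pos by (intro mult_strict_right_mono)
      then have "t2 + s * T < t1 + T" by (simp add: T_def)
      moreover have "0 < s * T" using that T_pos by simp
      ultimately show ?thesis unfolding mirror.loop_def using y_neg[of "t2 + s * T"] by simp
    qed
    show "Im (mirror.loop t2 s) > 0" if "1/2 < s" "s < 1" for s
    proof -
      have "1/2 * T < s * T" "s * T < 1 * T" using that T_pos by (intro mult_strict_right_mono; simp)+
      then have "t1 < t2 + s * T - T" "t2 + s * T - T < t2" by (simp_all add: T_def)
      then have "Im (z (t2 + s * T - T)) > 0" by (rule y_pos)
      then show ?thesis unfolding mirror.loop_def using z_T[of "t2 + s * T - T"] by simp
    qed
    show "- p \<notin> path_image (mirror.loop t2)"
      unfolding mirror.path_image_loop by (rule between_notin_orbit(2)[OF p])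
  qed (use p mirror.path_loop mirror.loop_closed in auto)
  then show ?thesis using mirror.winding_number_loop[OF between_notin_orbit(2)[OF p], of b t2] by simp
qed

lemma midpoint:
  obtains p where "Im p = 0" "Re (z t2) < Re p" "Re p < Re (z t1)"
proof -
  have "Re (z t2) < Re (z t1)" using x_decreasing[of t1 t2] t12 by simp
  then show thesis using that[of "of_real ((Re (z t2) + Re (z t1)) / 2)"] by simp
qed

lemma counter_clockwise_orbit: "counter_clockwise (orbit.loop b)"
proof -
  obtain p where p: "Im p = 0" "Re (z t2) < Re p" "Re p < Re (z t1)" by (rule midpoint)
  show ?thesis
    unfolding counter_clockwise_def
    using orbit.winding_number_loop_inside(2)[OF between_notin_orbit(1)[OF p]] winding_orbit[OF p] by simp
qed

text \<open>\<open>counter_clockwise\<close> quantifies over all inside points, so its failure needs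
  an actual one; \<open>- p\<close> serves.\<close>

lemma not_counter_clockwise_mirror: "\<not> counter_clockwise (mirror.loop b)"
proof -
  obtain p where p: "Im p = 0" "Re (z t2) < Re p" "Re p < Re (z t1)" by (rule midpoint)
  have "- p \<in> inside (path_image (mirror.loop b))"
    using mirror.winding_number_loop_inside(1)[OF between_notin_orbit(2)[OF p]] winding_mirror[OF p] by simp
  moreover have "winding_number (mirror.loop b) (- p) \<noteq> 1" using winding_mirror[OF p] by simp
  ultimately show ?thesis unfolding counter_clockwise_def by blast
qed

text \<open>If \<open>Re (z t2) > 0\<close>, a half-plane separates the orbit from 0. Otherwise 0
  lies on the orbit or strictly between \<open>z t2\<close> and \<open>z t1\<close>, where the
  winding number is 1.\<close>

lemma outside_orbit: "0 \<in> outside (path_image (orbit.loop b)) \<longleftrightarrow> Re (z t2) > 0"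
proof
  assume out: "0 \<in> outside (path_image (orbit.loop b))"
  show "Re (z t2) > 0"
  proof (rule ccontr)
    assume n: "\<not> Re (z t2) > 0"
    have "winding_number (orbit.loop b) 0 \<noteq> 0" if "0 \<notin> range z"
    proof -
      have "Re (z t2) \<noteq> 0"
      proof
        assume "Re (z t2) = 0"
        then have "z t2 = 0" using y2 by (simp add: complex_eq_iff)
        then show False using that by (metis rangeI)
      qed
      then show ?thesis using n x1_pos winding_orbit[of 0 b] by simp
    qed
    then show False using orbit.not_in_outside[of 0 b] out by blast
  qed
next
  assume x2: "Re (z t2) > 0"
  have "path_image (orbit.loop b) \<subseteq> {w. Re w > 0}"
    unfolding orbit.path_image_loop by (auto intro: less_le_trans[OF x2 x_range(1)])
  then show "0 \<in> outside (path_image (orbit.loop b))"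
    by (rule subsetD[OF outside_subset_convex[OF convex_halfspace_Re_gt[of 0]]]) simp
qed

lemma outside_mirror: "0 \<in> outside (path_image (mirror.loop b)) \<longleftrightarrow> Re (z t2) > 0"
proof
  assume out: "0 \<in> outside (path_image (mirror.loop b))"
  show "Re (z t2) > 0"
  proof (rule ccontr)
    assume n: "\<not> Re (z t2) > 0"
    have "winding_number (mirror.loop b) 0 \<noteq> 0" if "0 \<notin> range (\<lambda>t. - cnj (z t))"
    proof -
      have "Re (z t2) \<noteq> 0"
      proof
        assume "Re (z t2) = 0"
        then have "- cnj (z t2) = 0" using y2 by (simp add: complex_eq_iff)
        then show False using that by (metis rangeI)
      qed
      then show ?thesis using n x1_pos winding_mirror[of 0 b] by simp
    qed
    then show False using mirror.not_in_outside[of 0 b] out by blast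
  qed
next
  assume x2: "Re (z t2) > 0"
  have "path_image (mirror.loop b) \<subseteq> {w. Re w < 0}"
    unfolding mirror.path_image_loop by (auto intro: less_le_trans[OF x2 x_range(1)])
  then show "0 \<in> outside (path_image (mirror.loop b))"
    by (rule subsetD[OF outside_subset_convex[OF convex_halfspace_Re_lt[of 0]]]) simp
qed

lemma countable_zeros: "countable {t. z t = 0}"
proof (cases "\<exists>s. z s = 0")
  case True
  then obtain s where s: "z s = 0" by blast
  have "{t. z t = 0} \<subseteq> range (\<lambda>k::int. s + of_int k * T)"
  proof
    fix t assume "t \<in> {t. z t = 0}"
    then have "z t = z s" using s by simp
    then obtain k :: int where "t - s = of_int k * T" using z_eq_iff by blast
    then have "t = s + of_int k * T" by simp
    then show "t \<in> range (\<lambda>k::int. s + of_int k * T)" by blast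
  qed
  then show ?thesis using countable_subset countable_image uncountable_def by (metis countableI_type)
qed auto

text \<open>The integrand differs from \<open>K\<close>, the derivative of \<open>\<theta>\<close>,
  at most at the countably many zeros of \<open>z\<close>, where \<open>g 0\<close> is
  arbitrary.\<close>

lemma total_curvature:
  "(\<integral>\<^sup>+t\<in>{a..a + T}. ennreal (g (cmod (z t))) \<partial>lborel) = ennreal D"
proof -
  have "AE t in lborel. z t \<noteq> 0"
    using AE_not_in[OF countable_imp_null_set_lborel[OF countable_zeros]] by simp
  then have "(\<integral>\<^sup>+t. ennreal (g (cmod (z t))) * indicator {a..a + T} t \<partial>lborel) =
      (\<integral>\<^sup>+t. ennreal (K t) * indicator {a..a + T} t \<partial>lborel)"
    by (rule nn_integral_cong_AE[OF eventually_mono]) (simp add: Kz)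
  also have "\<dots> = ennreal (\<theta> (a + T) - \<theta> a)"
  proof (rule nn_integral_FTC_Icc)
    show "K \<in> borel_measurable borel" by (rule borel_measurable_continuous_onI[OF K_cont])
  qed (use K_nonneg T_pos \<theta>' in auto)
  finally show ?thesis by (simp add: \<theta>_T)
qed

lemma total_curvature_neg:
  "(\<integral>\<^sup>+t\<in>{a..a + T}. ennreal (- g (cmod (z t))) \<partial>lborel) = 0"
proof -
  have "AE t in lborel. z t \<noteq> 0"
    using AE_not_in[OF countable_imp_null_set_lborel[OF countable_zeros]] by simp
  then have "(\<integral>\<^sup>+t. ennreal (- g (cmod (z t))) * indicator {a..a + T} t \<partial>lborel) =
      (\<integral>\<^sup>+t. 0 \<partial>(lborel :: real measure))"
    by (rule nn_integral_cong_AE[OF eventually_mono])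
      (simp add: ennreal_neg less_imp_le[OF g_pos])
  then show ?thesis by simp
qed

end

section \<open>Extension of closed maximal solutions\<close>

context flow
begin

lemma flow_constant:
  assumes "z * of_real (f (cmod z)) = 1"
  shows "\<Phi> t z = z"
proof -
  have "z \<noteq> 0" using assms by auto
  have "rhs z = \<i> * (z * of_real (f (cmod z))) - \<i>" by (simp add: rhs_def mult.assoc)
  then have "rhs z = 0" by (simp only: assms) simp
  then have "(\<lambda>t. z) t = \<Phi> (t - 0) ((\<lambda>t. z) 0)"
    using \<open>z \<noteq> 0\<close> by (intro flow_unique[of UNIV]) auto
  then show ?thesis by simp
qed

end

locale solution_path = flow +
  fixes J :: "real set" and c :: "real \<Rightarrow> complex"
  assumes path: "(J, c) \<in> arclength_paths"
    and curvature: "\<And>t. t \<in> J \<Longrightarrow> c t \<noteq> 0 \<Longrightarrow> curvature (J, c) t = f (cmod (c t))"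
begin

definition "\<theta> = tangent_angle (J, c)"
definition "\<kappa> = curvature (J, c)"
definition "w = zpath (J, c)"
definition "Z t = \<Phi> t (w 0)"

lemma J: "open J" "is_interval J" "0 \<in> J"
  using path by (auto simp: arclength_paths_def)

lemma c': "t \<in> J \<Longrightarrow> (c has_vector_derivative cis (\<theta> t)) (at t)"
  unfolding \<theta>_def by (rule tangent_angle(3)[OF path])

lemma \<theta>': "t \<in> J \<Longrightarrow> (\<theta> has_real_derivative \<kappa> t) (at t)"
  unfolding \<theta>_def \<kappa>_def by (rule tangent_angle(4)[OF path])

lemma w_eq: "w t = - \<i> * cnj (c t) * cis (\<theta> t)"
  by (simp add: w_def zpath_def \<theta>_def)

lemma cmod_w: "cmod (w t) = cmod (c t)"
  by (simp add: w_eq norm_mult)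

lemma w': "t \<in> J \<Longrightarrow> (w has_vector_derivative \<i> * of_real (\<kappa> t) * w t - \<i>) (at t)"
proof -
  assume t: "t \<in> J"
  have "w = (\<lambda>t. - \<i> * cnj (c t) * cis (\<theta> t))" using w_eq by (rule ext)
  then show ?thesis using rolling_derivative[of c \<theta> t "\<kappa> t", OF c'[OF t] \<theta>'[OF t]] by (simp only:)
qed

lemma \<kappa>_eq: "t \<in> J \<Longrightarrow> w t \<noteq> 0 \<Longrightarrow> \<kappa> t = f (cmod (w t))"
  using curvature[of t] cmod_w[of t] by (metis \<kappa>_def norm_eq_zero)

lemma w_isolated: "t \<in> J \<Longrightarrow> w t = 0 \<Longrightarrow> eventually (\<lambda>s. w s \<noteq> 0) (at t)"
  using eventually_neq_0_of_derivative[OF w'] by simp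

lemma w_flow: "s \<in> J \<Longrightarrow> t \<in> J \<Longrightarrow> w t = \<Phi> (t - s) (w s)"
proof (rule flow_unique[of J])
  show "continuous_on J w"
    using w' by (meson continuous_at_imp_continuous_on has_vector_derivative_continuous)
  show "(w has_vector_derivative rhs (w t)) (at t)" if "t \<in> J" "w t \<noteq> 0" for t
    using w'[OF that(1)] \<kappa>_eq[OF that] by (simp add: rhs_def mult_ac)
qed (use J w_isolated in auto)

lemma w_eq_Z: "t \<in> J \<Longrightarrow> w t = Z t"
  using w_flow[OF J(3)] by (simp add: Z_def)

lemma Z_add: "Z (s + t) = \<Phi> s (Z t)"
  by (simp add: Z_def flow_add)

lemma Z_cont: "continuous_on S Z"
  unfolding Z_def[abs_def] by (intro continuous_flow continuous_intros)

lemma \<kappa>_smooth: "smooth_on J \<kappa>"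
proof (rule smooth_on_cong[OF J(1) _ smooth_on_derivative])
  show "\<kappa> t = vector_derivative \<theta> (at t)" if "t \<in> J" for t
    using \<theta>'[OF that] by (simp add: has_real_derivative_iff_has_vector_derivative vector_derivative_at)
  show "smooth_on J \<theta>" unfolding \<theta>_def by (rule tangent_angle(1)[OF path])
qed

text \<open>The curvature of the solution swept out by the whole orbit. The limit fills in the value at a
  zero of the orbit; it exists as soon as \<open>c\<close> itself passes through \<open>0\<close>.\<close>

definition "K t = Lim (at t) (\<lambda>s. f (cmod (Z s)))"

lemma K_nonzero:
  assumes "Z t \<noteq> 0"
  shows "K t = f (cmod (Z t))"
  unfolding K_def
proof (rule tendsto_Lim)
  have "isCont (\<lambda>s. f (cmod (Z s))) t"
  proof (rule isCont_o2[where g = f])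
    show "isCont (\<lambda>s. cmod (Z s)) t"
      using Z_cont[of UNIV] by (intro continuous_intros) (simp add: continuous_on_eq_continuous_at)
    show "isCont f (cmod (Z t))" using DERIV_isCont[OF f_derivative] assms by simp
  qed
  then show "((\<lambda>s. f (cmod (Z s))) \<longlongrightarrow> f (cmod (Z t))) (at t)" by (simp add: isCont_def)
qed simp

text \<open>\<open>\<kappa>\<close> is continuous and equals \<open>f (|Z|)\<close> off the isolated
  zeros; so the limit exists even if \<open>c t = 0\<close>.\<close>

lemma curvature_limit:
  assumes t: "t \<in> J"
  shows "((\<lambda>s. f (cmod (Z s))) \<longlongrightarrow> \<kappa> t) (at t)"
proof -
  have "isCont \<kappa> t" using smooth_on_continuous[OF \<kappa>_smooth] J(1) t continuous_on_eq_continuous_at by blast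
  then have "(\<kappa> \<longlongrightarrow> \<kappa> t) (at t)" by (simp add: isCont_def)
  moreover have "eventually (\<lambda>s. \<kappa> s = f (cmod (Z s))) (at t)"
  proof -
    have "eventually (\<lambda>s. w s \<noteq> 0) (at t)"
    proof (cases "w t = 0")
      case False
      then show ?thesis
        using tendsto_imp_eventually_ne[OF has_vector_derivative_continuous[OF w'[OF t], unfolded continuous_at]] by blast
    qed (rule w_isolated[OF t])
    moreover have "eventually (\<lambda>s. s \<in> J) (at t)"
      using eventually_nhds_in_open[OF J(1) t] unfolding eventually_at_filter by (rule eventually_mono) simp
    ultimately show ?thesis
      by eventually_elim (simp add: \<kappa>_eq w_eq_Z)
  qed
  ultimately show ?thesis by (rule Lim_transform_eventually)
qed

text \<open>The orbit is at 0 at both times and continues from there in the same way, so their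
  difference is a period.\<close>

lemma Z_shift:
  assumes "ts \<in> J" "c ts = 0" "Z t = 0"
  shows "Z (s + (ts - t)) = Z s"
proof -
  have "Z ts = 0" using assms(1,2) w_eq_Z[of ts] cmod_w[of ts] by auto
  have "Z (s + (ts - t)) = Z ((s - t) + ts)" by (simp add: algebra_simps)
  also have "\<dots> = \<Phi> (s - t) 0" by (simp only: Z_add \<open>Z ts = 0\<close>)
  also have "\<dots> = Z ((s - t) + t)" by (simp only: Z_add assms(3))
  finally show ?thesis by simp
qed

text \<open>Off the zeros of \<open>Z\<close> smoothness comes from the ODE. At a zero nothing is
  known about \<open>f\<close>, and regularity is transported by \<open>Z_shift\<close> from a time
  \<open>ts\<close> at which the given smooth path itself passes through 0.\<close>

lemma K_regular:
  assumes "Z t \<noteq> 0 \<or> (\<exists>ts\<in>J. c ts = 0)"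
  shows "(\<exists>U. t \<in> U \<and> open U \<and> smooth_on U K) \<and> (Z has_vector_derivative \<i> * of_real (K t) * Z t - \<i>) (at t)"
proof (cases "Z t = 0")
  case False
  define U where "U = {t. Z t \<noteq> 0}"
  have Z': "(Z has_vector_derivative rhs (Z s)) (at s)" if "s \<in> U" for s
  proof -
    have "Z = (\<lambda>s. \<Phi> s (w 0))" by (rule ext) (rule Z_def)
    moreover have "\<Phi> s (w 0) \<noteq> 0" using that by (simp add: U_def Z_def)
    ultimately show ?thesis using flow_ode by simp
  qed
  have U: "open U"
    unfolding U_def by (intro open_Collect_neq Z_cont continuous_on_const)
  moreover have "smooth_on U K"
  proof (rule smooth_on_cong[OF U])
    show "smooth_on U (\<lambda>t. f (cmod (Z t)))"
      by (rule smooth_on_orbit_functions[OF U _ Z' orbit_fun[OF smooth]]) (auto simp: U_def)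
  qed (simp add: U_def K_nonzero)
  moreover have "t \<in> U" using False by (simp add: U_def)
  moreover have "(Z has_vector_derivative \<i> * of_real (K t) * Z t - \<i>) (at t)"
    using Z'[OF \<open>t \<in> U\<close>] by (simp add: rhs_def K_nonzero[OF False] mult_ac)
  ultimately show ?thesis by blast
next
  case True
  then obtain ts where ts: "ts \<in> J" "c ts = 0" using assms by blast
  define a where "a = ts - t"
  have shift: "Z (s + a) = Z s" for s
    unfolding a_def by (rule Z_shift[OF ts True])
  define U where "U = (\<lambda>s. - a + s) ` J"
  have Ua: "s + a \<in> J" if "s \<in> U" for s using that by (auto simp: U_def)
  have U: "open U" "t \<in> U"
    unfolding U_def using J(1) ts(1) by (auto simp: open_translation a_def image_iff)
  have K: "K s = \<kappa> (s + a)" if "s \<in> U" for s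
    unfolding K_def
  proof (rule tendsto_Lim)
    have "((\<lambda>r. f (cmod (Z (r + a)))) \<longlongrightarrow> \<kappa> (s + a)) (at (s + a - a))"
      by (rule LIM_offset[OF curvature_limit[OF Ua[OF that]]])
    then show "((\<lambda>r. f (cmod (Z r))) \<longlongrightarrow> \<kappa> (s + a)) (at s)" by (simp add: shift)
  qed simp
  have "smooth_on U (\<lambda>s. \<kappa> (s - - a))"
    unfolding U_def by (rule smooth_on_shift[OF J(1) \<kappa>_smooth])
  then have "smooth_on U K" by (intro smooth_on_cong[OF U(1), of K]) (simp_all add: K)
  moreover have "(Z has_vector_derivative \<i> * of_real (K t) * Z t - \<i>) (at t)"
  proof -
    have "((\<lambda>s. w (s + a)) has_vector_derivative \<i> * of_real (\<kappa> (t + a)) * w (t + a) - \<i>) (at t)"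
      by (rule has_vector_derivative_shift[OF w'[OF Ua[OF U(2)]]])
    then have "((\<lambda>s. w (s + a)) has_vector_derivative \<i> * of_real (K t) * Z t - \<i>) (at t)"
      by (simp only: K[OF U(2)] w_eq_Z[OF Ua[OF U(2)]] shift)
    moreover have "w (s + a) = Z s" if "s \<in> U" for s using w_eq_Z[OF Ua[OF that]] shift by simp
    ultimately show ?thesis
      using has_vector_derivative_transform_within_open[OF _ U] by blast
  qed
  ultimately show ?thesis using U by blast
qed

lemma K_eq_\<kappa>: "t \<in> J \<Longrightarrow> K t = \<kappa> t"
  unfolding K_def by (rule tendsto_Lim[OF _ curvature_limit]) simp_all

text \<open>The interval to which the solution is extended. If \<open>c\<close> passes through 0, no
  zero of the orbit is an obstacle; otherwise the extension stops at the zeros.\<close>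

definition "I = (if \<exists>ts\<in>J. c ts = 0 then UNIV else connected_component_set {t. Z t \<noteq> 0} 0)"

lemma I: "open I" "is_interval I" "J \<subseteq> I"
  and I_regular: "t \<in> I \<Longrightarrow> Z t \<noteq> 0 \<or> (\<exists>ts\<in>J. c ts = 0)"
  and I_end: "I \<noteq> UNIV \<Longrightarrow> \<exists>b. b \<in> closure I \<and> Z b = 0" "I \<noteq> UNIV \<Longrightarrow> t \<in> I \<Longrightarrow> Z t \<noteq> 0"
proof -
  let ?V = "{t. Z t \<noteq> 0}"
  have V: "open ?V" by (intro open_Collect_neq Z_cont continuous_on_const)
  have "open I \<and> is_interval I \<and> J \<subseteq> I \<and> (t \<in> I \<longrightarrow> Z t \<noteq> 0 \<or> (\<exists>ts\<in>J. c ts = 0)) \<and>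
    (I \<noteq> UNIV \<longrightarrow> (\<exists>b. b \<in> closure I \<and> Z b = 0) \<and> (t \<in> I \<longrightarrow> Z t \<noteq> 0))"
  proof (cases "\<exists>ts\<in>J. c ts = 0")
    case True
    then have "I = UNIV" by (simp add: I_def)
    then show ?thesis using True by simp
  next
    case False
    then have I: "I = connected_component_set ?V 0" unfolding I_def by simp
    have oI: "open I" unfolding I by (rule open_connected_component[OF V])
    have cI: "connected I" unfolding I by simp
    have IV: "I \<subseteq> ?V" unfolding I by (rule connected_component_subset)
    have JV: "J \<subseteq> ?V"
    proof
      fix t assume t: "t \<in> J"
      then have "c t \<noteq> 0" using False by blast
      then have "w t \<noteq> 0" using cmod_w[of t] by auto
      then show "t \<in> ?V" using w_eq_Z[OF t] by simp
    qed
    have JI: "J \<subseteq> I" unfolding I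
      by (rule connected_component_maximal[OF J(3) is_interval_connected[OF J(2)] JV])
    have "\<exists>b. b \<in> closure I \<and> Z b = 0" if "I \<noteq> UNIV"
    proof (rule ccontr)
      assume no: "\<not> ?thesis"
      \<comment> \<open>Without a zero on its boundary the component would contain its closure,
        hence be open and closed in the line.\<close>
      then have sub: "closure I \<subseteq> ?V" by blast
      have "closure I \<subseteq> connected_component_set ?V 0"
        by (rule connected_component_maximal[OF _ connected_imp_connected_closure[OF cI] sub])
          (use JI J(3) closure_subset in blast)
      then have "closed I" using I closure_subset_eq by metis
      then have "I = {} \<or> I = UNIV" using oI clopen by blast
      then show False using that JI J(3) by blast
    qed
    then show ?thesis using oI cI IV JI by (auto simp: is_interval_connected_1)
  qed
  then show "open I" "is_interval I" "J \<subseteq> I" "t \<in> I \<Longrightarrow> Z t \<noteq> 0 \<or> (\<exists>ts\<in>J. c ts = 0)"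
    "I \<noteq> UNIV \<Longrightarrow> \<exists>b. b \<in> closure I \<and> Z b = 0" "I \<noteq> UNIV \<Longrightarrow> t \<in> I \<Longrightarrow> Z t \<noteq> 0" by auto
qed

lemma Z': "t \<in> I \<Longrightarrow> (Z has_vector_derivative \<i> * of_real (K t) * Z t - \<i>) (at t)"
  using K_regular[OF I_regular] by blast

lemma K_smooth: "smooth_on I K"
  by (rule smooth_on_locally) (use K_regular[OF I_regular] in blast)

text \<open>The angle is the integral of \<open>K\<close> and the path is recovered from it and
  \<open>Z\<close>. The initial value \<open>\<theta> 0\<close> makes it agree with \<open>c\<close>
  on \<open>J\<close>, where \<open>K = \<kappa>\<close>.\<close>

lemma extension:
  obtains d \<Theta> where "(I, d) \<in> arclength_paths" "\<And>t. t \<in> J \<Longrightarrow> d t = c t"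
    "\<And>t. t \<in> I \<Longrightarrow> (d has_vector_derivative cis (\<Theta> t)) (at t)"
    "\<And>t. t \<in> I \<Longrightarrow> (\<Theta> has_real_derivative K t) (at t)"
    "\<And>t. Z t = - \<i> * cnj (d t) * cis (\<Theta> t)"
    "\<And>t. d t \<noteq> 0 \<Longrightarrow> K t = f (cmod (d t))"
proof -
  have I0: "0 \<in> I" using I(3) J(3) by blast
  obtain \<Theta> where \<Theta>: "\<And>t. t \<in> I \<Longrightarrow> (\<Theta> has_real_derivative K t) (at t)" "\<Theta> 0 = \<theta> 0"
    using interval_antiderivative[OF I(1,2) I0 smooth_on_continuous[OF K_smooth], of "\<theta> 0"] by metis
  define d where "d t = - \<i> * cnj (Z t) * cis (\<Theta> t)" for t
  have Zd: "Z t = - \<i> * cnj (d t) * cis (\<Theta> t)" for t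
    by (rule rolling_inverse) (simp add: d_def)
  have d': "(d has_vector_derivative cis (\<Theta> t)) (at t)" if t: "t \<in> I" for t
  proof -
    have "((\<lambda>t. - \<i> * cnj (Z t) * cis (\<Theta> t)) has_vector_derivative
       (- \<i> * cnj (Z t)) * (\<i> * of_real (K t) * cis (\<Theta> t)) + (- \<i> * cnj (\<i> * of_real (K t) * Z t - \<i>)) * cis (\<Theta> t)) (at t)"
      by (intro has_vector_derivative_mult has_vector_derivative_mult_right has_vector_derivative_cnj
          Z'[OF t] has_vector_derivative_cis \<Theta>(1)[OF t])
    moreover have "(- \<i> * cnj (Z t)) * (\<i> * of_real (K t) * cis (\<Theta> t)) +
        (- \<i> * cnj (\<i> * of_real (K t) * Z t - \<i>)) * cis (\<Theta> t) = cis (\<Theta> t)"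
      by (simp add: algebra_simps)
    moreover have "d = (\<lambda>t. - \<i> * cnj (Z t) * cis (\<Theta> t))" by (rule ext) (rule d_def)
    ultimately show ?thesis by (simp only:)
  qed
  have "smooth_on I \<Theta>"
    by (rule smooth_on_from_derivative[OF I(1) _ K_smooth])
      (use \<Theta>(1) in \<open>simp add: has_real_derivative_iff_has_vector_derivative\<close>)
  then have "smooth_on I d"
    using smooth_on_from_derivative[OF I(1) d' smooth_on_cis[OF I(1)]] by blast
  then have path: "(I, d) \<in> arclength_paths"
    unfolding arclength_paths_def using I I0 vector_derivative_at[OF d'] by simp
  have "\<Theta> t = \<theta> t" if t: "t \<in> J" for t
  proof -
    have "(\<Theta> t - \<theta> t) = (\<Theta> 0 - \<theta> 0)"
    proof (rule interval_constant[OF J(2) t J(3)])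
      fix s assume s: "s \<in> J"
      have "((\<lambda>t. \<Theta> t - \<theta> t) has_real_derivative K s - \<kappa> s) (at s)"
        using s I(3) by (intro DERIV_diff \<Theta>(1) \<theta>') auto
      then show "((\<lambda>t. \<Theta> t - \<theta> t) has_vector_derivative 0) (at s)"
        using K_eq_\<kappa>[OF s] by (simp add: has_real_derivative_iff_has_vector_derivative)
    qed
    then show ?thesis using \<Theta>(2) by simp
  qed
  then have "d t = c t" if "t \<in> J" for t
    using rolling_inverse[OF w_eq, of t] w_eq_Z[OF that] that by (simp add: d_def)
  moreover have "K t = f (cmod (d t))" if "d t \<noteq> 0" for t
  proof -
    have "cmod (d t) = cmod (Z t)" by (simp add: d_def norm_mult)
    then show ?thesis using that K_nonzero[of t] by (metis norm_eq_zero)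
  qed
  ultimately show thesis using that[OF path _ d' \<Theta>(1) Zd] by blast
qed

end

section \<open>Representatives of oriented curves\<close>

lemma oriented_curve_members:
  assumes C: "C \<in> oriented_curves" and p: "(J, c) \<in> C"
  shows "(J, c) \<in> arclength_paths" "trace C = c ` J"
    "\<And>J' c'. (J', c') \<in> C \<Longrightarrow> \<exists>a. \<forall>t\<in>J'. t - a \<in> J \<and> c' t = c (t - a)"
proof -
  obtain J0 c0 where C0: "C = same_curve `` {(J0, c0)}"
    using C unfolding oriented_curves_def quotient_def by auto
  have mem: "(J', c') \<in> arclength_paths \<and> (\<exists>\<alpha>. J' = (\<lambda>t. \<alpha> + t) ` J0 \<and> (\<forall>t\<in>J'. c' t = c0 (t - \<alpha>)))"
    if "(J', c') \<in> C" for J' c'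
    using that unfolding C0 same_curve_def by auto
  show "(J, c) \<in> arclength_paths" using mem[OF p] by blast
  obtain \<alpha> where \<alpha>: "J = (\<lambda>t. \<alpha> + t) ` J0" "\<forall>t\<in>J. c t = c0 (t - \<alpha>)" using mem[OF p] by blast
  have img: "c' ` J' = c0 ` J0" if m: "(J', c') \<in> C" for J' c'
  proof -
    obtain \<beta> where \<beta>: "J' = (\<lambda>t. \<beta> + t) ` J0" "\<forall>t\<in>J'. c' t = c0 (t - \<beta>)" using mem[OF m] by blast
    have "c' ` J' = (\<lambda>t. c0 (t - \<beta>)) ` J'" using \<beta>(2) by (intro image_cong) auto
    also have "\<dots> = c0 ` J0" unfolding \<beta>(1) image_image by simp
    finally show ?thesis .
  qed
  have "trace C = c0 ` J0" unfolding trace_def using img p by fast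
  then show "trace C = c ` J" using img[OF p] by simp
  show "\<exists>a. \<forall>t\<in>J'. t - a \<in> J \<and> c' t = c (t - a)" if m: "(J', c') \<in> C" for J' c'
  proof -
    obtain \<beta> where \<beta>: "J' = (\<lambda>t. \<beta> + t) ` J0" "\<forall>t\<in>J'. c' t = c0 (t - \<beta>)" using mem[OF m] by blast
    have "t - (\<beta> - \<alpha>) \<in> J \<and> c' t = c (t - (\<beta> - \<alpha>))" if t: "t \<in> J'" for t
    proof -
      obtain s where s: "s \<in> J0" "t = \<beta> + s" using t \<beta>(1) by blast
      then have e: "t - (\<beta> - \<alpha>) = \<alpha> + s" by simp
      have m: "\<alpha> + s \<in> J" using s(1) \<alpha>(1) by blast
      show ?thesis
        unfolding e using m \<alpha>(2)[rule_format, OF m] \<beta>(2)[rule_format, OF t] s(2) by simp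
    qed
    then show ?thesis by blast
  qed
qed

lemma oriented_curve_nonempty: "C \<in> oriented_curves \<Longrightarrow> C \<noteq> {}"
proof -
  assume "C \<in> oriented_curves"
  then obtain J0 c0 where C0: "C = same_curve `` {(J0, c0)}" "(J0, c0) \<in> arclength_paths"
    unfolding oriented_curves_def quotient_def by auto
  then have "(J0, c0) \<in> C" by (auto simp: same_curve_def intro: exI[of _ 0])
  then show ?thesis by blast
qed

lemma solution_class:
  assumes path: "(I, d) \<in> arclength_paths"
    and d': "\<And>t. t \<in> I \<Longrightarrow> (d has_vector_derivative cis (\<Theta> t)) (at t)"
    and \<Theta>': "\<And>t. t \<in> I \<Longrightarrow> (\<Theta> has_real_derivative K t) (at t)"
    and K: "\<And>t. d t \<noteq> 0 \<Longrightarrow> K t = f (cmod (d t))"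
  shows "solution f (same_curve `` {(I, d)})" "(I, d) \<in> same_curve `` {(I, d)}"
proof -
  show "(I, d) \<in> same_curve `` {(I, d)}" using path by (auto simp: same_curve_def intro: exI[of _ 0])
  have "curvature (J, c) t = f (cmod (c t))"
    if m: "(J, c) \<in> same_curve `` {(I, d)}" and t: "t \<in> J" "c t \<noteq> 0" for J c t
  proof -
    obtain \<alpha> where \<alpha>: "(J, c) \<in> arclength_paths" "J = (\<lambda>t. \<alpha> + t) ` I" "\<forall>t\<in>J. c t = d (t - \<alpha>)"
      using m by (auto simp: same_curve_def)
    have J: "open J" using \<alpha>(1) by (simp add: arclength_paths_def)
    have sI: "s + - \<alpha> \<in> I" if "s \<in> J" for s using that \<alpha>(2) by auto
    have "(c has_vector_derivative cis (\<Theta> (s + - \<alpha>))) (at s)" if s: "s \<in> J" for s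
      by (rule has_vector_derivative_transform_within_open[OF
            has_vector_derivative_shift[OF d'[OF sI[OF s]]] J s]) (use \<alpha>(3) in simp)
    moreover have "((\<lambda>s. \<Theta> (s + - \<alpha>)) has_real_derivative K (t + - \<alpha>)) (at t)"
      using has_vector_derivative_shift[of \<Theta> "K (t + - \<alpha>)" t "- \<alpha>"] \<Theta>'[OF sI[OF t(1)]]
      by (simp add: has_real_derivative_iff_has_vector_derivative)
    ultimately have "curvature (J, c) t = K (t + - \<alpha>)"
      by (rule curvature_eqI[OF \<alpha>(1) _ t(1)])
    moreover have "c t = d (t + - \<alpha>)" using \<alpha>(3) t(1) by simp
    ultimately show ?thesis using K t(2) by simp
  qed
  moreover have "same_curve `` {(I, d)} \<in> oriented_curves"
    unfolding oriented_curves_def using path by (rule quotientI)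
  ultimately show "solution f (same_curve `` {(I, d)})" unfolding solution_def by blast
qed

text \<open>A closed maximal solution is traversed by a path defined on the whole line, even if its
  representatives are not: the path obtained from the flow could only stop at a zero \<open>b\<close> of the
  orbit, but then \<open>0\<close> would be missing from the compact trace.\<close>

lemma (in flow) closed_maximal_solution_complete:
  assumes max: "maximal_solution f C" and closed: "closed_curve C"
  obtains J c d \<Theta> K where "(J, c) \<in> C" "0 \<in> J" "open J" "\<And>t. t \<in> J \<Longrightarrow> d t = c t"
    "trace C = range d"
    "\<And>t. (d has_vector_derivative cis (\<Theta> t)) (at t)"
    "\<And>t. (\<Theta> has_real_derivative K t) (at t)"
    "continuous_on UNIV K"
    "\<And>t. \<Phi> t (base_point C) = - \<i> * cnj (d t) * cis (\<Theta> t)"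
    "\<And>t. d t \<noteq> 0 \<Longrightarrow> K t = f (cmod (d t))"
proof -
  have C: "C \<in> oriented_curves" "solution f C"
    using max by (auto simp: maximal_solution_def solution_def)
  \<comment> \<open>\<open>base_point\<close> makes this very choice, so its orbit is the one
    belonging to \<open>(J, c)\<close>.\<close>
  define p where "p = (SOME p. p \<in> C)"
  have "p \<in> C" unfolding p_def using oriented_curve_nonempty[OF C(1)] by (simp add: some_in_eq)
  moreover obtain J c where Jc: "p = (J, c)" by (cases p)
  ultimately have p: "(J, c) \<in> C" by simp
  interpret solution_path f \<Phi> J c
  proof
    show "(J, c) \<in> arclength_paths" by (rule oriented_curve_members(1)[OF C(1) p])
    show "curvature (J, c) t = f (cmod (c t))" if "t \<in> J" "c t \<noteq> 0" for t
      using C(2) p that unfolding solution_def by blast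
  qed
  obtain d \<Theta> where d: "(I, d) \<in> arclength_paths" "\<And>t. t \<in> J \<Longrightarrow> d t = c t"
    "\<And>t. t \<in> I \<Longrightarrow> (d has_vector_derivative cis (\<Theta> t)) (at t)"
    "\<And>t. t \<in> I \<Longrightarrow> (\<Theta> has_real_derivative K t) (at t)"
    "\<And>t. Z t = - \<i> * cnj (d t) * cis (\<Theta> t)"
    "\<And>t. d t \<noteq> 0 \<Longrightarrow> K t = f (cmod (d t))"
    using extension by metis
  have sol: "solution f (same_curve `` {(I, d)})" "(I, d) \<in> same_curve `` {(I, d)}"
    by (rule solution_class[OF d(1,3,4,6)]; assumption)+
  have tr': "trace (same_curve `` {(I, d)}) = d ` I"
    by (rule oriented_curve_members(2)[OF _ sol(2)]) (use sol(1) in \<open>simp add: solution_def\<close>)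
  have tr: "trace C = c ` J" by (rule oriented_curve_members(2)[OF C(1) p])
  have "c ` J = d ` J" using d(2) by (intro image_cong) auto
  \<comment> \<open>\<open>(I, d)\<close> extends \<open>(J, c)\<close>, and maximality makes the
    traces equal even if the domains differ.\<close>
  then have "trace C \<subseteq> trace (same_curve `` {(I, d)})" unfolding tr tr' using I(3) by blast
  then have trd: "trace C = d ` I" using max sol(1) tr' unfolding maximal_solution_def by blast
  have cmod_d: "cmod (d t) = cmod (Z t)" for t by (simp add: d(5) norm_mult)
  have "I = UNIV"
  proof (rule ccontr)
    assume nU: "I \<noteq> UNIV"
    obtain b where b: "b \<in> closure I" "Z b = 0" using I_end(1)[OF nU] by blast
    \<comment> \<open>Moduli are used because \<open>|d| = |Z|\<close> and \<open>Z\<close> is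
      continuous also at \<open>b\<close>, where nothing is known about the continuity of
      \<open>d\<close>.\<close>
    have cpt: "compact (cmod ` d ` I)"
      using closed trd by (auto simp: closed_curve_def intro!: compact_continuous_image continuous_intros)
    have "cmod ` d ` I = (\<lambda>t. cmod (Z t)) ` I" by (simp add: image_image cmod_d)
    then have "closed ((\<lambda>t. cmod (Z t)) ` I)" using compact_imp_closed[OF cpt] by simp
    moreover have "(\<lambda>t. cmod (Z t)) ` closure I \<subseteq> closure ((\<lambda>t. cmod (Z t)) ` I)"
      by (intro image_closure_subset continuous_intros Z_cont closure_subset closed_closure)
    ultimately have "(\<lambda>t. cmod (Z t)) b \<in> (\<lambda>t. cmod (Z t)) ` I" using b(1) closure_closed by blast
    then obtain t where "t \<in> I" "cmod (Z t) = 0" using b(2) by auto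
    then show False using I_end(2)[OF nU] by simp
  qed
  note all = d(3,4)[unfolded \<open>I = UNIV\<close>, OF UNIV_I] trd[unfolded \<open>I = UNIV\<close>]
  have base: "base_point C = w 0" unfolding base_point_def w_def p_def[symmetric] Jc ..
  show thesis
  proof (rule that[of J c d \<Theta> K, OF p J(3,1) d(2) all(3) all(1) all(2) _ _ d(6)])
    show "continuous_on UNIV K" using smooth_on_continuous[OF K_smooth] \<open>I = UNIV\<close> by simp
    show "\<Phi> t (base_point C) = - \<i> * cnj (d t) * cis (\<Theta> t)" for t
      unfolding base by (subst d(5)[symmetric]) (simp add: Z_def)
  qed
qed

section \<open>Period, net winding and twist of a periodic orbit\<close>

lemma (in periodic_loop) period_eq:
  assumes \<Phi>: "\<And>t. \<Phi> t z0 = F t" "z0 = F 0"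
  shows "period \<Phi> z0 = ereal T" "orbit_path \<Phi> z0 = loop 0"
proof -
  show *: "period \<Phi> z0 = ereal T"
    unfolding period_def
  proof (rule antisym)
    have "\<Phi> T z0 = z0" using F_shift[of 0 1] \<Phi> by simp
    then show "Inf {ereal t |t. 0 < t \<and> \<Phi> t z0 = z0} \<le> ereal T"
      using period_pos by (intro Inf_lower) blast
    show "ereal T \<le> Inf {ereal t |t. 0 < t \<and> \<Phi> t z0 = z0}"
    proof (rule Inf_greatest)
      fix x assume "x \<in> {ereal t |t. 0 < t \<and> \<Phi> t z0 = z0}"
      then obtain t where t: "x = ereal t" "0 < t" "F t = F 0" using \<Phi> by auto
      then obtain k :: int where k: "t - 0 = of_int k * T" using F_eq_iff by blast
      then have "of_int k * T > 0" using t(2) by simp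
      then have "k \<ge> 1" using period_pos by (simp add: zero_less_mult_iff)
      then have "1 * T \<le> of_int k * T" using period_pos by (intro mult_right_mono) auto
      then show "ereal T \<le> x" using k t(1) by simp
    qed
  qed
  show "orbit_path \<Phi> z0 = loop 0"
    unfolding orbit_path_def loop_def * by (simp only: \<Phi>(1) real_of_ereal.simps add_0)
qed

context half_period
begin

lemma orbit_winding:
  assumes "\<And>t. \<Phi> t z0 = z t" "z0 = z 0"
  shows "net_winding g \<Phi> z0 = ereal (D / (2 * pi))" "untwisted_orbit \<Phi> z0 \<longleftrightarrow> Re (z t2) > 0"
proof -
  note p = orbit.period_eq[of \<Phi>, OF assms]
  have "ext_integral {0..T} (\<lambda>t. g (cmod (\<Phi> t z0))) = ereal D"
    using total_curvature[of 0] total_curvature_neg[of 0] D_pos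
    by (simp add: ext_integral_def assms(1) zero_ennreal.rep_eq)
  then show "net_winding g \<Phi> z0 = ereal (D / (2 * pi))"
    using T_pos by (simp add: net_winding_def Fix_def p counter_clockwise_orbit)
  show "untwisted_orbit \<Phi> z0 \<longleftrightarrow> Re (z t2) > 0"
    by (simp add: untwisted_orbit_def Per_def p outside_orbit)
qed

text \<open>The integrand is negative and the loop is clockwise, so the two signs cancel.\<close>

lemma mirror_winding:
  assumes "\<And>t. \<Phi> t z0 = - cnj (z t)" "z0 = - cnj (z 0)"
  shows "net_winding (\<lambda>s. - g s) \<Phi> z0 = ereal (D / (2 * pi))" "untwisted_orbit \<Phi> z0 \<longleftrightarrow> Re (z t2) > 0"
proof -
  note p = mirror.period_eq[of \<Phi>, OF assms]
  have "ext_integral {0..T} (\<lambda>t. - g (cmod (\<Phi> t z0))) = - ereal D"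
    using total_curvature[of 0] total_curvature_neg[of 0] D_pos
    by (simp add: ext_integral_def assms(1) zero_ennreal.rep_eq)
  then show "net_winding (\<lambda>s. - g s) \<Phi> z0 = ereal (D / (2 * pi))"
    using T_pos by (simp add: net_winding_def Fix_def p not_counter_clockwise_mirror one_ereal_def)
  show "untwisted_orbit \<Phi> z0 \<longleftrightarrow> Re (z t2) > 0"
    by (simp add: untwisted_orbit_def Per_def p outside_mirror)
qed

lemma trace_neq_sphere: "range c \<noteq> sphere 0 r"
proof
  assume "range c = sphere 0 r"
  then have "cmod (c t) = r" for t by (metis mem_sphere_0 rangeI)
  then show False using r_decreasing[of t1 t2] t12 by (simp add: cmod_z)
qed

end

lemma constant_sign:
  fixes h :: "real \<Rightarrow> real"
  assumes "continuous_on {0<..} h" "\<And>s. s > 0 \<Longrightarrow> h s \<noteq> 0"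
  shows "(\<forall>s>0. h s > 0) \<or> (\<forall>s>0. h s < 0)"
proof (rule ccontr)
  assume "\<not> ?thesis"
  then obtain s t where st: "s > 0" "h s \<le> 0" "t > 0" "h t \<ge> 0" by (meson not_less)
  have "is_interval (h ` {0<..})"
    using connected_continuous_image[OF assms(1)] by (simp add: is_interval_connected_1)
  then have "0 \<in> h ` {0<..}"
    by (rule mem_is_interval_1_I[OF _ _ _ st(2,4)]) (use st in auto)
  then show False using assms(2) by auto
qed

context flow
begin

lemma f_monotone:
  assumes "\<And>s. s > 0 \<Longrightarrow> deriv f s \<noteq> 0"
  shows "(\<forall>s t. 0 < s \<longrightarrow> s < t \<longrightarrow> f s < f t) \<or> (\<forall>s t. 0 < s \<longrightarrow> s < t \<longrightarrow> f t < f s)"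
  using constant_sign[OF continuous_deriv_f assms]
proof
  assume pos: "\<forall>s>0. deriv f s > 0"
  have "f s < f t" if "0 < s" "s < t" for s t
  proof (rule DERIV_pos_imp_increasing[OF that(2)])
    fix x assume "s \<le> x" "x \<le> t"
    then show "\<exists>y. (f has_real_derivative y) (at x) \<and> y > 0" using f_derivative[of x] pos that by auto
  qed
  then show ?thesis by blast
next
  assume neg: "\<forall>s>0. deriv f s < 0"
  have "f t < f s" if "0 < s" "s < t" for s t
  proof (rule DERIV_neg_imp_decreasing[OF that(2)])
    fix x assume "s \<le> x" "x \<le> t"
    then show "\<exists>y. (f has_real_derivative y) (at x) \<and> y < 0" using f_derivative[of x] neg that by auto
  qed
  then show ?thesis by blast
qed

end

section \<open>Solutions on the whole line, for either sign of \<open>f\<close>\<close>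

locale complete_solution = flow +
  fixes d :: "real \<Rightarrow> complex" and \<Theta> K :: "real \<Rightarrow> real" and z0 :: complex
  assumes d': "(d has_vector_derivative cis (\<Theta> t)) (at t)"
    and \<Theta>': "(\<Theta> has_real_derivative K t) (at t)"
    and K_cont: "continuous_on UNIV K"
    and z_eq: "\<Phi> t z0 = - \<i> * cnj (d t) * cis (\<Theta> t)"
    and K_eq: "d t \<noteq> 0 \<Longrightarrow> K t = f (cmod (d t))"
    and trace_compact: "compact (range d)"
    and nonzero: "s > 0 \<Longrightarrow> f s * deriv f s \<noteq> 0"
begin

abbreviation "Z t \<equiv> \<Phi> t z0"

lemma cmod_Z: "cmod (Z t) = cmod (d t)"
  by (simp add: z_eq norm_mult)

lemma Z': "((\<lambda>t. Z t) has_vector_derivative \<i> * of_real (K t) * Z t - \<i>) (at t)"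
  using rolling_derivative[OF d' \<Theta>'] by (simp only: z_eq)

lemma K_Z: "Z t \<noteq> 0 \<Longrightarrow> K t = f (cmod (Z t))"
  using K_eq[of t] cmod_Z[of t] by (metis norm_eq_zero)

lemma Z_fixed: "Z s * of_real (f (cmod (Z s))) = 1 \<Longrightarrow> Z t = Z s"
  using flow_constant[of "Z s" "t - s"] flow_add[of "t - s" s z0] by simp

text \<open>The ODE is invariant under conjugation combined with time reversal at \<open>s\<close>,
  and the real point \<open>Z s\<close> is fixed by it; uniqueness does the rest.\<close>

lemma Z_refl:
  assumes y: "Im (Z s) = 0"
  shows "Z (s - u) = cnj (Z (s + u))"
proof -
  define W where "W u = cnj (Z (s - u))" for u
  have W': "(W has_vector_derivative \<i> * of_real (K (s - u)) * W u - \<i>) (at u)" for u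
  proof -
    have "((\<lambda>u. cnj (Z (s - u))) has_vector_derivative
        cnj (- (\<i> * of_real (K (s - u)) * Z (s - u) - \<i>))) (at u)"
      by (intro has_vector_derivative_cnj has_vector_derivative_reflect Z')
    moreover have "cnj (- (\<i> * of_real (K (s - u)) * Z (s - u) - \<i>)) =
        \<i> * of_real (K (s - u)) * W u - \<i>"
      by (simp add: W_def)
    ultimately show ?thesis unfolding W_def[abs_def] by (simp only:)
  qed
  have "W u = \<Phi> (u - 0) (W 0)"
  proof (rule flow_unique[of UNIV])
    show "continuous_on UNIV W"
      using W' by (meson continuous_at_imp_continuous_on has_vector_derivative_continuous)
    show "(W has_vector_derivative rhs (W u)) (at u)" if "W u \<noteq> 0" for u
    proof -
      have "cmod (Z (s - u)) = cmod (W u)" by (simp add: W_def)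
      then have "K (s - u) = f (cmod (W u))" using that K_Z[of "s - u"] by (simp add: W_def)
      then show ?thesis using W'[of u] by (simp add: rhs_def mult_ac)
    qed
    show "eventually (\<lambda>s. W s \<noteq> 0) (at u)" if "W u = 0" for u
      by (rule eventually_neq_0_of_derivative[OF W' _ that]) (simp add: that)
  qed auto
  moreover have "W 0 = Z s" using y by (simp add: W_def complex_eq_iff)
  ultimately have "W u = Z (s + u)" using flow_add[of u s z0] by (simp add: add.commute)
  then show ?thesis unfolding W_def by (metis complex_cnj_cnj)
qed

lemma f_mono: "(\<forall>s t. 0 < s \<longrightarrow> s < t \<longrightarrow> f s < f t) \<or> (\<forall>s t. 0 < s \<longrightarrow> s < t \<longrightarrow> f t < f s)"
  by (rule f_monotone) (use nonzero in force)

lemma f_sign: "(\<forall>s>0. f s > 0) \<or> (\<forall>s>0. f s < 0)"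
  by (rule constant_sign[OF continuous_f]) (use nonzero in force)

lemma rolling_pos:
  assumes "\<forall>s>0. f s > 0"
  shows "rolling_curve f d \<Theta> K (\<lambda>t. Z t)"
proof
  show "Im (Z s) = 0 \<Longrightarrow> Z (s - u) = cnj (Z (s + u))" for s u by (rule Z_refl)
  show "Z s * of_real (f (cmod (Z s))) = 1 \<Longrightarrow> Z t = Z s" for s t by (rule Z_fixed)
qed (use assms f_mono d' \<Theta>' K_cont K_eq z_eq trace_compact in simp_all)

text \<open>For negative \<open>f\<close> the mirror image of the solution solves the equation with \<open>- f\<close>.\<close>

lemma rolling_neg:
  assumes neg: "\<forall>s>0. f s < 0"
  shows "rolling_curve (\<lambda>s. - f s) (\<lambda>t. cnj (d t)) (\<lambda>t. - \<Theta> t) (\<lambda>t. - K t) (\<lambda>t. - cnj (Z t))"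
proof
  show "(\<forall>s t. 0 < s \<longrightarrow> s < t \<longrightarrow> - f s < - f t) \<or> (\<forall>s t. 0 < s \<longrightarrow> s < t \<longrightarrow> - f t < - f s)"
    using f_mono by auto
  show "((\<lambda>t. cnj (d t)) has_vector_derivative cis (- \<Theta> t)) (at t)" for t
    using has_vector_derivative_cnj[OF d'[of t]] by (simp add: cis_cnj)
  show "((\<lambda>t. - \<Theta> t) has_real_derivative - K t) (at t)" for t by (rule DERIV_minus[OF \<Theta>'])
  show "continuous_on UNIV (\<lambda>t. - K t)" by (intro continuous_intros K_cont)
  show "cnj (d t) \<noteq> 0 \<Longrightarrow> - K t = - f (cmod (cnj (d t)))" for t using K_eq by simp
  show "- cnj (Z t) = - \<i> * cnj (cnj (d t)) * cis (- \<Theta> t)" for t by (simp add: z_eq cis_cnj)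
  show "Im (- cnj (Z s)) = 0 \<Longrightarrow> - cnj (Z (s - u)) = cnj (- cnj (Z (s + u)))" for s u
    using Z_refl[of s u] by simp
  show "- cnj (Z s) * of_real (- f (cmod (- cnj (Z s)))) = 1 \<Longrightarrow> - cnj (Z t) = - cnj (Z s)" for s t
  proof -
    assume "- cnj (Z s) * of_real (- f (cmod (- cnj (Z s)))) = 1"
    then have "cnj (Z s * of_real (f (cmod (Z s)))) = cnj 1" by simp
    then have "Z s * of_real (f (cmod (Z s))) = 1" by (simp only: complex_cnj_cancel_iff)
    then show ?thesis using Z_fixed[of s t] by simp
  qed
  have "range (\<lambda>t. cnj (d t)) = cnj ` range d" by auto
  then show "compact (range (\<lambda>t. cnj (d t)))"
    using compact_continuous_image[OF continuous_on_cnj[OF continuous_on_id] trace_compact] by simp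
qed (use neg in simp)

lemma homeomorphic_cnj: "range (\<lambda>t. cnj (d t)) homeomorphic S \<longleftrightarrow> range d homeomorphic S"
proof -
  have "homeomorphism (range d) (range (\<lambda>t. cnj (d t))) cnj cnj"
    unfolding homeomorphism_def image_image by (auto intro!: continuous_intros)
  then have "range d homeomorphic range (\<lambda>t. cnj (d t))" unfolding homeomorphic_def by blast
  then show ?thesis using homeomorphic_trans homeomorphic_sym by metis
qed

lemma nonconstant_case:
  assumes nonconst: "Z a \<noteq> Z b"
  obtains v where "v > 0" "net_winding f \<Phi> z0 = ereal v"
    "range d homeomorphic (sphere 0 1 :: complex set) \<longleftrightarrow>
      untwisted_orbit \<Phi> z0 \<and> (\<exists>n::nat. n \<ge> 2 \<and> v = 1 / real n)"
    "\<forall>r. range d \<noteq> sphere 0 r"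
  using f_sign
proof
  have n_eq: "D = 2 * pi / real n \<longleftrightarrow> D / (2 * pi) = 1 / real n" for D and n :: nat
    by (auto simp: field_simps)
  assume pos: "\<forall>s>0. f s > 0"
  interpret rolling_curve f d \<Theta> K "\<lambda>t. Z t" by (rule rolling_pos[OF pos])
  obtain s t where st: "s < t" "Im (Z s) = 0" "Im (Z t) = 0" "\<And>u. s < u \<Longrightarrow> u < t \<Longrightarrow> Im (Z u) > 0"
    using half_period_exists[OF nonconst] by metis
  interpret half_period f d \<Theta> K "\<lambda>t. Z t" s t by standard (use st in auto)
  show thesis
    using that[of "D / (2 * pi)"] D_pos orbit_winding[of \<Phi> z0] flow_0 Jordan_iff n_eq trace_neq_sphere
    by simp
next
  have n_eq: "D = 2 * pi / real n \<longleftrightarrow> D / (2 * pi) = 1 / real n" for D and n :: nat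
    by (auto simp: field_simps)
  assume neg: "\<forall>s>0. f s < 0"
  interpret rolling_curve "\<lambda>s. - f s" "\<lambda>t. cnj (d t)" "\<lambda>t. - \<Theta> t" "\<lambda>t. - K t" "\<lambda>t. - cnj (Z t)"
    by (rule rolling_neg[OF neg])
  have "- cnj (Z a) \<noteq> - cnj (Z b)" using nonconst by simp
  then obtain s t where st: "s < t" "Im (- cnj (Z s)) = 0" "Im (- cnj (Z t)) = 0"
    "\<And>u. s < u \<Longrightarrow> u < t \<Longrightarrow> Im (- cnj (Z u)) > 0"
    using half_period_exists by metis
  interpret half_period "\<lambda>s. - f s" "\<lambda>t. cnj (d t)" "\<lambda>t. - \<Theta> t" "\<lambda>t. - K t" "\<lambda>t. - cnj (Z t)" s t
    by standard (use st in auto)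
  have "range d \<noteq> sphere 0 r" for r
  proof
    assume "range d = sphere 0 r"
    then have "cmod (d t) = r" for t by (metis mem_sphere_0 rangeI)
    then show False using r_decreasing[of s t] t12 by (simp add: cmod_Z)
  qed
  then show thesis
    using that[of "D / (2 * pi)"] D_pos mirror_winding[of \<Phi> z0] flow_0
      Jordan_iff[unfolded homeomorphic_cnj] n_eq
    by simp
qed

lemma constant_case:
  assumes const: "\<And>t. Z t = z0"
  shows "z0 \<in> Feq f" "Im z0 = 0" "untwisted_orbit \<Phi> z0" "net_winding f \<Phi> z0 = 0"
    "\<exists>\<alpha>. \<forall>t. d t = of_real (cmod z0) * cis (\<alpha> + sgn (Re z0) * t / cmod z0)"
    "range d = sphere 0 (cmod z0)"
proof -
  have "((\<lambda>t. z0) has_vector_derivative \<i> * of_real (K 0) * z0 - \<i>) (at 0)"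
    using Z'[of 0] by (simp only: const)
  then have "\<i> * of_real (K 0) * z0 - \<i> = 0"
    using vector_derivative_unique_at has_vector_derivative_const by blast
  then have "\<i> * (of_real (K 0) * z0) = \<i> * 1" by simp
  then have K0: "of_real (K 0) * z0 = 1" using mult_left_cancel[of \<i>] by simp
  then have z00: "z0 \<noteq> 0" by auto
  have Kt: "K t = f (cmod z0)" for t using K_Z[of t] const z00 by simp
  have zf: "z0 * of_real (f (cmod z0)) = 1" using K0 by (simp add: Kt mult.commute)
  then show Feq: "z0 \<in> Feq f" using z00 by (simp add: Feq_def)
  have f0: "f (cmod z0) \<noteq> 0" using zf by auto
  have z0f: "z0 = of_real (1 / f (cmod z0))" using zf f0 by (simp add: field_simps)
  then show im: "Im z0 = 0" by (metis Im_complex_of_real)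
  have re: "Re z0 = 1 / f (cmod z0)" using z0f by (metis Re_complex_of_real)
  have re0: "Re z0 \<noteq> 0" using re f0 by simp
  \<comment> \<open>At a rest point every positive time is a return time, so the infimum that
    defines the period is 0.\<close>
  have "{ereal t |t. 0 < t \<and> \<Phi> t z0 = z0} = ereal ` {0<..}" using const by auto
  moreover have "Inf (ereal ` {0<..}) = 0"
  proof (rule antisym)
    show "Inf (ereal ` {0<..}) \<le> 0"
    proof (rule ccontr)
      assume "\<not> ?thesis"
      then obtain e where "0 < ereal e" "ereal e < Inf (ereal ` {0<..})"
        using ereal_dense2[of 0 "Inf (ereal ` {0<..})"] by (auto simp: not_le)
      moreover from this have "Inf (ereal ` {0<..}) \<le> ereal e" by (intro Inf_lower) auto
      ultimately show False by simp
    qed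
    show "0 \<le> Inf (ereal ` {0<..})" by (rule Inf_greatest) auto
  qed
  ultimately have per: "period \<Phi> z0 = 0" unfolding period_def by simp
  show "net_winding f \<Phi> z0 = 0" by (simp add: net_winding_def Fix_def per)
  have "path_image (orbit_path \<Phi> z0) = {z0}"
    unfolding path_image_def orbit_path_def by (simp add: const image_constant_conv)
  then have "outside (path_image (orbit_path \<Phi> z0)) = - {z0}" by (simp add: outside_convex)
  then show "untwisted_orbit \<Phi> z0" using z00 by (simp add: untwisted_orbit_def Per_def per)
  have cm: "cmod z0 = \<bar>Re z0\<bar>" using im by (simp add: cmod_def)
  have Th: "\<Theta> t = \<Theta> 0 + t / Re z0" for t
  proof -
    have "((\<lambda>t. \<Theta> t - t / Re z0) has_real_derivative 0) (at s)" for s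
      using DERIV_diff[OF \<Theta>'[of s] DERIV_cdivide[OF DERIV_ident, of "Re z0"]] by (simp add: Kt re)
    then have "\<Theta> t - t / Re z0 = \<Theta> 0 - 0 / Re z0" by (rule DERIV_isconst_all[rule_format])
    then show ?thesis by simp
  qed
  \<comment> \<open>The sense of rotation. The factor \<open>- i \<sigma>\<close> that appears in
    \<open>d\<close> is a quarter turn, by the angle \<open>- \<sigma> pi / 2\<close>.\<close>
  define \<sigma> where "\<sigma> = sgn (Re z0)"
  have \<sigma>: "\<sigma> * cmod z0 = Re z0" "\<sigma> = 1 \<or> \<sigma> = - 1" using re0 by (auto simp: \<sigma>_def cm sgn_real_def)
  have dt: "d t = of_real (cmod z0) * cis ((\<Theta> 0 - \<sigma> * (pi / 2)) + \<sigma> * t / cmod z0)" for t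
  proof -
    have "cis (- (\<sigma> * (pi / 2))) = - \<i> * of_real \<sigma>" using \<sigma>(2) by (auto simp: complex_eq_iff)
    moreover have "\<sigma> * t / cmod z0 = t / Re z0" unfolding \<sigma>(1)[symmetric] using \<sigma>(2) by auto
    ultimately have "of_real (cmod z0) * cis ((\<Theta> 0 - \<sigma> * (pi / 2)) + \<sigma> * t / cmod z0) =
        of_real (cmod z0) * (- \<i> * of_real \<sigma>) * cis (\<Theta> t)"
      by (simp add: Th[of t] cis_mult[symmetric] diff_conv_add_uminus del: add_uminus_conv_diff)
    also have "\<dots> = - \<i> * of_real (\<sigma> * cmod z0) * cis (\<Theta> t)" by simp
    also have "\<dots> = - \<i> * cnj (Z t) * cis (\<Theta> t)"
    proof -
      have "of_real (Re z0) = cnj z0" using im by (simp add: complex_eq_iff)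
      then show ?thesis unfolding \<sigma>(1) const by simp
    qed
    also have "\<dots> = d t" by (rule rolling_inverse[OF z_eq, symmetric])
    finally show ?thesis by simp
  qed
  then show "\<exists>\<alpha>. \<forall>t. d t = of_real (cmod z0) * cis (\<alpha> + sgn (Re z0) * t / cmod z0)"
    unfolding \<sigma>_def by blast
  show "range d = sphere 0 (cmod z0)"
  proof
    show "range d \<subseteq> sphere 0 (cmod z0)" using cmod_Z const by auto
    show "sphere 0 (cmod z0) \<subseteq> range d"
    proof
      fix p :: complex assume "p \<in> sphere 0 (cmod z0)"
      then have p: "cmod p = cmod z0" by simp
      define t where "t = \<sigma> * cmod z0 * (Arg p - (\<Theta> 0 - \<sigma> * (pi / 2)))"
      have "\<sigma> * t / cmod z0 = Arg p - (\<Theta> 0 - \<sigma> * (pi / 2))"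
        using \<sigma>(2) z00 by (auto simp: t_def)
      then have "d t = of_real (cmod z0) * cis (Arg p)" unfolding dt by simp
      also have "\<dots> = p" using p z00 by (metis cis_Arg norm_eq_zero rcis_cmod_Arg rcis_def)
      finally show "p \<in> range d" by (metis rangeI)
    qed
  qed
qed

end

theorem theorem3p13:
  fixes f :: "real \<Rightarrow> real"
    and \<Phi> :: "real \<Rightarrow> complex \<Rightarrow> complex"
    and C :: "path_on set"
  assumes "smooth_on {0<..} f"
    and "\<And>s. s > 0 \<Longrightarrow> f s * deriv f s \<noteq> 0"
    and "generates_flow f \<Phi>"
    and "maximal_solution f C" and "closed_curve C"
  shows "(untwisted \<Phi> C \<and>
            (curve_winding f \<Phi> C = 0 \<or>
             (\<exists>n::nat. n \<ge> 2 \<and> curve_winding f \<Phi> C = ereal (1 / real n)))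
          \<longleftrightarrow> Jordan_solution f C) \<and>
         (curve_winding f \<Phi> C = 0 \<longleftrightarrow>
            (\<exists>z \<in> Feq f. (Re z > 0 \<and> ccw_circle (cmod z) C) \<or> (Re z < 0 \<and> cw_circle (cmod z) C)))"
proof -
  interpret flow f \<Phi> by standard (rule assms)+
  obtain J c d \<Theta> K where s: "(J, c) \<in> C" "0 \<in> J" "open J" "\<And>t. t \<in> J \<Longrightarrow> d t = c t"
    "trace C = range d"
    "\<And>t. (d has_vector_derivative cis (\<Theta> t)) (at t)"
    "\<And>t. (\<Theta> has_real_derivative K t) (at t)"
    "continuous_on UNIV K"
    "\<And>t. \<Phi> t (base_point C) = - \<i> * cnj (d t) * cis (\<Theta> t)"
    "\<And>t. d t \<noteq> 0 \<Longrightarrow> K t = f (cmod (d t))"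
    using closed_maximal_solution_complete[OF assms(4,5)] by metis
  interpret complete_solution f \<Phi> d \<Theta> K "base_point C"
    by standard (use s assms(2,5) in \<open>simp_all add: closed_curve_def\<close>)
  have Jordan: "Jordan_solution f C \<longleftrightarrow> range d homeomorphic (sphere 0 1 :: complex set)"
    using assms(4) s(5) by (simp add: Jordan_solution_def)
  show ?thesis
  proof (cases "\<forall>t. \<Phi> t (base_point C) = base_point C")
    case False
    then obtain t where "\<Phi> t (base_point C) \<noteq> \<Phi> 0 (base_point C)" using flow_0 by auto
    then obtain v where v: "v > 0" "net_winding f \<Phi> (base_point C) = ereal v"
      "range d homeomorphic (sphere 0 1 :: complex set) \<longleftrightarrow>
        untwisted_orbit \<Phi> (base_point C) \<and> (\<exists>n::nat. n \<ge> 2 \<and> v = 1 / real n)"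
      "\<forall>r. range d \<noteq> sphere 0 r"
      by (rule nonconstant_case)
    \<comment> \<open>Away from rest points the net winding is positive and the trace is no circle
      about 0, so both sides of the second equivalence fail.\<close>
    have "\<not> ccw_circle r C" "\<not> cw_circle r C" for r
      using v(4) s(5) by (simp_all add: ccw_circle_def cw_circle_def)
    then show ?thesis
      using v(1-3) Jordan by (auto simp: untwisted_def curve_winding_def)
  next
    case True
    then have "\<Phi> t (base_point C) = base_point C" for t by blast
    \<comment> \<open>At a rest point all sides of both equivalences are true.\<close>
    note const = constant_case[OF this]
    let ?z = "base_point C"
    have z0: "?z \<noteq> 0" using const(1) by (simp add: Feq_def)
    then have re0: "Re ?z \<noteq> 0" using const(2) by (auto simp: complex_eq_iff)
    obtain \<alpha> where \<alpha>: "\<And>t. d t = of_real (cmod ?z) * cis (\<alpha> + sgn (Re ?z) * t / cmod ?z)"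
      using const(5) by blast
    \<comment> \<open>The notions of circle quantify over all representatives; each is a translate
      of \<open>(J, c)\<close>, which only changes the phase.\<close>
    have rep: "\<exists>\<beta>. \<forall>t\<in>J'. c' t = of_real (cmod ?z) * cis (\<beta> + sgn (Re ?z) * t / cmod ?z)"
      if "(J', c') \<in> C" for J' c'
    proof -
      have "C \<in> oriented_curves" using assms(4) by (simp add: maximal_solution_def solution_def)
      from oriented_curve_members(3)[OF this s(1) that]
      obtain a where a: "\<forall>t\<in>J'. t - a \<in> J \<and> c' t = c (t - a)" by blast
      have "c' t = of_real (cmod ?z) * cis ((\<alpha> - sgn (Re ?z) * a / cmod ?z) + sgn (Re ?z) * t / cmod ?z)"
        if "t \<in> J'" for t
      proof -
        have "c' t = d (t - a)" using a that s(4) by simp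
        also have "\<dots> = of_real (cmod ?z) * cis ((\<alpha> - sgn (Re ?z) * a / cmod ?z) + sgn (Re ?z) * t / cmod ?z)"
          unfolding \<alpha>
          by (intro arg_cong2[where f = "(*)"] arg_cong[where f = cis] refl)
            (simp add: diff_divide_distrib right_diff_distrib)
        finally show ?thesis .
      qed
      then show ?thesis by blast
    qed
    have "(Re ?z > 0 \<and> ccw_circle (cmod ?z) C) \<or> (Re ?z < 0 \<and> cw_circle (cmod ?z) C)"
    proof (cases "Re ?z > 0")
      case True
      then show ?thesis using rep const(6) s(5) by (auto simp: ccw_circle_def)
    next
      case False
      then have "Re ?z < 0" using re0 by simp
      then show ?thesis using rep const(6) s(5) by (auto simp: cw_circle_def)
    qed
    moreover have "Jordan_solution f C"
      unfolding Jordan const(6) using z0 by (intro homeomorphic_spheres) auto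
    ultimately show ?thesis
      using const(1,3,4) by (auto simp: untwisted_def curve_winding_def)
  qed
qed

end
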